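(* Over $\mathsf{RCA}_0$, the system $\mathsf{WKL}_0$ is equivalent to the following statement: for every countable commutative ring $R$ with unity and every ideal $I\subseteq R$, if the radical $\sqrt{I}$ is a maximal ideal, then $I$ is primary.
   Context: Work in second-order arithmetic. $\mathsf{RCA}_0$ consists of the basic axioms of arithmetic, $\Sigma^0_1$-induction and $\Delta^0_1$-comprehension. $\mathsf{WKL}_0$ is $\mathsf{RCA}_0$ plus weak K\H{o}nig's lemma (every infinite binary tree has an infinite path). Rings are countable commutative rings with unity, coded as subsets of $\mathbb{N}$ with the ring operations; an ideal is a set $I\subseteq R$ with $ar+bs\in I$ for all $a,b\in I$, $r,s\in R$. The radical is $\sqrt{I}=\{a\in R:\exists n>0,\ a^n\in I\}$ (it is given by a formula and need not exist as a set). $\sqrt{I}$ is maximal means it is a proper ideal and no proper ideal strictly contains it. $I$ is primary if whenever $ab\in I$, then $a\in I$ or $b^n\in I$ for some $n$. *)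

theory Defs
  imports "HOL-Algebra.Ring"
begin

section \<open>Structures for the language of second-order arithmetic\<close>

text \<open>
  The number sort ranges over the whole type \<^typ>\<open>'a\<close>, the set sort over
  the members of the field \<open>sets_of\<close>. Nothing forces either sort to be standard:
  numbers may be nonstandard, and \<open>sets_of\<close> may be any nonempty collection of subsets.
\<close>

record 'a l2_structure =
  nzero :: 'a (\<open>\<^bold>0\<index>\<close>)
  none :: 'a (\<open>\<^bold>1\<index>\<close>)
  nadd :: "'a \<Rightarrow> 'a \<Rightarrow> 'a" (infixl \<open>\<boxplus>\<index>\<close> 65)
  nmult :: "'a \<Rightarrow> 'a \<Rightarrow> 'a" (infixl \<open>\<boxdot>\<index>\<close> 70)
  nless :: "'a \<Rightarrow> 'a \<Rightarrow> bool" (infix \<open>\<prec>\<index>\<close> 50)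
  sets_of :: "'a set set"

section \<open>Bounded formulas with number and set parameters\<close>

text \<open>
  Number variables are de Bruijn indices. The bound of a quantifier is evaluated outside
  the scope of that quantifier, so it cannot mention the bound variable. Set variables
  are never quantified and only serve as parameters.
\<close>

datatype l2_term =
    Var nat
  | Zero
  | One
  | Plus l2_term l2_term
  | Times l2_term l2_term

datatype bounded_formula =
    Equal l2_term l2_term
  | Less l2_term l2_term
  | Member l2_term nat
  | Neg bounded_formula
  | Conj bounded_formula bounded_formula
  | Disj bounded_formula bounded_formula
  | BAll l2_term bounded_formula
  | BEx l2_term bounded_formula

primrec eval_term :: "'a l2_structure \<Rightarrow> (nat \<Rightarrow> 'a) \<Rightarrow> l2_term \<Rightarrow> 'a" where
  "eval_term M e (Var i) = e i"
| "eval_term M e Zero = \<^bold>0\<^bsub>M\<^esub>"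
| "eval_term M e One = \<^bold>1\<^bsub>M\<^esub>"
| "eval_term M e (Plus s t) = eval_term M e s \<boxplus>\<^bsub>M\<^esub> eval_term M e t"
| "eval_term M e (Times s t) = eval_term M e s \<boxdot>\<^bsub>M\<^esub> eval_term M e t"

primrec holds :: "'a l2_structure \<Rightarrow> (nat \<Rightarrow> 'a set) \<Rightarrow> (nat \<Rightarrow> 'a) \<Rightarrow> bounded_formula \<Rightarrow> bool"
where
  "holds M E e (Equal s t) \<longleftrightarrow> eval_term M e s = eval_term M e t"
| "holds M E e (Less s t) \<longleftrightarrow> eval_term M e s \<prec>\<^bsub>M\<^esub> eval_term M e t"
| "holds M E e (Member t X) \<longleftrightarrow> eval_term M e t \<in> E X"
| "holds M E e (Neg p) \<longleftrightarrow> \<not> holds M E e p"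
| "holds M E e (Conj p q) \<longleftrightarrow> holds M E e p \<and> holds M E e q"
| "holds M E e (Disj p q) \<longleftrightarrow> holds M E e p \<or> holds M E e q"
| "holds M E e (BAll t p) \<longleftrightarrow>
     (\<forall>x. x \<prec>\<^bsub>M\<^esub> eval_term M e t \<longrightarrow> holds M E (case_nat x e) p)"
| "holds M E e (BEx t p) \<longleftrightarrow>
     (\<exists>x. x \<prec>\<^bsub>M\<^esub> eval_term M e t \<and> holds M E (case_nat x e) p)"

text \<open>
  The \<open>\<Sigma>\<^sup>0\<^sub>1\<close> formula \<open>\<exists>x. p(x, n, e)\<close> and the \<open>\<Pi>\<^sup>0\<^sub>1\<close> formula \<open>\<forall>x. p(x, n, e)\<close>
  as predicates of \<open>n\<close>: in \<open>p\<close> the index 0 stands for \<open>x\<close>, the index 1 for \<open>n\<close>, and the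
  higher indices for the number parameters \<open>e\<close>.
\<close>

definition sigma1 ::
  "'a l2_structure \<Rightarrow> (nat \<Rightarrow> 'a set) \<Rightarrow> (nat \<Rightarrow> 'a) \<Rightarrow> bounded_formula \<Rightarrow> 'a \<Rightarrow> bool" where
  "sigma1 M E e p n \<longleftrightarrow> (\<exists>x. holds M E (case_nat x (case_nat n e)) p)"

definition pi1 ::
  "'a l2_structure \<Rightarrow> (nat \<Rightarrow> 'a set) \<Rightarrow> (nat \<Rightarrow> 'a) \<Rightarrow> bounded_formula \<Rightarrow> 'a \<Rightarrow> bool" where
  "pi1 M E e p n \<longleftrightarrow> (\<forall>x. holds M E (case_nat x (case_nat n e)) p)"

section \<open>Models of \<open>RCA\<^sub>0\<close>\<close>

definition basic_axioms :: "'a l2_structure \<Rightarrow> bool" where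
  "basic_axioms M \<longleftrightarrow>
     (\<forall>n. n \<boxplus>\<^bsub>M\<^esub> \<^bold>1\<^bsub>M\<^esub> \<noteq> \<^bold>0\<^bsub>M\<^esub>) \<and>
     (\<forall>m n. m \<boxplus>\<^bsub>M\<^esub> \<^bold>1\<^bsub>M\<^esub> = n \<boxplus>\<^bsub>M\<^esub> \<^bold>1\<^bsub>M\<^esub> \<longrightarrow> m = n) \<and>
     (\<forall>m. m \<boxplus>\<^bsub>M\<^esub> \<^bold>0\<^bsub>M\<^esub> = m) \<and>
     (\<forall>m n. m \<boxplus>\<^bsub>M\<^esub> (n \<boxplus>\<^bsub>M\<^esub> \<^bold>1\<^bsub>M\<^esub>) = (m \<boxplus>\<^bsub>M\<^esub> n) \<boxplus>\<^bsub>M\<^esub> \<^bold>1\<^bsub>M\<^esub>) \<and>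
     (\<forall>m. m \<boxdot>\<^bsub>M\<^esub> \<^bold>0\<^bsub>M\<^esub> = \<^bold>0\<^bsub>M\<^esub>) \<and>
     (\<forall>m n. m \<boxdot>\<^bsub>M\<^esub> (n \<boxplus>\<^bsub>M\<^esub> \<^bold>1\<^bsub>M\<^esub>) = (m \<boxdot>\<^bsub>M\<^esub> n) \<boxplus>\<^bsub>M\<^esub> m) \<and>
     (\<forall>m. \<not> m \<prec>\<^bsub>M\<^esub> \<^bold>0\<^bsub>M\<^esub>) \<and>
     (\<forall>m n. m \<prec>\<^bsub>M\<^esub> n \<boxplus>\<^bsub>M\<^esub> \<^bold>1\<^bsub>M\<^esub> \<longleftrightarrow> m \<prec>\<^bsub>M\<^esub> n \<or> m = n)"

definition sigma1_induction :: "'a l2_structure \<Rightarrow> bool" where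
  "sigma1_induction M \<longleftrightarrow>
     (\<forall>p E e. range E \<subseteq> sets_of M \<longrightarrow>
        sigma1 M E e p \<^bold>0\<^bsub>M\<^esub> \<longrightarrow>
        (\<forall>n. sigma1 M E e p n \<longrightarrow> sigma1 M E e p (n \<boxplus>\<^bsub>M\<^esub> \<^bold>1\<^bsub>M\<^esub>)) \<longrightarrow>
        (\<forall>n. sigma1 M E e p n))"

definition delta1_comprehension :: "'a l2_structure \<Rightarrow> bool" where
  "delta1_comprehension M \<longleftrightarrow>
     (\<forall>p q E e. range E \<subseteq> sets_of M \<longrightarrow>
        (\<forall>n. sigma1 M E e p n \<longleftrightarrow> pi1 M E e q n) \<longrightarrow>
        (\<exists>X\<in>sets_of M. \<forall>n. n \<in> X \<longleftrightarrow> sigma1 M E e p n))"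

definition RCA0 :: "'a l2_structure \<Rightarrow> bool" where
  "RCA0 M \<longleftrightarrow> sets_of M \<noteq> {} \<and>
     basic_axioms M \<and> sigma1_induction M \<and> delta1_comprehension M"

section \<open>Pairs and functions inside a structure\<close>

definition npair :: "'a l2_structure \<Rightarrow> 'a \<Rightarrow> 'a \<Rightarrow> 'a" where
  "npair M i j = (i \<boxplus>\<^bsub>M\<^esub> j) \<boxdot>\<^bsub>M\<^esub> (i \<boxplus>\<^bsub>M\<^esub> j) \<boxplus>\<^bsub>M\<^esub> i"

definition nprod :: "'a l2_structure \<Rightarrow> 'a set \<Rightarrow> 'a set \<Rightarrow> 'a set" where
  "nprod M X Y = {npair M x y | x y. x \<in> X \<and> y \<in> Y}"

definition is_fun :: "'a l2_structure \<Rightarrow> 'a set \<Rightarrow> 'a set \<Rightarrow> 'a set \<Rightarrow> bool" where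
  "is_fun M F X Y \<longleftrightarrow> F \<subseteq> nprod M X Y \<and> (\<forall>x\<in>X. \<exists>!y. npair M x y \<in> F)"

definition app :: "'a l2_structure \<Rightarrow> 'a set \<Rightarrow> 'a \<Rightarrow> 'a" where
  "app M F x = (THE y. npair M x y \<in> F)"

section \<open>Weak Koenig's lemma\<close>

text \<open>
  The triple \<open>(k, (m, n))\<close> describes the finite set of all \<open>i < k\<close> such that
  \<open>m(i + 1) + 1\<close> divides \<open>n\<close>; by the beta-function argument every finite set of the structure
  has such a description, and the least one is its code. A finite sequence of length \<open>l\<close> is
  coded as the finite set of its pairs \<open>(i, s\<^sub>i)\<close> with \<open>i < l\<close>.
\<close>

definition is_triple :: "'a l2_structure \<Rightarrow> 'a \<Rightarrow> bool" where
  "is_triple M c \<longleftrightarrow> (\<exists>k m n. c = npair M k (npair M m n))"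

definition elems :: "'a l2_structure \<Rightarrow> 'a \<Rightarrow> 'a set" where
  "elems M c = {i. \<exists>k m n. c = npair M k (npair M m n) \<and> i \<prec>\<^bsub>M\<^esub> k \<and>
      (\<exists>q. n = (m \<boxdot>\<^bsub>M\<^esub> (i \<boxplus>\<^bsub>M\<^esub> \<^bold>1\<^bsub>M\<^esub>) \<boxplus>\<^bsub>M\<^esub> \<^bold>1\<^bsub>M\<^esub>) \<boxdot>\<^bsub>M\<^esub> q)}"

definition finite_set_code :: "'a l2_structure \<Rightarrow> 'a \<Rightarrow> bool" where
  "finite_set_code M c \<longleftrightarrow> is_triple M c \<and>
     (\<forall>d. is_triple M d \<and> elems M d = elems M c \<longrightarrow> \<not> d \<prec>\<^bsub>M\<^esub> c)"

definition binary_seq :: "'a l2_structure \<Rightarrow> 'a \<Rightarrow> 'a \<Rightarrow> bool" where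
  "binary_seq M s l \<longleftrightarrow> finite_set_code M s \<and>
     is_fun M (elems M s) {i. i \<prec>\<^bsub>M\<^esub> l} {\<^bold>0\<^bsub>M\<^esub>, \<^bold>1\<^bsub>M\<^esub>}"

definition binary_tree :: "'a l2_structure \<Rightarrow> 'a set \<Rightarrow> bool" where
  "binary_tree M T \<longleftrightarrow>
     (\<forall>s\<in>T. \<exists>l. binary_seq M s l) \<and>
     (\<forall>s\<in>T. \<forall>t. (\<exists>l. binary_seq M t l) \<and> elems M t \<subseteq> elems M s \<longrightarrow> t \<in> T)"

definition unbounded :: "'a l2_structure \<Rightarrow> 'a set \<Rightarrow> bool" where
  "unbounded M X \<longleftrightarrow> (\<forall>k. \<exists>i\<in>X. \<not> i \<prec>\<^bsub>M\<^esub> k)"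

definition path_through :: "'a l2_structure \<Rightarrow> 'a set \<Rightarrow> 'a set \<Rightarrow> bool" where
  "path_through M T F \<longleftrightarrow> is_fun M F UNIV {\<^bold>0\<^bsub>M\<^esub>, \<^bold>1\<^bsub>M\<^esub>} \<and>
     (\<forall>n. \<exists>s\<in>T. binary_seq M s n \<and> elems M s = {npair M i (app M F i) | i. i \<prec>\<^bsub>M\<^esub> n})"

definition weak_koenig_lemma :: "'a l2_structure \<Rightarrow> bool" where
  "weak_koenig_lemma M \<longleftrightarrow>
     (\<forall>T\<in>sets_of M. binary_tree M T \<and> unbounded M T \<longrightarrow>
        (\<exists>F\<in>sets_of M. path_through M T F))"

definition WKL0 :: "'a l2_structure \<Rightarrow> bool" where
  "WKL0 M \<longleftrightarrow> RCA0 M \<and> weak_koenig_lemma M"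

section \<open>Rings and ideals inside a structure\<close>

text \<open>
  The ring coded by a carrier set, two sets that code the binary operations, and two numbers.
  Being a commutative ring with unity only involves quantifiers over the elements of the
  carrier, so the external predicate \<^const>\<open>cring\<close> agrees with its internal reading.
\<close>

definition coded_ring ::
  "'a l2_structure \<Rightarrow> 'a set \<Rightarrow> 'a set \<Rightarrow> 'a set \<Rightarrow> 'a \<Rightarrow> 'a \<Rightarrow> 'a ring" where
  "coded_ring M C P T z u =
     \<lparr>carrier = C, mult = (\<lambda>a b. app M T (npair M a b)), one = u,
      zero = z, add = (\<lambda>a b. app M P (npair M a b))\<rparr>"

definition countable_rings :: "'a l2_structure \<Rightarrow> 'a ring set" where
  "countable_rings M =
     {coded_ring M C P T z u | C P T z u.
        C \<in> sets_of M \<and> P \<in> sets_of M \<and> T \<in> sets_of M \<and>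
        is_fun M P (nprod M C C) C \<and> is_fun M T (nprod M C C) C \<and>
        cring (coded_ring M C P T z u)}"

definition is_ideal :: "'a ring \<Rightarrow> 'a set \<Rightarrow> bool" where
  "is_ideal R I \<longleftrightarrow> I \<subseteq> carrier R \<and>
     (\<forall>a\<in>I. \<forall>b\<in>I. \<forall>r\<in>carrier R. \<forall>s\<in>carrier R. a \<otimes>\<^bsub>R\<^esub> r \<oplus>\<^bsub>R\<^esub> b \<otimes>\<^bsub>R\<^esub> s \<in> I)"

text \<open>
  \<open>c = a\<^sup>n\<close>, where the exponent \<open>n\<close> is a possibly nonstandard number of the structure:
  powers are given by primitive recursion inside the structure.
\<close>

definition is_power :: "'a l2_structure \<Rightarrow> 'a ring \<Rightarrow> 'a \<Rightarrow> 'a \<Rightarrow> 'a \<Rightarrow> bool" where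
  "is_power M R a n c \<longleftrightarrow>
     (\<exists>F\<in>sets_of M. is_fun M F UNIV (carrier R) \<and>
        app M F \<^bold>0\<^bsub>M\<^esub> = \<one>\<^bsub>R\<^esub> \<and>
        (\<forall>i. app M F (i \<boxplus>\<^bsub>M\<^esub> \<^bold>1\<^bsub>M\<^esub>) = app M F i \<otimes>\<^bsub>R\<^esub> a) \<and>
        app M F n = c)"

text \<open>The radical is a definable class and need not belong to \<^term>\<open>sets_of M\<close>.\<close>

definition radical :: "'a l2_structure \<Rightarrow> 'a ring \<Rightarrow> 'a set \<Rightarrow> 'a set" where
  "radical M R I =
     {a \<in> carrier R. \<exists>n c. \<^bold>0\<^bsub>M\<^esub> \<prec>\<^bsub>M\<^esub> n \<and> is_power M R a n c \<and> c \<in> I}"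

text \<open>
  Maximality of a class \<open>K\<close>, which need not be a set of the structure; the ideals compared
  with it are sets of the structure.
\<close>

definition is_maximal_ideal :: "'a l2_structure \<Rightarrow> 'a ring \<Rightarrow> 'a set \<Rightarrow> bool" where
  "is_maximal_ideal M R K \<longleftrightarrow> is_ideal R K \<and> K \<noteq> carrier R \<and>
     \<not> (\<exists>J\<in>sets_of M. is_ideal R J \<and> J \<noteq> carrier R \<and> K \<subset> J)"

definition is_primary :: "'a l2_structure \<Rightarrow> 'a ring \<Rightarrow> 'a set \<Rightarrow> bool" where
  "is_primary M R I \<longleftrightarrow>
     (\<forall>a\<in>carrier R. \<forall>b\<in>carrier R. a \<otimes>\<^bsub>R\<^esub> b \<in> I \<longrightarrow>
        a \<in> I \<or> (\<exists>n c. is_power M R b n c \<and> c \<in> I))"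

definition maximal_radical_implies_primary :: "'a l2_structure \<Rightarrow> bool" where
  "maximal_radical_implies_primary M \<longleftrightarrow>
     (\<forall>R\<in>countable_rings M. \<forall>I\<in>sets_of M.
        is_ideal R I \<longrightarrow> is_maximal_ideal M R (radical M R I) \<longrightarrow> is_primary M R I)"

end

theory Submission
  imports Defs
begin

text \<open>
  A \<open>\<Delta>\<^sub>1\<close> predicate of a model is decided by a set of the model, so a single class \<open>Dec\<close> of
  predicates, closed under bounded quantifiers and primitive recursive functions, carries the
  internal recursion theory.

  From weak Koenig's lemma: if \<open>ab \<in> I\<close>, \<open>a \<notin> I\<close> and no power of \<open>b\<close> lies in \<open>I\<close>, then
  \<open>\<surd>I + bR\<close> is a proper \<open>\<Sigma>\<^sub>1\<close> ideal, because \<open>1 = y + br\<close> gives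
  \<open>a - a y\<^sup>n \<in> I\<close> for all \<open>n\<close>. By compactness it extends to a proper ideal that is a set of
  the model, against the maximality of \<open>\<surd>I\<close>.

  Conversely, for disjoint \<open>\<Sigma>\<^sub>1\<close> classes \<open>A\<close> and \<open>B\<close> take polynomials over the field with
  two elements and an ideal \<open>I\<close> that makes \<open>x\<^sub>n\<close> nilpotent for \<open>n \<in> A\<close> and \<open>x\<^sub>n - 1\<close>
  nilpotent for \<open>n \<in> B\<close>, of an order that bounds the stage at which \<open>n\<close> is enumerated; this
  keeps \<open>I\<close> decidable. A proper ideal in the model that contains \<open>\<surd>I\<close> separates \<open>A\<close> from
  \<open>B\<close>. If there is no separating set, \<open>\<surd>I\<close> is therefore maximal in the model, although two
  further variables with \<open>yz \<in> I\<close> show that \<open>I\<close> is not primary. Finally, separation applied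
  to the nodes of a binary tree one of whose sides dies out before the other yields a path.
\<close>

section \<open>Substitution in bounded formulas\<close>

text \<open>Exponents, lengths and sizes of finite sets are elements of the model and may be
  nonstandard, so HOL's finite sums, cardinalities and ring powers do not apply to them. Powers,
  parities and codes are computed by recursion inside the model, and each induction over its numbers
  needs a formula simple enough for the induction axiom. This dictates the choice of ring. Over the
  field with two elements a polynomial is its finite support and a sum of coefficients is a parity.
  Squaring is additive, so (x + y)^d = x^d + y^d for every internal power of two d; this identity
  stands in for the binomial theorem and shows that the radical is an ideal, although it need not be
  a set of the model. Powers of two also explain the decidability of the ideal: distinct exponents
  that are congruent modulo 2^i differ by at least 2^i > i, so a relevant stage i is bounded by the
  exponents at hand. Maximality is used in a degenerate form: if nothing separates the two classes,
  no proper ideal that is a set of the model contains the radical, so there is nothing to compare it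
  with.\<close>

primrec subst_term :: "(nat \<Rightarrow> l2_term) \<Rightarrow> l2_term \<Rightarrow> l2_term" where
  "subst_term \<sigma> (Var i) = \<sigma> i"
| "subst_term \<sigma> Zero = Zero"
| "subst_term \<sigma> One = One"
| "subst_term \<sigma> (Plus s t) = Plus (subst_term \<sigma> s) (subst_term \<sigma> t)"
| "subst_term \<sigma> (Times s t) = Times (subst_term \<sigma> s) (subst_term \<sigma> t)"

definition lift_subst :: "(nat \<Rightarrow> l2_term) \<Rightarrow> nat \<Rightarrow> l2_term" where
  "lift_subst \<sigma> = case_nat (Var 0) (\<lambda>i. subst_term (\<lambda>j. Var (Suc j)) (\<sigma> i))"

primrec subst_formula ::
  "bounded_formula \<Rightarrow> (nat \<Rightarrow> l2_term) \<Rightarrow> (nat \<Rightarrow> nat) \<Rightarrow> bounded_formula" where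
  "subst_formula (Equal s t) \<sigma> \<theta> = Equal (subst_term \<sigma> s) (subst_term \<sigma> t)"
| "subst_formula (Less s t) \<sigma> \<theta> = Less (subst_term \<sigma> s) (subst_term \<sigma> t)"
| "subst_formula (Member t X) \<sigma> \<theta> = Member (subst_term \<sigma> t) (\<theta> X)"
| "subst_formula (Neg p) \<sigma> \<theta> = Neg (subst_formula p \<sigma> \<theta>)"
| "subst_formula (Conj p q) \<sigma> \<theta> = Conj (subst_formula p \<sigma> \<theta>) (subst_formula q \<sigma> \<theta>)"
| "subst_formula (Disj p q) \<sigma> \<theta> = Disj (subst_formula p \<sigma> \<theta>) (subst_formula q \<sigma> \<theta>)"
| "subst_formula (BAll t p) \<sigma> \<theta> = BAll (subst_term \<sigma> t) (subst_formula p (lift_subst \<sigma>) \<theta>)"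
| "subst_formula (BEx t p) \<sigma> \<theta> = BEx (subst_term \<sigma> t) (subst_formula p (lift_subst \<sigma>) \<theta>)"

lemma eval_subst_term:
  "eval_term M e (subst_term \<sigma> t) = eval_term M (\<lambda>i. eval_term M e (\<sigma> i)) t"
  by (induction t) simp_all

lemma eval_lift_subst:
  "(\<lambda>i. eval_term M (case_nat x e) (lift_subst \<sigma> i)) = case_nat x (\<lambda>i. eval_term M e (\<sigma> i))"
  by (rule ext) (simp add: lift_subst_def eval_subst_term split: nat.split)

lemma holds_subst_formula:
  "holds M E e (subst_formula p \<sigma> \<theta>) \<longleftrightarrow> holds M (\<lambda>i. E (\<theta> i)) (\<lambda>i. eval_term M e (\<sigma> i)) p"
  by (induction p arbitrary: e \<sigma>) (simp_all add: eval_subst_term eval_lift_subst)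

text \<open>Environments are infinite sequences. \<open>Dec_delta\<close> merges arguments into
  pairs one at a time and therefore has to know that only finitely many of them matter.\<close>

definition finitely_supported :: "((nat \<Rightarrow> 'a) \<Rightarrow> 'b) \<Rightarrow> bool" where
  "finitely_supported f \<longleftrightarrow> (\<exists>N. \<forall>e e'. (\<forall>i<N. e i = e' i) \<longrightarrow> f e = f e')"

lemma finitely_supported_const: "finitely_supported (\<lambda>e. a)"
  by (simp add: finitely_supported_def)

lemma finitely_supported_comp:
  "finitely_supported f \<Longrightarrow> finitely_supported (\<lambda>e. h (f e))"
  unfolding finitely_supported_def by metis

lemma finitely_supported_comp2:
  assumes "finitely_supported f" "finitely_supported g"
  shows "finitely_supported (\<lambda>e. h (f e) (g e))"
proof -
  obtain N1 N2 where
    *: "\<And>e e'. (\<forall>i<N1. e i = e' i) \<Longrightarrow> f e = f e'" "\<And>e e'. (\<forall>i<N2. e i = e' i) \<Longrightarrow> g e = g e'"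
    using assms unfolding finitely_supported_def by blast
  have "h (f e) (g e) = h (f e') (g e')" if "\<forall>i<max N1 N2. e i = e' i" for e e'
    using that *[of e e'] by simp
  then show ?thesis unfolding finitely_supported_def by blast
qed

lemma finitely_supported_bind:
  fixes f :: "(nat \<Rightarrow> 'a) \<Rightarrow> 'b"
  assumes "finitely_supported f"
  shows "finitely_supported (\<lambda>e x. f (case_nat x e))"
proof -
  obtain N where *: "\<And>e e'. (\<forall>i<N. e i = e' i) \<Longrightarrow> f e = f e'"
    using assms unfolding finitely_supported_def by blast
  have "f (case_nat x e) = f (case_nat x e')" if "\<forall>i<N. e i = e' i" for e e' x
    by (rule *) (use that in \<open>auto split: nat.split\<close>)
  then show ?thesis unfolding finitely_supported_def by blast
qed

lemma eval_term_finitely_supported: "finitely_supported (\<lambda>e. eval_term M e t)"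
proof (induction t)
  case (Var i)
  show ?case unfolding finitely_supported_def by (rule exI[of _ "Suc i"]) simp
qed (auto intro: finitely_supported_const finitely_supported_comp2)

lemma holds_finitely_supported: "finitely_supported (\<lambda>e. holds M E e p)"
proof (induction p)
  case (BAll t p)
  show ?case
    using finitely_supported_comp2[where h="\<lambda>b Q. \<forall>x. x \<prec>\<^bsub>M\<^esub> b \<longrightarrow> Q x",
        OF eval_term_finitely_supported[of M t] finitely_supported_bind[OF BAll]] by simp
next
  case (BEx t p)
  show ?case
    using finitely_supported_comp2[where h="\<lambda>b Q. \<exists>x. x \<prec>\<^bsub>M\<^esub> b \<and> Q x",
        OF eval_term_finitely_supported[of M t] finitely_supported_bind[OF BEx]] by simp
qed (auto intro: finitely_supported_comp2 finitely_supported_comp eval_term_finitely_supported)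

definition interleave :: "(nat \<Rightarrow> 'b) \<Rightarrow> (nat \<Rightarrow> 'b) \<Rightarrow> nat \<Rightarrow> 'b" where
  "interleave e c i = (if even i then e (i div 2) else c (i div 2))"

lemma interleave_even [simp]: "interleave e c (2 * i) = e i"
  and interleave_odd [simp]: "interleave e c (Suc (2 * i)) = c i"
  by (simp_all add: interleave_def)

lemma odd_minus_one_div_two: "odd i \<Longrightarrow> (i - Suc 0) div 2 = i div (2::nat)"
  by (elim oddE) simp

section \<open>Predicates with a bounded definition\<close>

locale rca =
  fixes M :: "'a l2_structure" (structure)
  assumes rca: "RCA0 M"
begin

text \<open>
  Even variables of a formula are the arguments of the predicate, odd ones hold number
  parameters. Thus every element of the structure and every set of \<open>sets_of M\<close> may occur
  in the \<open>\<lambda>\<close>-term to which \<open>Dec\<close> is applied.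
\<close>

definition DecP :: "(nat \<Rightarrow> 'a set) \<Rightarrow> (nat \<Rightarrow> 'a) \<Rightarrow> ((nat \<Rightarrow> 'a) \<Rightarrow> bool) \<Rightarrow> bool" where
  "DecP E c P \<longleftrightarrow> range E \<subseteq> sets_of M \<and> (\<exists>p. \<forall>e. P e \<longleftrightarrow> holds M E (interleave e c) p)"

definition Dec :: "((nat \<Rightarrow> 'a) \<Rightarrow> bool) \<Rightarrow> bool" where
  "Dec P \<longleftrightarrow> (\<exists>E c. DecP E c P)"

lemma DecP_I: "range E \<subseteq> sets_of M \<Longrightarrow> (\<And>e. P e \<longleftrightarrow> holds M E (interleave e c) p) \<Longrightarrow> DecP E c P"
  unfolding DecP_def by blast

lemma Dec_I: "range E \<subseteq> sets_of M \<Longrightarrow> (\<And>e. P e \<longleftrightarrow> holds M E (interleave e c) p) \<Longrightarrow> Dec P"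
  unfolding Dec_def using DecP_I by blast

definition TmP :: "(nat \<Rightarrow> 'a) \<Rightarrow> ((nat \<Rightarrow> 'a) \<Rightarrow> 'a) \<Rightarrow> bool" where
  "TmP c t \<longleftrightarrow> (\<exists>s. \<forall>e. t e = eval_term M (interleave e c) s)"

definition Tm :: "((nat \<Rightarrow> 'a) \<Rightarrow> 'a) \<Rightarrow> bool" where
  "Tm t \<longleftrightarrow> (\<exists>c. TmP c t)"

text \<open>Two predicates come with different parameter sequences. Interleaving these gives a
  common one, in which parameter number k moves to place 2k here and to place 2k + 1 in
  \<open>TmP_right\<close>; the renaming redirects the odd variables accordingly.\<close>

lemma TmP_left: "TmP c t \<Longrightarrow> TmP (interleave c c') t"
proof -
  assume "TmP c t"
  then obtain s where s: "\<And>e. t e = eval_term M (interleave e c) s" unfolding TmP_def by blast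
  let ?\<sigma> = "\<lambda>i. if even i then Var i else Var (Suc (2 * (2 * (i div 2))))"
  have "(\<lambda>i. eval_term M (interleave e (interleave c c')) (?\<sigma> i)) = interleave e c" for e
    by (rule ext) (auto simp: interleave_def odd_minus_one_div_two)
  then have "t e = eval_term M (interleave e (interleave c c')) (subst_term ?\<sigma> s)" for e
    by (simp add: s eval_subst_term)
  then show ?thesis unfolding TmP_def by blast
qed

lemma TmP_right: "TmP c t \<Longrightarrow> TmP (interleave c' c) t"
proof -
  assume "TmP c t"
  then obtain s where s: "\<And>e. t e = eval_term M (interleave e c) s" unfolding TmP_def by blast
  let ?\<sigma> = "\<lambda>i. if even i then Var i else Var (Suc (2 * Suc (2 * (i div 2))))"
  have "(\<lambda>i. eval_term M (interleave e (interleave c' c)) (?\<sigma> i)) = interleave e c" for e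
    by (rule ext) (auto simp: interleave_def odd_minus_one_div_two)
  then have "t e = eval_term M (interleave e (interleave c' c)) (subst_term ?\<sigma> s)" for e
    by (simp add: s eval_subst_term)
  then show ?thesis unfolding TmP_def by blast
qed

lemma range_interleave: "range E \<subseteq> S \<Longrightarrow> range E' \<subseteq> S \<Longrightarrow> range (interleave E E') \<subseteq> S"
  by (auto simp: interleave_def)

lemma DecP_left:
  assumes "DecP E c P" "range E' \<subseteq> sets_of M"
  shows "DecP (interleave E E') (interleave c c') P"
proof -
  obtain p where p: "\<And>e. P e \<longleftrightarrow> holds M E (interleave e c) p" using assms unfolding DecP_def by blast
  let ?\<sigma> = "\<lambda>i. if even i then Var i else Var (Suc (2 * (2 * (i div 2))))"
  have "(\<lambda>i. eval_term M (interleave e (interleave c c')) (?\<sigma> i)) = interleave e c" for e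
    by (rule ext) (auto simp: interleave_def odd_minus_one_div_two)
  then have "P e \<longleftrightarrow> holds M (interleave E E') (interleave e (interleave c c'))
      (subst_formula p ?\<sigma> (\<lambda>i. 2 * i))" for e
    by (simp add: p holds_subst_formula)
  moreover have "range (interleave E E') \<subseteq> sets_of M"
    using assms unfolding DecP_def by (intro range_interleave) auto
  ultimately show ?thesis by (rule DecP_I[rotated])
qed

lemma DecP_right:
  assumes "DecP E c P" "range E' \<subseteq> sets_of M"
  shows "DecP (interleave E' E) (interleave c' c) P"
proof -
  obtain p where p: "\<And>e. P e \<longleftrightarrow> holds M E (interleave e c) p" using assms unfolding DecP_def by blast
  let ?\<sigma> = "\<lambda>i. if even i then Var i else Var (Suc (2 * Suc (2 * (i div 2))))"
  have "(\<lambda>i. eval_term M (interleave e (interleave c' c)) (?\<sigma> i)) = interleave e c" for e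
    by (rule ext) (auto simp: interleave_def odd_minus_one_div_two)
  then have "P e \<longleftrightarrow> holds M (interleave E' E) (interleave e (interleave c' c))
      (subst_formula p ?\<sigma> (\<lambda>i. Suc (2 * i)))" for e
    by (simp add: p holds_subst_formula)
  moreover have "range (interleave E' E) \<subseteq> sets_of M"
    using assms unfolding DecP_def by (intro range_interleave) auto
  ultimately show ?thesis by (rule DecP_I[rotated])
qed

lemma Dec_Dec_common:
  assumes "Dec P" "Dec Q"
  obtains E c where "DecP E c P" "DecP E c Q"
proof -
  obtain E c E' c' where *: "DecP E c P" "DecP E' c' Q" using assms unfolding Dec_def by blast
  then have "range E \<subseteq> sets_of M" "range E' \<subseteq> sets_of M" unfolding DecP_def by blast+
  from that[OF DecP_left[OF *(1) this(2)] DecP_right[OF *(2) this(1)]] show ?thesis .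
qed

lemma Tm_Tm_common:
  assumes "Tm s" "Tm t"
  obtains c where "TmP c s" "TmP c t"
proof -
  obtain c c' where "TmP c s" "TmP c' t" using assms unfolding Tm_def by blast
  from that[OF TmP_left[OF this(1)] TmP_right[OF this(2)]] show ?thesis .
qed

lemma Tm_Dec_common:
  assumes "Tm t" "Dec Q"
  obtains E c where "TmP c t" "DecP E c Q"
proof -
  obtain c where c: "TmP c t" using assms unfolding Tm_def by blast
  obtain E d where d: "DecP E d Q" using assms unfolding Dec_def by blast
  then have "range E \<subseteq> sets_of M" unfolding DecP_def by blast
  from that[OF TmP_left[OF c] DecP_right[OF d this]] show ?thesis .
qed

lemma some_set: obtains E :: "nat \<Rightarrow> 'a set" where "range E \<subseteq> sets_of M"
proof -
  from rca obtain X where "X \<in> sets_of M" unfolding RCA0_def by blast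
  then show ?thesis using that[of "\<lambda>_. X"] by blast
qed

lemma Tm_var: "Tm (\<lambda>e. e i)"
  unfolding Tm_def TmP_def by (rule exI, rule exI[of _ "Var (2 * i)"]) simp

lemma Tm_const: "Tm (\<lambda>e. a)"
  unfolding Tm_def TmP_def
  by (rule exI[of _ "\<lambda>_. a"], rule exI[of _ "Var 1"]) (simp add: interleave_def)

lemma Tm_add: assumes "Tm s" "Tm t" shows "Tm (\<lambda>e. s e \<boxplus> t e)"
proof -
  obtain c where "TmP c s" "TmP c t" using Tm_Tm_common[OF assms] .
  then obtain u v where "\<And>e. s e = eval_term M (interleave e c) u" "\<And>e. t e = eval_term M (interleave e c) v"
    unfolding TmP_def by blast
  then have "\<And>e. s e \<boxplus> t e = eval_term M (interleave e c) (Plus u v)" by simp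
  then show ?thesis unfolding Tm_def TmP_def by blast
qed

lemma Tm_mult: assumes "Tm s" "Tm t" shows "Tm (\<lambda>e. s e \<boxdot> t e)"
proof -
  obtain c where "TmP c s" "TmP c t" using Tm_Tm_common[OF assms] .
  then obtain u v where "\<And>e. s e = eval_term M (interleave e c) u" "\<And>e. t e = eval_term M (interleave e c) v"
    unfolding TmP_def by blast
  then have "\<And>e. s e \<boxdot> t e = eval_term M (interleave e c) (Times u v)" by simp
  then show ?thesis unfolding Tm_def TmP_def by blast
qed

lemma Dec_eq_Tm: assumes "Tm s" "Tm t" shows "Dec (\<lambda>e. s e = t e)"
proof -
  obtain c where "TmP c s" "TmP c t" using Tm_Tm_common[OF assms] .
  then obtain u v where *: "\<And>e. s e = eval_term M (interleave e c) u" "\<And>e. t e = eval_term M (interleave e c) v"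
    unfolding TmP_def by blast
  obtain E :: "nat \<Rightarrow> 'a set" where E: "range E \<subseteq> sets_of M" by (rule some_set)
  have "\<And>e. s e = t e \<longleftrightarrow> holds M E (interleave e c) (Equal u v)" by (simp add: *)
  then show ?thesis by (rule Dec_I[OF E])
qed

lemma Dec_less_Tm: assumes "Tm s" "Tm t" shows "Dec (\<lambda>e. s e \<prec> t e)"
proof -
  obtain c where "TmP c s" "TmP c t" using Tm_Tm_common[OF assms] .
  then obtain u v where *: "\<And>e. s e = eval_term M (interleave e c) u" "\<And>e. t e = eval_term M (interleave e c) v"
    unfolding TmP_def by blast
  obtain E :: "nat \<Rightarrow> 'a set" where E: "range E \<subseteq> sets_of M" by (rule some_set)
  have "\<And>e. s e \<prec> t e \<longleftrightarrow> holds M E (interleave e c) (Less u v)" by (simp add: *)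
  then show ?thesis by (rule Dec_I[OF E])
qed

lemma Dec_mem_Tm: assumes "Tm t" "X \<in> sets_of M" shows "Dec (\<lambda>e. t e \<in> X)"
proof -
  from assms obtain u c where "\<And>e. t e = eval_term M (interleave e c) u"
    unfolding Tm_def TmP_def by blast
  then have "\<And>e. t e \<in> X \<longleftrightarrow> holds M (\<lambda>_. X) (interleave e c) (Member u 0)" by simp
  moreover have "range (\<lambda>_::nat. X) \<subseteq> sets_of M" using assms by auto
  ultimately show ?thesis by (rule Dec_I[rotated])
qed

lemma Dec_not: assumes "Dec P" shows "Dec (\<lambda>e. \<not> P e)"
proof -
  obtain E c p where E: "range E \<subseteq> sets_of M" and "\<And>e. P e \<longleftrightarrow> holds M E (interleave e c) p"
    using assms unfolding Dec_def DecP_def by blast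
  then have "\<And>e. \<not> P e \<longleftrightarrow> holds M E (interleave e c) (Neg p)" by simp
  then show ?thesis by (rule Dec_I[OF E])
qed

lemma Dec_conj: assumes "Dec P" "Dec Q" shows "Dec (\<lambda>e. P e \<and> Q e)"
proof -
  obtain E c where "DecP E c P" "DecP E c Q" using Dec_Dec_common[OF assms] .
  then obtain p q where *: "range E \<subseteq> sets_of M" "\<And>e. P e \<longleftrightarrow> holds M E (interleave e c) p"
     "\<And>e. Q e \<longleftrightarrow> holds M E (interleave e c) q" unfolding DecP_def by blast
  then have "\<And>e. P e \<and> Q e \<longleftrightarrow> holds M E (interleave e c) (Conj p q)" by simp
  then show ?thesis by (rule Dec_I[OF *(1)])
qed

lemma Dec_disj: assumes "Dec P" "Dec Q" shows "Dec (\<lambda>e. P e \<or> Q e)"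
  using Dec_not[OF Dec_conj[OF Dec_not[OF assms(1)] Dec_not[OF assms(2)]]] by simp

lemma Dec_imp: assumes "Dec P" "Dec Q" shows "Dec (\<lambda>e. P e \<longrightarrow> Q e)"
  unfolding imp_conv_disj by (intro Dec_disj Dec_not assms)

lemma Dec_iff: assumes "Dec P" "Dec Q" shows "Dec (\<lambda>e. P e \<longleftrightarrow> Q e)"
proof -
  have "(\<lambda>e. P e \<longleftrightarrow> Q e) = (\<lambda>e. (P e \<longrightarrow> Q e) \<and> (Q e \<longrightarrow> P e))" by blast
  then show ?thesis by (simp only:) (intro Dec_conj Dec_imp assms)
qed

lemma Dec_const: "Dec (\<lambda>e. B)"
proof -
  have "Dec (\<lambda>e. e 0 = e 0)" by (intro Dec_eq_Tm Tm_var)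
  then show ?thesis using Dec_not[of "\<lambda>e. e 0 = e 0"] by (cases B) simp_all
qed

lemma Dec_bex_Tm:
  assumes "Tm t" "Dec (\<lambda>e. Q (e 0) (\<lambda>i. e (Suc i)))"
  shows "Dec (\<lambda>e. \<exists>x. x \<prec> t e \<and> Q x e)"
proof -
  obtain E c where "TmP c t" "DecP E c (\<lambda>e. Q (e 0) (\<lambda>i. e (Suc i)))"
    using Tm_Dec_common[OF assms] .
  then obtain s q where *: "range E \<subseteq> sets_of M" "\<And>e. t e = eval_term M (interleave e c) s"
     "\<And>e. Q (e 0) (\<lambda>i. e (Suc i)) \<longleftrightarrow> holds M E (interleave e c) q"
    unfolding DecP_def TmP_def by blast
  \<comment> \<open>The binder adds a single slot in front of everything. What the target layout has
    at 2j (for j > 0) is therefore found at 2j - 1, and the parameter at 2j + 1 is found at 2j +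
    2.\<close>
  let ?\<sigma> = "\<lambda>i. if i = 0 then Var 0 else if even i then Var (i - 1) else Var (Suc i)"
  have "(\<lambda>i. eval_term M (case_nat x (interleave e c)) (?\<sigma> i)) = interleave (case_nat x e) c" for x e
  proof
    fix i
    show "eval_term M (case_nat x (interleave e c)) (?\<sigma> i) = interleave (case_nat x e) c i"
    proof (cases "even i")
      case True
      then obtain j where "i = 2 * j" by blast
      then show ?thesis
        using interleave_even[of "case_nat x e" c j] by (cases j) simp_all
    next
      case False
      then obtain j where "i = Suc (2 * j)" by (metis oddE Suc_eq_plus1)
      then show ?thesis by simp
    qed
  qed
  then have "Q x e \<longleftrightarrow> holds M E (case_nat x (interleave e c)) (subst_formula q ?\<sigma> (\<lambda>i. i))" for x e
    using *(3)[of "case_nat x e"] by (simp add: holds_subst_formula)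
  then have "(\<exists>x. x \<prec> t e \<and> Q x e) \<longleftrightarrow>
      holds M E (interleave e c) (BEx s (subst_formula q ?\<sigma> (\<lambda>i. i)))" for e
    by (simp add: *(2))
  then show ?thesis by (rule Dec_I[OF *(1)])
qed

lemma Dec_subst_terms:
  assumes "Dec P"
  shows "Dec (\<lambda>e. P (\<lambda>i. eval_term M (interleave e d) (\<tau> i)))"
proof -
  obtain E c p where *: "range E \<subseteq> sets_of M" "\<And>e. P e \<longleftrightarrow> holds M E (interleave e c) p"
    using assms unfolding Dec_def DecP_def by blast
  let ?\<rho> = "\<lambda>i. if even i then Var i else Var (Suc (2 * Suc (2 * (i div 2))))"
  let ?\<sigma> = "\<lambda>i. if even i then subst_term ?\<rho> (\<tau> (i div 2)) else Var (Suc (2 * (2 * (i div 2))))"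
  have 1: "(\<lambda>i. eval_term M (interleave e (interleave c d)) (?\<rho> i)) = interleave e d" for e
    by (rule ext) (auto simp: interleave_def odd_minus_one_div_two)
  have "(\<lambda>i. eval_term M (interleave e (interleave c d)) (?\<sigma> i)) =
      interleave (\<lambda>i. eval_term M (interleave e d) (\<tau> i)) c" for e
  proof
    fix i
    show "eval_term M (interleave e (interleave c d)) (?\<sigma> i) =
      interleave (\<lambda>i. eval_term M (interleave e d) (\<tau> i)) c i"
      by (cases "even i") (simp_all only: if_True if_False eval_subst_term 1, simp_all add: interleave_def odd_minus_one_div_two)
  qed
  then have "P (\<lambda>i. eval_term M (interleave e d) (\<tau> i)) \<longleftrightarrow>
     holds M E (interleave e (interleave c d)) (subst_formula p ?\<sigma> (\<lambda>i. i))" for e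
    by (simp add: *(2) holds_subst_formula)
  then show ?thesis by (rule Dec_I[OF *(1)])
qed

lemma Dec_rename: "Dec P \<Longrightarrow> Dec (\<lambda>e. P (\<lambda>i. e (\<rho> i)))"
  using Dec_subst_terms[of P undefined "\<lambda>i. Var (2 * \<rho> i)"] by simp

text \<open>Freezes the arguments from \<open>k\<close> on by turning them into parameters. This is
  how a predicate that is uniform in its environment becomes one to which induction applies.\<close>

lemma Dec_instantiate: "Dec P \<Longrightarrow> Dec (\<lambda>e. P (\<lambda>i. if i < k then e i else d i))"
proof -
  assume "Dec P"
  then have "Dec (\<lambda>e. P (\<lambda>i. eval_term M (interleave e d) (if i < k then Var (2 * i) else Var (Suc (2 * i)))))"
    by (rule Dec_subst_terms)
  then show ?thesis by (simp add: if_distrib cong: if_cong)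
qed

lemma Dec_finitely_supported: "Dec P \<Longrightarrow> finitely_supported P"
proof -
  assume "Dec P"
  then obtain E c p where *: "\<And>e. P e \<longleftrightarrow> holds M E (interleave e c) p"
    unfolding Dec_def DecP_def by blast
  obtain N where N: "\<And>e e'. (\<forall>i<N. e i = e' i) \<Longrightarrow> holds M E e p = holds M E e' p"
    using holds_finitely_supported unfolding finitely_supported_def by blast
  have "P e = P e'" if "\<forall>i<N. e i = e' i" for e e'
    unfolding * by (rule N) (use that in \<open>auto simp: interleave_def\<close>)
  then show ?thesis unfolding finitely_supported_def by blast
qed

text \<open>Translates the interleaved layout into that of \<open>sigma1\<close> and
  \<open>pi1\<close>: witness, argument, then the parameters.\<close>

lemma DecP_two_variables:
  assumes "DecP E c (\<lambda>e. A (e 0) (e 1))"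
  obtains p where "\<And>x n. A x n \<longleftrightarrow> holds M E (case_nat x (case_nat n c)) p"
proof -
  obtain p where p: "\<And>e. A (e 0) (e 1) \<longleftrightarrow> holds M E (interleave e c) p"
    using assms unfolding DecP_def by blast
  let ?\<sigma> = "\<lambda>i. if even i then (if i = 0 then Var 0 else Var 1) else Var (i div 2 + 2)"
  have "(\<lambda>i. eval_term M (case_nat x (case_nat n c)) (?\<sigma> i)) = interleave (case_nat x (\<lambda>_. n)) c" for x n
    by (rule ext) (auto simp: interleave_def split: nat.split elim!: evenE)
  then have "A x n \<longleftrightarrow> holds M E (case_nat x (case_nat n c)) (subst_formula p ?\<sigma> (\<lambda>i. i))" for x n
    using p[of "case_nat x (\<lambda>_. n)"] by (simp add: holds_subst_formula)
  then show ?thesis using that by blast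
qed

section \<open>Induction and comprehension in terms of \<open>Dec\<close>\<close>

theorem sigma_induct:
  assumes "Dec (\<lambda>e. A (e 0) (e 1))"
    and "\<exists>x. A x \<^bold>0" "\<And>n. \<exists>x. A x n \<Longrightarrow> \<exists>x. A x (n \<boxplus> \<^bold>1)"
  shows "\<exists>x. A x n"
proof -
  obtain E c where Ec: "DecP E c (\<lambda>e. A (e 0) (e 1))" using assms(1) unfolding Dec_def by blast
  obtain p where p: "\<And>x n. A x n \<longleftrightarrow> holds M E (case_nat x (case_nat n c)) p"
    using DecP_two_variables[OF Ec] by blast
  have ind: "sigma1_induction M" and E: "range E \<subseteq> sets_of M"
    using rca Ec unfolding RCA0_def DecP_def by blast+
  have eq: "sigma1 M E c p m \<longleftrightarrow> (\<exists>x. A x m)" for m unfolding sigma1_def by (simp add: p)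
  have "sigma1 M E c p n"
    by (rule ind[unfolded sigma1_induction_def, rule_format, OF E]) (unfold eq, fact assms(2), erule assms(3))
  then show ?thesis unfolding eq .
qed

theorem dec_induct:
  assumes "Dec (\<lambda>e. P (e 0))" "P \<^bold>0" "\<And>n. P n \<Longrightarrow> P (n \<boxplus> \<^bold>1)"
  shows "P n"
  using sigma_induct[of "\<lambda>x n. P n" n] Dec_rename[OF assms(1), of "\<lambda>i. Suc i"] assms(2,3) by auto

theorem delta_comprehension:
  assumes "Dec (\<lambda>e. A (e 0) (e 1))" "Dec (\<lambda>e. B (e 0) (e 1))"
    and "\<And>n. (\<exists>x. A x n) \<longleftrightarrow> (\<forall>x. B x n)"
  shows "{n. \<exists>x. A x n} \<in> sets_of M"
proof -
  obtain E c where Ec: "DecP E c (\<lambda>e. A (e 0) (e 1))" "DecP E c (\<lambda>e. B (e 0) (e 1))"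
    using Dec_Dec_common[OF assms(1,2)] .
  obtain p where p: "\<And>x n. A x n \<longleftrightarrow> holds M E (case_nat x (case_nat n c)) p"
    using DecP_two_variables[OF Ec(1)] by blast
  obtain q where q: "\<And>x n. B x n \<longleftrightarrow> holds M E (case_nat x (case_nat n c)) q"
    using DecP_two_variables[OF Ec(2)] by blast
  have compr: "delta1_comprehension M" and E: "range E \<subseteq> sets_of M"
    using rca Ec unfolding RCA0_def DecP_def by blast+
  have eq: "sigma1 M E c p m \<longleftrightarrow> (\<exists>x. A x m)" for m unfolding sigma1_def by (simp add: p)
  have eq': "pi1 M E c q m \<longleftrightarrow> (\<forall>x. B x m)" for m unfolding pi1_def by (simp add: q)
  have "\<exists>X\<in>sets_of M. \<forall>n. n \<in> X \<longleftrightarrow> sigma1 M E c p n"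
    using compr[unfolded delta1_comprehension_def, THEN spec[of _ p], THEN spec[of _ q],
        THEN spec[of _ E], THEN spec[of _ c]] E assms(3) by (simp add: eq eq')
  then obtain X where "X \<in> sets_of M" "\<And>n. n \<in> X \<longleftrightarrow> (\<exists>x. A x n)" unfolding eq by blast
  moreover from this(2) have "X = {n. \<exists>x. A x n}" by blast
  ultimately show ?thesis by simp
qed

lemma dec_comprehension: "Dec (\<lambda>e. P (e 0)) \<Longrightarrow> {n. P n} \<in> sets_of M"
  using delta_comprehension[of "\<lambda>x n. P n" "\<lambda>x n. P n"] Dec_rename[of "\<lambda>e. P (e 0)" "\<lambda>i. Suc i"] by simp

section \<open>Arithmetic in a model\<close>

lemma basic: "basic_axioms M"
  using rca unfolding RCA0_def by blast

lemma suc_not_zero: "n \<boxplus> \<^bold>1 \<noteq> \<^bold>0"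
  and suc_inject: "m \<boxplus> \<^bold>1 = n \<boxplus> \<^bold>1 \<Longrightarrow> m = n"
  and add_zero: "m \<boxplus> \<^bold>0 = m"
  and add_suc: "m \<boxplus> (n \<boxplus> \<^bold>1) = (m \<boxplus> n) \<boxplus> \<^bold>1"
  and mult_zero: "m \<boxdot> \<^bold>0 = \<^bold>0"
  and mult_suc: "m \<boxdot> (n \<boxplus> \<^bold>1) = (m \<boxdot> n) \<boxplus> m"
  and not_less_zero: "\<not> m \<prec> \<^bold>0"
  and less_suc: "m \<prec> n \<boxplus> \<^bold>1 \<longleftrightarrow> m \<prec> n \<or> m = n"
  using basic unfolding basic_axioms_def by blast+

lemmas Tm_Dec_intros = Dec_eq_Tm Dec_less_Tm Tm_add Tm_mult Tm_const Tm_var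
  Dec_imp Dec_conj Dec_disj Dec_not

lemma zero_add: "\<^bold>0 \<boxplus> n = n"
  by (rule dec_induct[where P="\<lambda>n. \<^bold>0 \<boxplus> n = n"])
    (intro Tm_Dec_intros, simp_all add: add_zero add_suc)

lemma suc_add: "(m \<boxplus> \<^bold>1) \<boxplus> n = (m \<boxplus> n) \<boxplus> \<^bold>1"
  by (rule dec_induct[where P="\<lambda>n. (m \<boxplus> \<^bold>1) \<boxplus> n = (m \<boxplus> n) \<boxplus> \<^bold>1"])
    (intro Tm_Dec_intros, simp_all add: add_zero add_suc)

lemma add_commute': "m \<boxplus> n = n \<boxplus> m"
  by (rule dec_induct[where P="\<lambda>n. m \<boxplus> n = n \<boxplus> m"])
    (intro Tm_Dec_intros, simp_all add: add_zero add_suc suc_add zero_add)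

lemma add_assoc': "m \<boxplus> n \<boxplus> k = m \<boxplus> (n \<boxplus> k)"
  by (rule dec_induct[where P="\<lambda>k. m \<boxplus> n \<boxplus> k = m \<boxplus> (n \<boxplus> k)"])
    (intro Tm_Dec_intros, simp_all add: add_zero add_suc)

lemma add_left_commute': "m \<boxplus> (n \<boxplus> k) = n \<boxplus> (m \<boxplus> k)"
  by (metis add_assoc' add_commute')

lemma add_cancel: "m \<boxplus> k = n \<boxplus> k \<longleftrightarrow> m = n"
proof -
  have "m \<boxplus> k = n \<boxplus> k \<longrightarrow> m = n"
    by (rule dec_induct[where P="\<lambda>k. m \<boxplus> k = n \<boxplus> k \<longrightarrow> m = n"])
      (intro Tm_Dec_intros, auto simp: add_zero add_suc dest: suc_inject)
  then show ?thesis by blast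
qed

lemma zero_mult: "\<^bold>0 \<boxdot> n = \<^bold>0"
  by (rule dec_induct[where P="\<lambda>n. \<^bold>0 \<boxdot> n = \<^bold>0"])
    (intro Tm_Dec_intros, simp_all add: mult_zero mult_suc add_zero)

lemma suc_mult: "(m \<boxplus> \<^bold>1) \<boxdot> n = m \<boxdot> n \<boxplus> n"
  by (rule dec_induct[where P="\<lambda>n. (m \<boxplus> \<^bold>1) \<boxdot> n = m \<boxdot> n \<boxplus> n"])
    (intro Tm_Dec_intros, simp_all add: mult_zero mult_suc add_zero add_assoc' add_left_commute' add_commute')

lemma mult_commute': "m \<boxdot> n = n \<boxdot> m"
  by (rule dec_induct[where P="\<lambda>n. m \<boxdot> n = n \<boxdot> m"])
    (intro Tm_Dec_intros, simp_all add: mult_zero mult_suc zero_mult suc_mult)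

lemma distrib_right': "(m \<boxplus> n) \<boxdot> k = m \<boxdot> k \<boxplus> n \<boxdot> k"
  by (rule dec_induct[where P="\<lambda>k. (m \<boxplus> n) \<boxdot> k = m \<boxdot> k \<boxplus> n \<boxdot> k"])
    (intro Tm_Dec_intros, simp_all add: mult_zero mult_suc add_zero add_assoc' add_left_commute')

lemma mult_assoc': "m \<boxdot> n \<boxdot> k = m \<boxdot> (n \<boxdot> k)"
proof -
  have *: "m \<boxdot> (a \<boxplus> b) = m \<boxdot> a \<boxplus> m \<boxdot> b" for a b
    by (metis mult_commute' distrib_right')
  show ?thesis
    by (rule dec_induct[where P="\<lambda>k. m \<boxdot> n \<boxdot> k = m \<boxdot> (n \<boxdot> k)"])
      (intro Tm_Dec_intros, simp_all add: mult_zero mult_suc add_zero *)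
qed

lemma one_mult: "\<^bold>1 \<boxdot> n = n"
  by (metis zero_add suc_mult zero_mult)

lemma zero_or_suc: "n = \<^bold>0 \<or> (\<exists>m. n = m \<boxplus> \<^bold>1)"
proof -
  have "\<exists>m. n = \<^bold>0 \<or> n = m \<boxplus> \<^bold>1"
    by (rule sigma_induct[where A="\<lambda>m n. n = \<^bold>0 \<or> n = m \<boxplus> \<^bold>1"])
      (intro Tm_Dec_intros, auto)
  then show ?thesis by blast
qed

lemma less_iff_add: "m \<prec> n \<longleftrightarrow> (\<exists>k. n = m \<boxplus> k \<boxplus> \<^bold>1)"
proof
  have "\<exists>k. m \<prec> n \<longrightarrow> n = m \<boxplus> k \<boxplus> \<^bold>1"
  proof (rule sigma_induct[where A="\<lambda>k n. m \<prec> n \<longrightarrow> n = m \<boxplus> k \<boxplus> \<^bold>1"])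
    show "Dec (\<lambda>e. m \<prec> e 1 \<longrightarrow> e 1 = m \<boxplus> e 0 \<boxplus> \<^bold>1)" by (intro Tm_Dec_intros)
    show "\<exists>k. m \<prec> \<^bold>0 \<longrightarrow> \<^bold>0 = m \<boxplus> k \<boxplus> \<^bold>1" by (simp add: not_less_zero)
    show "\<exists>k. m \<prec> n \<boxplus> \<^bold>1 \<longrightarrow> n \<boxplus> \<^bold>1 = m \<boxplus> k \<boxplus> \<^bold>1" if "\<exists>k. m \<prec> n \<longrightarrow> n = m \<boxplus> k \<boxplus> \<^bold>1" for n
      using that by (metis less_suc add_suc add_zero)
  qed
  then show "m \<prec> n \<Longrightarrow> \<exists>k. n = m \<boxplus> k \<boxplus> \<^bold>1" by blast
  have "m \<prec> m \<boxplus> k \<boxplus> \<^bold>1" for k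
    by (rule dec_induct[where P="\<lambda>k. m \<prec> m \<boxplus> k \<boxplus> \<^bold>1"])
      (intro Tm_Dec_intros, simp_all add: add_zero less_suc add_suc)
  then show "\<exists>k. n = m \<boxplus> k \<boxplus> \<^bold>1 \<Longrightarrow> m \<prec> n" by blast
qed

definition nle :: "'a \<Rightarrow> 'a \<Rightarrow> bool"  (infix \<open>\<preceq>\<close> 50) where
  "m \<preceq> n \<longleftrightarrow> m \<prec> n \<or> m = n"

lemma nle_iff_add: "m \<preceq> n \<longleftrightarrow> (\<exists>k. n = m \<boxplus> k)"
  unfolding nle_def less_iff_add by (metis add_zero zero_or_suc add_assoc')

lemma nle_total: "m \<preceq> n \<or> n \<preceq> m"
proof -
  have "m \<prec> n \<or> m = n \<or> n \<prec> m"
  proof (rule dec_induct[where P="\<lambda>n. m \<prec> n \<or> m = n \<or> n \<prec> m"])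
    show "Dec (\<lambda>e. m \<prec> e 0 \<or> m = e 0 \<or> e 0 \<prec> m)" by (intro Tm_Dec_intros)
    show "m \<prec> \<^bold>0 \<or> m = \<^bold>0 \<or> \<^bold>0 \<prec> m"
      unfolding less_iff_add by (metis zero_or_suc zero_add)
    show "m \<prec> n \<boxplus> \<^bold>1 \<or> m = n \<boxplus> \<^bold>1 \<or> n \<boxplus> \<^bold>1 \<prec> m" if "m \<prec> n \<or> m = n \<or> n \<prec> m" for n
      using that unfolding less_suc unfolding less_iff_add
      by (metis zero_or_suc add_zero add_assoc' add_commute')
  qed
  then show ?thesis unfolding nle_def by blast
qed

lemma add_eq_self: "m \<boxplus> k = m \<longleftrightarrow> k = \<^bold>0"
  by (metis add_cancel add_commute' add_zero)

lemma nle_antisym: "m \<preceq> n \<Longrightarrow> n \<preceq> m \<Longrightarrow> m = n"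
  unfolding nle_iff_add
  by (metis add_assoc' add_eq_self add_zero suc_not_zero zero_or_suc add_suc)

lemma less_iff_nle: "m \<prec> n \<longleftrightarrow> m \<preceq> n \<and> \<not> n \<preceq> m"
proof -
  have "\<not> n \<prec> n" for n
    unfolding less_iff_add by (metis add_assoc' add_eq_self suc_not_zero)
  then show ?thesis using nle_antisym nle_def by metis
qed

definition nminus :: "'a \<Rightarrow> 'a \<Rightarrow> 'a" where
  "nminus m n = (if n \<preceq> m then THE k. n \<boxplus> k = m else \<^bold>0)"

lemma add_nminus: "nminus (n \<boxplus> k) n = k"
proof -
  have "(THE j. n \<boxplus> j = n \<boxplus> k) = k"
    by (rule the_equality) (metis add_cancel add_commute')+
  moreover have "n \<preceq> n \<boxplus> k" unfolding nle_iff_add by blast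
  ultimately show ?thesis by (simp add: nminus_def)
qed

lemma nminus_nle: "m \<preceq> n \<Longrightarrow> nminus m n = \<^bold>0"
  by (metis add_nminus add_zero nle_antisym nminus_def)

lemma nminus_cases: obtains (le) "m \<preceq> n" "nminus m n = \<^bold>0" | (ge) k where "m = n \<boxplus> k" "nminus m n = k"
  by (metis add_nminus nle_iff_add nle_total nminus_nle)

text \<open>From here on the library on ordered semidomains speaks about the numbers of the model,
  nonstandard ones included. Cut-off subtraction \<open>nminus\<close> supplies the difference that
  this class requires.\<close>

sublocale N: linordered_semidom "nadd M" nminus nle "nless M" "nzero M" "nmult M" "none M"
proof
  fix a b c :: 'a
  show "a \<boxplus> b \<boxplus> c = a \<boxplus> (b \<boxplus> c)" by (rule add_assoc')
  show "a \<boxplus> b = b \<boxplus> a" by (rule add_commute')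
  show "\<^bold>0 \<boxplus> a = a" by (rule zero_add)
  show "a \<boxdot> b \<boxdot> c = a \<boxdot> (b \<boxdot> c)" by (rule mult_assoc')
  show "a \<boxdot> b = b \<boxdot> a" by (rule mult_commute')
  show "\<^bold>1 \<boxdot> a = a" by (rule one_mult)
  show "(a \<boxplus> b) \<boxdot> c = a \<boxdot> c \<boxplus> b \<boxdot> c" by (rule distrib_right')
  show "\<^bold>0 \<boxdot> a = \<^bold>0" by (rule zero_mult)
  show "a \<boxdot> \<^bold>0 = \<^bold>0" by (rule mult_zero)
  show "\<^bold>0 \<noteq> \<^bold>1" by (metis suc_not_zero zero_add)
  show "nminus (a \<boxplus> b) a = b" by (rule add_nminus)
  show "nminus (nminus a b) c = nminus a (b \<boxplus> c)"
  proof (cases a b rule: nminus_cases)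
    case le
    then have "a \<preceq> b \<boxplus> c" unfolding nle_iff_add by (metis add_assoc')
    then show ?thesis using le by (simp add: nminus_nle nle_iff_add zero_add)
  next
    case (ge k)
    show ?thesis
    proof (cases k c rule: nminus_cases)
      case le
      then have "a \<preceq> b \<boxplus> c" using ge unfolding nle_iff_add by (metis add_assoc')
      then show ?thesis using le ge by (simp add: nminus_nle)
    next
      case ge2: (ge j)
      then have "a = b \<boxplus> c \<boxplus> j" using ge by (simp add: add_assoc')
      then show ?thesis using ge ge2 by (simp add: add_nminus)
    qed
  qed
  show dl: "c \<boxdot> (nminus a b) = nminus (c \<boxdot> a) (c \<boxdot> b)"
  proof (cases a b rule: nminus_cases)
    case le
    then have "c \<boxdot> a \<preceq> c \<boxdot> b" unfolding nle_iff_add by (metis distrib_right' mult_commute')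
    then show ?thesis using le by (simp add: nminus_nle mult_zero)
  next
    case (ge k)
    then have "c \<boxdot> a = c \<boxdot> b \<boxplus> c \<boxdot> k" by (metis distrib_right' mult_commute')
    then show ?thesis using ge by (simp add: add_nminus)
  qed
  show "a \<prec> b \<longleftrightarrow> a \<preceq> b \<and> \<not> b \<preceq> a" by (rule less_iff_nle)
  show "a \<preceq> a" by (simp add: nle_def)
  show "a \<preceq> b \<Longrightarrow> b \<preceq> c \<Longrightarrow> a \<preceq> c" unfolding nle_iff_add by (metis add_assoc')
  show "a \<preceq> b \<Longrightarrow> b \<preceq> a \<Longrightarrow> a = b" by (rule nle_antisym)
  show "a \<preceq> b \<or> b \<preceq> a" by (rule nle_total)
  show "a \<preceq> b \<Longrightarrow> c \<boxplus> a \<preceq> c \<boxplus> b" unfolding nle_iff_add by (metis add_assoc')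
  have *: "u \<prec> v \<longleftrightarrow> (\<exists>k. k \<noteq> \<^bold>0 \<and> v = u \<boxplus> k)" for u v
    unfolding less_iff_add by (metis add_suc suc_not_zero zero_or_suc)
  have mult_nz: "u \<boxdot> v \<noteq> \<^bold>0" if "u \<noteq> \<^bold>0" "v \<noteq> \<^bold>0" for u v
    using that by (metis mult_suc add_suc suc_not_zero zero_or_suc)
  show "a \<prec> b \<Longrightarrow> \<^bold>0 \<prec> c \<Longrightarrow> c \<boxdot> a \<prec> c \<boxdot> b" unfolding *
    by (metis distrib_right' mult_commute' zero_add mult_nz)
  show "\<^bold>0 \<prec> \<^bold>1" unfolding less_iff_add by (metis zero_add)
  show "b \<preceq> a \<Longrightarrow> nminus a b \<boxplus> b = a" unfolding nle_iff_add by (metis add_nminus add_commute')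
  show "a \<noteq> \<^bold>0 \<Longrightarrow> b \<noteq> \<^bold>0 \<Longrightarrow> a \<boxdot> b \<noteq> \<^bold>0" by (rule mult_nz)
  show "a \<boxdot> (b \<boxplus> c) = a \<boxdot> b \<boxplus> a \<boxdot> c" by (metis distrib_right' mult_commute')
qed

section \<open>Pairs and the calculus of decidable predicates\<close>

abbreviation pr :: "'a \<Rightarrow> 'a \<Rightarrow> 'a" where "pr \<equiv> npair M"

lemma less_suc_iff: "m \<prec> n \<boxplus> \<^bold>1 \<longleftrightarrow> m \<preceq> n"
  unfolding less_suc nle_def by blast

lemma suc_nle_iff: "m \<boxplus> \<^bold>1 \<preceq> n \<longleftrightarrow> m \<prec> n"
  by (metis less_suc_iff N.not_less N.add_le_cancel_right)

lemma nle_square: "n \<preceq> n \<boxdot> n"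
proof (cases "n = \<^bold>0")
  case False
  then have "\<^bold>1 \<preceq> n" by (metis zero_or_suc nle_iff_add add_commute')
  then have "\<^bold>1 \<boxdot> n \<preceq> n \<boxdot> n" by (intro N.mult_right_mono) (auto simp: nle_iff_add)
  then show ?thesis by simp
qed (simp add: nle_def)

lemma zero_nle [simp]: "\<^bold>0 \<preceq> n"
  unfolding nle_iff_add by (metis zero_add)

lemma nle_add_left: "n \<preceq> m \<boxplus> n" and nle_add_right: "n \<preceq> n \<boxplus> m"
  unfolding nle_iff_add by (metis add_commute')+

lemma pr_bounds: "i \<preceq> pr i j" "j \<preceq> pr i j"
proof -
  show "i \<preceq> pr i j" unfolding npair_def by (rule nle_add_left)
  have "j \<preceq> i \<boxplus> j" by (rule nle_add_left)
  also have "\<dots> \<preceq> (i \<boxplus> j) \<boxdot> (i \<boxplus> j)" by (rule nle_square)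
  also have "\<dots> \<preceq> pr i j" unfolding npair_def by (rule nle_add_right)
  finally show "j \<preceq> pr i j" .
qed

lemma pr_mono: "i \<preceq> i' \<Longrightarrow> j \<preceq> j' \<Longrightarrow> pr i j \<preceq> pr i' j'"
  unfolding npair_def by (intro N.add_mono N.mult_mono) simp_all

text \<open>With s = i + j the pair lies between s^2 and s^2 + s, which is below (s + 1)^2.
  Different sums thus occupy disjoint intervals.\<close>

lemma pr_less_of_sum_less:
  assumes "i \<boxplus> j \<prec> i' \<boxplus> j'"
  shows "pr i j \<prec> pr i' j'"
proof -
  let ?s = "i \<boxplus> j" and ?s' = "i' \<boxplus> j'"
  have "pr i j \<preceq> ?s \<boxdot> ?s \<boxplus> ?s"
    unfolding npair_def by (intro N.add_left_mono nle_add_right)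
  also have "\<dots> \<prec> ?s \<boxdot> ?s \<boxplus> ?s \<boxplus> (?s \<boxplus> \<^bold>1)"
    unfolding less_iff_add by (metis add_assoc')
  also have "\<dots> = (?s \<boxplus> \<^bold>1) \<boxdot> (?s \<boxplus> \<^bold>1)"
    by (simp add: N.distrib_left N.distrib_right N.add_ac)
  also have "\<dots> \<preceq> ?s' \<boxdot> ?s'"
    using assms unfolding suc_nle_iff[symmetric] by (intro N.mult_mono) simp_all
  also have "\<dots> \<preceq> pr i' j'" unfolding npair_def by (rule nle_add_right)
  finally show ?thesis .
qed

lemma pr_inject [simp]: "pr i j = pr i' j' \<longleftrightarrow> i = i' \<and> j = j'"
proof
  assume eq: "pr i j = pr i' j'"
  then have s: "i \<boxplus> j = i' \<boxplus> j'"
    using pr_less_of_sum_less by (metis N.less_irrefl N.neq_iff)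
  then have "i = i'" using eq unfolding npair_def by (metis add_cancel add_commute')
  then show "i = i' \<and> j = j'" using s by simp
qed simp

lemma Tm_pr: "Tm s \<Longrightarrow> Tm t \<Longrightarrow> Tm (\<lambda>e. pr (s e) (t e))"
  unfolding npair_def by (intro Tm_Dec_intros)

text \<open>
  A \<open>\<Delta>\<^sub>1\<close> predicate of several variables is decidable with one more set parameter: the set
  of the codes of its tuples. The induction merges two variables into one pair at a time.
\<close>

lemma Dec_delta_aux:
  assumes "Dec A" "Dec B"
    and "\<And>e. P e \<longleftrightarrow> (\<exists>x. A (case_nat x e))" "\<And>e. P e \<longleftrightarrow> (\<forall>x. B (case_nat x e))"
    and "\<And>e e'. (\<And>i. i < Suc k \<Longrightarrow> e i = e' i) \<Longrightarrow> P e \<longleftrightarrow> P e'"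
  shows "Dec P"
  using assms
proof (induction k arbitrary: A B P)
  case 0
  have ren: "(\<lambda>i. e (case_nat 0 (\<lambda>_. 1) i)) = case_nat (e 0) (\<lambda>_. e 1)" for e :: "nat \<Rightarrow> 'a"
    by (rule ext) (simp split: nat.split)
  have "Dec (\<lambda>e. A (case_nat (e 0) (\<lambda>_. e 1)))" "Dec (\<lambda>e. B (case_nat (e 0) (\<lambda>_. e 1)))"
    using Dec_rename[OF 0(1), of "case_nat 0 (\<lambda>_. 1)"] Dec_rename[OF 0(2), of "case_nat 0 (\<lambda>_. 1)"]
    by (simp_all only: ren)
  then have "{n. \<exists>x. A (case_nat x (\<lambda>_. n))} \<in> sets_of M"
    by (rule delta_comprehension[of "\<lambda>x n. A (case_nat x (\<lambda>_. n))"]) (metis 0(3,4))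
  then have "Dec (\<lambda>e. e 0 \<in> {n. \<exists>x. A (case_nat x (\<lambda>_. n))})" by (intro Dec_mem_Tm Tm_var)
  moreover have "P e \<longleftrightarrow> e 0 \<in> {n. \<exists>x. A (case_nat x (\<lambda>_. n))}" for e
  proof -
    have "P e \<longleftrightarrow> P (\<lambda>_. e 0)" by (rule 0(5)) simp
    then show ?thesis using 0(3) by simp
  qed
  ultimately show ?case by simp
next
  case (Suc k)
  define merge where "merge x a b e = case_nat x (case_nat a (case_nat b (\<lambda>i. e (Suc i))))"
    for x a b and e :: "nat \<Rightarrow> 'a"
  \<comment> \<open>\<open>P'\<close> depends on one argument fewer than \<open>P\<close>: its first
    argument is read as the pair of the first two arguments of \<open>P\<close>, and it is false at
    numbers that are no pairs.\<close>
  define P' where "P' e \<longleftrightarrow> (\<exists>a b. e 0 = pr a b \<and> P (case_nat a (case_nat b (\<lambda>i. e (Suc i)))))" for e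
  define A' where "A' e \<longleftrightarrow> (\<exists>a. a \<prec> e 1 \<boxplus> \<^bold>1 \<and> (\<exists>b. b \<prec> e 1 \<boxplus> \<^bold>1 \<and>
      (e 1 = pr a b \<and> A (merge (e 0) a b (\<lambda>i. e (Suc i))))))" for e
  define B' where "B' e \<longleftrightarrow> (\<exists>a. a \<prec> e 1 \<boxplus> \<^bold>1 \<and> (\<exists>b. b \<prec> e 1 \<boxplus> \<^bold>1 \<and>
      (e 1 = pr a b \<and> B (merge (e 0) a b (\<lambda>i. e (Suc i))))))" for e
  have ren: "(\<lambda>i. e (case_nat 2 (case_nat 1 (case_nat 0 (\<lambda>i. i + 4))) i)) =
      merge (e (Suc (Suc 0))) (e (Suc 0)) (e 0) (\<lambda>i. e (Suc (Suc (Suc i))))" for e :: "nat \<Rightarrow> 'a"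
    unfolding merge_def by (rule ext) (simp split: nat.split add: eval_nat_numeral)
  have AB: "Dec (\<lambda>e. A (merge (e (Suc (Suc 0))) (e (Suc 0)) (e 0) (\<lambda>i. e (Suc (Suc (Suc i))))))"
    "Dec (\<lambda>e. B (merge (e (Suc (Suc 0))) (e (Suc 0)) (e 0) (\<lambda>i. e (Suc (Suc (Suc i))))))"
    using Dec_rename[OF Suc.prems(1), of "case_nat 2 (case_nat 1 (case_nat 0 (\<lambda>i. i + 4)))"]
      Dec_rename[OF Suc.prems(2), of "case_nat 2 (case_nat 1 (case_nat 0 (\<lambda>i. i + 4)))"]
    by (simp_all only: ren)
  have "Dec A'" "Dec B'" unfolding A'_def B'_def
    by (intro Dec_bex_Tm Dec_conj Dec_eq_Tm Tm_pr Tm_add Tm_var Tm_const AB)+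
  moreover have "P' e \<longleftrightarrow> (\<exists>x. A' (case_nat x e))" "P' e \<longleftrightarrow> (\<forall>x. B' (case_nat x e))" for e
  proof -
    show "P' e \<longleftrightarrow> (\<exists>x. A' (case_nat x e))"
      unfolding P'_def A'_def merge_def Suc.prems(3) less_suc_iff using pr_bounds by auto
    have "P' e \<Longrightarrow> (\<forall>x. B' (case_nat x e))"
      unfolding P'_def B'_def merge_def Suc.prems(4) less_suc_iff using pr_bounds by fastforce
    \<comment> \<open>The components found for different x might differ; injectivity of pairing
      identifies them.\<close>
    moreover have "P' e" if b: "\<forall>x. B' (case_nat x e)"
    proof -
      obtain a b where ab: "e 0 = pr a b" using b unfolding B'_def by auto
      then have "B (merge x a b e)" for x
        using spec[OF b, of x] unfolding B'_def by auto
      then show ?thesis unfolding P'_def Suc.prems(4) merge_def using ab by blast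
    qed
    ultimately show "P' e \<longleftrightarrow> (\<forall>x. B' (case_nat x e))" by blast
  qed
  moreover have "P' e \<longleftrightarrow> P' e'" if "\<And>i. i < Suc k \<Longrightarrow> e i = e' i" for e e'
  proof -
    have "P (case_nat a (case_nat b (\<lambda>i. e (Suc i)))) \<longleftrightarrow> P (case_nat a (case_nat b (\<lambda>i. e' (Suc i))))" for a b
      by (rule Suc.prems(5)) (use that in \<open>auto split: nat.split\<close>)
    moreover have "e 0 = e' 0" using that by simp
    ultimately show ?thesis unfolding P'_def by simp
  qed
  ultimately have "Dec P'" by (rule Suc.IH)
  \<comment> \<open>The pairing polynomial as a term: in the interleaved layout \<open>Var 0\<close>
    and \<open>Var 2\<close> hold the first two arguments.\<close>
  define \<tau> where "\<tau> = case_nat (Plus (Times (Plus (Var 0) (Var 2)) (Plus (Var 0) (Var 2))) (Var 0))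
     (\<lambda>i. Var (2 * (i + 2)))"
  have \<tau>: "(\<lambda>i. eval_term M (interleave e d) (\<tau> i)) = case_nat (pr (e 0) (e 1)) (\<lambda>i. e (i + 2))" for e d
  proof
    fix i
    show "eval_term M (interleave e d) (\<tau> i) = case_nat (pr (e 0) (e 1)) (\<lambda>i. e (i + 2)) i"
      using interleave_even[of e d 0] interleave_even[of e d 1]
      by (cases i) (simp_all only: \<tau>_def nat.case eval_term.simps npair_def interleave_even mult_0_right mult_1_right)
  qed
  have "Dec (\<lambda>e. P' (case_nat (pr (e 0) (e 1)) (\<lambda>i. e (i + 2))))"
    using Dec_subst_terms[OF \<open>Dec P'\<close>, of _ \<tau>] unfolding \<tau> .
  moreover have "P' (case_nat (pr (e 0) (e 1)) (\<lambda>i. e (i + 2))) \<longleftrightarrow> P e" for e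
  proof -
    have "case_nat (e 0) (case_nat (e 1) (\<lambda>i. e (Suc i + 1))) = e"
      by (rule ext) (simp split: nat.split)
    then show ?thesis unfolding P'_def by simp
  qed
  ultimately show ?case by simp
qed

text \<open>The matrix \<open>A\<close> looks at finitely many arguments only, hence so does
  \<open>P\<close>, and the pairing induction can be run for that many steps.\<close>

theorem Dec_delta:
  assumes "Dec (\<lambda>e. A (e 0) (\<lambda>i. e (Suc i)))" "Dec (\<lambda>e. B (e 0) (\<lambda>i. e (Suc i)))"
    and "\<And>e. P e \<longleftrightarrow> (\<exists>x. A x e)" "\<And>e. P e \<longleftrightarrow> (\<forall>x. B x e)"
  shows "Dec P"
proof -
  obtain N where N: "\<And>e e'. (\<forall>i<N. e i = e' i) \<Longrightarrow> A (e 0) (\<lambda>i. e (Suc i)) = A (e' 0) (\<lambda>i. e' (Suc i))"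
    using Dec_finitely_supported[OF assms(1)] unfolding finitely_supported_def by blast
  have "P e \<longleftrightarrow> P e'" if "\<And>i. i < Suc N \<Longrightarrow> e i = e' i" for e e'
  proof -
    have "A x e \<longleftrightarrow> A x e'" for x
      using N[of "case_nat x e" "case_nat x e'"] that by (auto split: nat.split)
    then show ?thesis by (simp add: assms(3))
  qed
  then show ?thesis
    by (rule Dec_delta_aux[OF assms(1,2), of P N, rotated 2]) (simp_all only: nat.case assms(3) assms(4)[symmetric])
qed

section \<open>Functions with a decidable graph\<close>

definition Fun :: "((nat \<Rightarrow> 'a) \<Rightarrow> 'a) \<Rightarrow> bool" where
  "Fun t \<longleftrightarrow> Dec (\<lambda>e. e 0 = t (\<lambda>i. e (Suc i)))"

lemma Fun_rename: "Fun t \<Longrightarrow> Fun (\<lambda>e. t (\<lambda>i. e (\<rho> i)))"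
  unfolding Fun_def
  using Dec_rename[of "\<lambda>e. e 0 = t (\<lambda>i. e (Suc i))" "case_nat 0 (\<lambda>i. Suc (\<rho> i))"] by simp

text \<open>No term of the language need denote \<open>t\<close>. But "some y in the graph satisfies
  Q" and "every y in the graph satisfies Q" say the same, which is a Delta_1 definition.\<close>

lemma Dec_subst:
  assumes "Fun t" "Dec (\<lambda>e. Q (e 0) (\<lambda>i. e (Suc i)))"
  shows "Dec (\<lambda>e. Q (t e) e)"
proof (rule Dec_delta)
  show "Dec (\<lambda>e. e 0 = t (\<lambda>i. e (Suc i)) \<and> Q (e 0) (\<lambda>i. e (Suc i)))"
    "Dec (\<lambda>e. e 0 = t (\<lambda>i. e (Suc i)) \<longrightarrow> Q (e 0) (\<lambda>i. e (Suc i)))"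
    by (intro Dec_conj Dec_imp assms[unfolded Fun_def])+
qed auto

lemma Fun_subst:
  assumes "Fun t" "Fun (\<lambda>e. F (e 0) (\<lambda>i. e (Suc i)))"
  shows "Fun (\<lambda>e. F (t e) e)"
proof -
  have "Dec (\<lambda>e. e 0 = F (e (Suc 0)) (\<lambda>i. e (Suc (Suc i))))"
    using assms(2) unfolding Fun_def .
  from Dec_rename[OF this, of "case_nat 1 (case_nat 0 (\<lambda>i. i + 2))"]
  have "Dec (\<lambda>e. e (Suc 0) = F (e 0) (\<lambda>i. e (Suc (Suc i))))" by simp
  from Dec_subst[where Q="\<lambda>y e. e 0 = F y (\<lambda>i. e (Suc i))", OF Fun_rename[OF assms(1), of Suc] this]
  show ?thesis unfolding Fun_def .
qed

lemma Fun_Tm: "Tm t \<Longrightarrow> Fun t"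
proof -
  assume "Tm t"
  then obtain c s where s: "\<And>e. t e = eval_term M (interleave e c) s"
    unfolding Tm_def TmP_def by blast
  let ?\<sigma> = "\<lambda>i. if even i then Var (i + 2) else Var i"
  have "(\<lambda>i. eval_term M (interleave e c) (?\<sigma> i)) = interleave (\<lambda>i. e (Suc i)) c" for e
    by (rule ext) (auto simp: interleave_def elim: evenE)
  then have "t (\<lambda>i. e (Suc i)) = eval_term M (interleave e c) (subst_term ?\<sigma> s)" for e
    by (simp add: s eval_subst_term)
  then have "Tm (\<lambda>e. t (\<lambda>i. e (Suc i)))" unfolding Tm_def TmP_def by blast
  then show ?thesis unfolding Fun_def by (intro Dec_eq_Tm Tm_var)
qed

lemma Fun_var: "Fun (\<lambda>e. e i)" by (intro Fun_Tm Tm_var)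

lemma Fun_const: "Fun (\<lambda>e. a)" by (intro Fun_Tm Tm_const)

lemma Fun_comp: "Fun (\<lambda>e. f (e 0)) \<Longrightarrow> Fun t \<Longrightarrow> Fun (\<lambda>e. f (t e))"
  using Fun_subst[of t "\<lambda>y e. f y"] by simp

lemma Fun_comp2:
  assumes "Fun (\<lambda>e. f (e 0) (e 1))" "Fun s" "Fun t"
  shows "Fun (\<lambda>e. f (s e) (t e))"
proof -
  have "Fun (\<lambda>e. f (e (Suc 0)) (e 0))"
    using Fun_rename[OF assms(1), of "case_nat 1 (\<lambda>_. 0)"] by simp
  from Fun_subst[where F="\<lambda>y e. f (e 0) y", OF Fun_rename[OF assms(3), of Suc] this]
  have "Fun (\<lambda>e. f (e 0) (t (\<lambda>i. e (Suc i))))" by simp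
  from Fun_subst[where F="\<lambda>y e. f y (t e)", OF assms(2) this] show ?thesis .
qed

lemma Dec_comp: "Dec (\<lambda>e. P (e 0)) \<Longrightarrow> Fun t \<Longrightarrow> Dec (\<lambda>e. P (t e))"
  using Dec_subst[of t "\<lambda>y e. P y"] by simp

lemma Dec_comp2:
  assumes "Dec (\<lambda>e. P (e 0) (e 1))" "Fun s" "Fun t"
  shows "Dec (\<lambda>e. P (s e) (t e))"
proof -
  have "Dec (\<lambda>e. P (e (Suc 0)) (e 0))"
    using Dec_rename[OF assms(1), of "case_nat 1 (\<lambda>_. 0)"] by simp
  from Dec_subst[where Q="\<lambda>y e. P (e 0) y", OF Fun_rename[OF assms(3), of Suc] this]
  have "Dec (\<lambda>e. P (e 0) (t (\<lambda>i. e (Suc i))))" by simp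
  from Dec_subst[where Q="\<lambda>y e. P y (t e)", OF assms(2) this] show ?thesis .
qed

lemma Fun_add: "Fun s \<Longrightarrow> Fun t \<Longrightarrow> Fun (\<lambda>e. s e \<boxplus> t e)"
  and Fun_mult: "Fun s \<Longrightarrow> Fun t \<Longrightarrow> Fun (\<lambda>e. s e \<boxdot> t e)"
  and Fun_pr: "Fun s \<Longrightarrow> Fun t \<Longrightarrow> Fun (\<lambda>e. pr (s e) (t e))"
  by (rule Fun_comp2[of "nadd M"] Fun_comp2[of "nmult M"] Fun_comp2[of pr],
      intro Fun_Tm Tm_add Tm_mult Tm_pr Tm_var, assumption+)+

lemma Dec_eq: "Fun s \<Longrightarrow> Fun t \<Longrightarrow> Dec (\<lambda>e. s e = t e)"
  and Dec_less: "Fun s \<Longrightarrow> Fun t \<Longrightarrow> Dec (\<lambda>e. s e \<prec> t e)"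
  by (rule Dec_comp2[of "(=)"] Dec_comp2[of "nless M"],
      intro Dec_eq_Tm Dec_less_Tm Tm_var, assumption+)+

lemma Dec_nle: "Fun s \<Longrightarrow> Fun t \<Longrightarrow> Dec (\<lambda>e. s e \<preceq> t e)"
  unfolding nle_def by (intro Dec_disj Dec_less Dec_eq)

lemma Dec_mem: "Fun t \<Longrightarrow> X \<in> sets_of M \<Longrightarrow> Dec (\<lambda>e. t e \<in> X)"
  by (rule Dec_comp) (intro Dec_mem_Tm Tm_var)

lemma Dec_bex_less:
  assumes "Fun t" "Dec (\<lambda>e. Q (e 0) (\<lambda>i. e (Suc i)))"
  shows "Dec (\<lambda>e. \<exists>x. x \<prec> t e \<and> Q x e)"
proof (rule Dec_subst[where Q="\<lambda>y e. \<exists>x. x \<prec> y \<and> Q x e", OF assms(1)])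
  have "Dec (\<lambda>e. Q (e 0) (\<lambda>i. e (Suc (Suc i))))"
    using Dec_rename[OF assms(2), of "case_nat 0 (\<lambda>i. i + 2)"] by simp
  then show "Dec (\<lambda>e. \<exists>x. x \<prec> e 0 \<and> Q x (\<lambda>i. e (Suc i)))"
    by (intro Dec_bex_Tm Tm_var)
qed

lemma Dec_ball_less:
  assumes "Fun t" "Dec (\<lambda>e. Q (e 0) (\<lambda>i. e (Suc i)))"
  shows "Dec (\<lambda>e. \<forall>x. x \<prec> t e \<longrightarrow> Q x e)"
  using Dec_not[OF Dec_bex_less[where Q="\<lambda>x e. \<not> Q x e", OF assms(1) Dec_not[OF assms(2)]]] by simp

lemma Dec_bex_nle:
  "Fun t \<Longrightarrow> Dec (\<lambda>e. Q (e 0) (\<lambda>i. e (Suc i))) \<Longrightarrow> Dec (\<lambda>e. \<exists>x. x \<preceq> t e \<and> Q x e)"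
  and Dec_ball_nle:
  "Fun t \<Longrightarrow> Dec (\<lambda>e. Q (e 0) (\<lambda>i. e (Suc i))) \<Longrightarrow> Dec (\<lambda>e. \<forall>x. x \<preceq> t e \<longrightarrow> Q x e)"
  unfolding less_suc_iff[symmetric] by (intro Dec_bex_less Dec_ball_less Fun_add Fun_const; assumption)+

lemma Dec_if:
  "Dec B \<Longrightarrow> Dec P \<Longrightarrow> Dec Q \<Longrightarrow> Dec (\<lambda>e. if B e then P e else Q e)"
  unfolding if_bool_eq_conj by (intro Dec_conj Dec_imp Dec_not)

lemma Fun_if:
  assumes "Dec B" "Fun s" "Fun t"
  shows "Fun (\<lambda>e. if B e then s e else t e)"
proof -
  have "Dec (\<lambda>e. if B (\<lambda>i. e (Suc i)) then e 0 = s (\<lambda>i. e (Suc i)) else e 0 = t (\<lambda>i. e (Suc i)))"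
    by (intro Dec_if Dec_rename[OF assms(1), of Suc] assms(2,3)[unfolded Fun_def])
  moreover have "(e 0 = (if B (\<lambda>i. e (Suc i)) then s (\<lambda>i. e (Suc i)) else t (\<lambda>i. e (Suc i)))) =
    (if B (\<lambda>i. e (Suc i)) then e 0 = s (\<lambda>i. e (Suc i)) else e 0 = t (\<lambda>i. e (Suc i)))" for e
    by simp
  ultimately show ?thesis unfolding Fun_def by simp
qed

lemma Fun_instantiate:
  "Fun t \<Longrightarrow> Fun (\<lambda>e. t (\<lambda>i. if i < k then e i else d i))"
  unfolding Fun_def
proof -
  assume *: "Dec (\<lambda>e. e 0 = t (\<lambda>i. e (Suc i)))"
  show "Dec (\<lambda>e. e 0 = t (\<lambda>i. if i < k then e (Suc i) else d i))"
    using Dec_instantiate[OF *, of "Suc k" "\<lambda>i. d (i - 1)"] by (simp cong: if_cong)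
qed

lemmas dec_intros = Dec_eq Dec_less Dec_nle Dec_const Dec_not Dec_conj Dec_disj Dec_imp Dec_iff
  Dec_bex_less Dec_ball_less Dec_bex_nle Dec_ball_nle Dec_if
  Fun_const Fun_var Fun_add Fun_mult Fun_pr Fun_if

section \<open>Induction and least elements\<close>

lemma dec_least:
  assumes "Dec (\<lambda>e. P (e 0))" "P n"
  obtains m where "P m" "\<And>k. k \<prec> m \<Longrightarrow> \<not> P k"
proof -
  have "(\<forall>k. k \<prec> n \<boxplus> \<^bold>1 \<longrightarrow> \<not> P k)" if no: "\<And>m. P m \<Longrightarrow> \<exists>k. k \<prec> m \<and> P k"
  proof (rule dec_induct[where P="\<lambda>n. \<forall>k. k \<prec> n \<longrightarrow> \<not> P k"])
    show "Dec (\<lambda>e. \<forall>k. k \<prec> e 0 \<longrightarrow> \<not> P k)" by (intro dec_intros assms(1))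
    show "\<forall>k. k \<prec> n \<boxplus> \<^bold>1 \<longrightarrow> \<not> P k" if "\<forall>k. k \<prec> n \<longrightarrow> \<not> P k" for n
      using that no unfolding less_suc by blast
  qed (simp add: not_less_zero)
  moreover have "n \<prec> n \<boxplus> \<^bold>1" by (simp add: less_suc)
  ultimately show ?thesis using that assms(2) by metis
qed

text \<open>Pi_1 induction is Sigma_1 induction run downwards: a failure at \<open>n\<close> is
  pushed to smaller and smaller arguments until it reaches zero.\<close>

lemma pi_induct:
  assumes "Dec (\<lambda>e. A (e 0) (e 1))"
    and "\<And>x. A x \<^bold>0" "\<And>n. \<forall>x. A x n \<Longrightarrow> \<forall>x. A x (n \<boxplus> \<^bold>1)"
  shows "A x n"
proof (rule ccontr)
  assume no: "\<not> A x n"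
  have A: "Dec (\<lambda>e. A (e (Suc 0)) (e 0))" using Dec_rename[OF assms(1), of "case_nat 1 (\<lambda>_. 0)"] by simp
  \<comment> \<open>The induction variable j measures the distance from n, so the failure sits at i
    with i + j = n. The first disjunct makes the claim trivial once j has passed n.\<close>
  have "\<exists>x. n \<prec> n \<or> (\<exists>i. i \<preceq> n \<and> i \<boxplus> n = n \<and> \<not> A x i)"
  proof (rule sigma_induct[where A="\<lambda>x j. n \<prec> j \<or> (\<exists>i. i \<preceq> n \<and> i \<boxplus> j = n \<and> \<not> A x i)" and n=n])
    show "Dec (\<lambda>e. n \<prec> e 1 \<or> (\<exists>i. i \<preceq> n \<and> i \<boxplus> e 1 = n \<and> \<not> A (e 0) i))" by (intro dec_intros A)
    show "\<exists>x. n \<prec> \<^bold>0 \<or> (\<exists>i. i \<preceq> n \<and> i \<boxplus> \<^bold>0 = n \<and> \<not> A x i)" using no by (auto simp: nle_def)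
    show "\<exists>x. n \<prec> j \<boxplus> \<^bold>1 \<or> (\<exists>i. i \<preceq> n \<and> i \<boxplus> (j \<boxplus> \<^bold>1) = n \<and> \<not> A x i)"
      if h: "\<exists>x. n \<prec> j \<or> (\<exists>i. i \<preceq> n \<and> i \<boxplus> j = n \<and> \<not> A x i)" for j
    proof (cases "n \<prec> j \<boxplus> \<^bold>1")
      case False
      then have "\<not> n \<prec> j" by (auto simp: less_suc)
      then obtain x i where i: "i \<preceq> n" "i \<boxplus> j = n" "\<not> A x i" using h by blast
      then have "i \<noteq> \<^bold>0" using assms(2) by auto
      then obtain k where k: "i = k \<boxplus> \<^bold>1" using zero_or_suc by blast
      then obtain y where "\<not> A y k" using assms(3) i(3) by blast
      moreover have "k \<boxplus> (j \<boxplus> \<^bold>1) = n" using i k by (simp add: N.add_ac)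
      moreover then have "k \<preceq> n" by (metis nle_add_right)
      ultimately show ?thesis by blast
    qed blast
  qed
  then show False using assms(2) by (metis N.less_irrefl add_eq_self add_commute')
qed

section \<open>Coding of finite sets\<close>

abbreviation dv :: "'a \<Rightarrow> 'a \<Rightarrow> bool" where "dv a n \<equiv> (\<exists>q. n = a \<boxdot> q)"

lemma dv_iff: "dv a n \<longleftrightarrow> (\<exists>q. q \<preceq> n \<and> n = a \<boxdot> q)"
proof
  assume "dv a n"
  then obtain q where q: "n = a \<boxdot> q" by blast
  show "\<exists>q. q \<preceq> n \<and> n = a \<boxdot> q"
  proof (cases "a = \<^bold>0")
    case False
    then have "\<^bold>1 \<preceq> a" by (metis zero_or_suc nle_iff_add add_commute')
    then have "\<^bold>1 \<boxdot> q \<preceq> a \<boxdot> q" by (intro N.mult_right_mono) simp_all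
    then show ?thesis using q by auto
  qed (use q in auto)
qed blast

lemma Dec_dv: "Fun s \<Longrightarrow> Fun t \<Longrightarrow> Dec (\<lambda>e. dv (s e) (t e))"
  unfolding dv_iff by (intro dec_intros Fun_rename[of _ Suc])

lemma dv_mult: "dv a x \<Longrightarrow> dv a (x \<boxdot> y)"
  by (metis mult_assoc')

lemma dv_add_cancel: assumes "dv a (x \<boxplus> y)" "dv a y" shows "dv a x"
proof -
  obtain p q where "x \<boxplus> y = a \<boxdot> p" "y = a \<boxdot> q" using assms by blast
  then have "nminus (a \<boxdot> p) (a \<boxdot> q) = x" by (metis add_nminus add_commute')
  then show ?thesis by (metis N.right_diff_distrib')
qed

lemmas ring_norm = N.distrib_left N.distrib_right N.add_ac N.mult_ac N.mult_1_left N.mult_1_right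

abbreviation modulus :: "'a \<Rightarrow> 'a \<Rightarrow> 'a" where "modulus m i \<equiv> m \<boxdot> (i \<boxplus> \<^bold>1) \<boxplus> \<^bold>1"

text \<open>Plays the role of a factorial: a multiplier divisible by all numbers up to
  \<open>k\<close> makes the moduli with indices below \<open>k\<close> pairwise coprime.\<close>

lemma common_multiple: "\<exists>m. m \<noteq> \<^bold>0 \<and> (\<forall>j. j \<prec> k \<longrightarrow> dv (j \<boxplus> \<^bold>1) m)"
proof (rule sigma_induct[where A="\<lambda>m k. m \<noteq> \<^bold>0 \<and> (\<forall>j. j \<prec> k \<longrightarrow> dv (j \<boxplus> \<^bold>1) m)"])
  show "Dec (\<lambda>e. e 0 \<noteq> \<^bold>0 \<and> (\<forall>j. j \<prec> e 1 \<longrightarrow> dv (j \<boxplus> \<^bold>1) (e 0)))"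
    by (intro dec_intros Dec_dv)
  show "\<exists>m. m \<noteq> \<^bold>0 \<and> (\<forall>j. j \<prec> \<^bold>0 \<longrightarrow> dv (j \<boxplus> \<^bold>1) m)"
    by (metis not_less_zero suc_not_zero)
  fix k
  assume "\<exists>m. m \<noteq> \<^bold>0 \<and> (\<forall>j. j \<prec> k \<longrightarrow> dv (j \<boxplus> \<^bold>1) m)"
  then obtain m where m: "m \<noteq> \<^bold>0" "\<And>j. j \<prec> k \<Longrightarrow> dv (j \<boxplus> \<^bold>1) m" by blast
  have "m \<boxdot> (k \<boxplus> \<^bold>1) \<noteq> \<^bold>0" using m(1) suc_not_zero by simp
  moreover have "dv (j \<boxplus> \<^bold>1) (m \<boxdot> (k \<boxplus> \<^bold>1))" if "j \<prec> k \<boxplus> \<^bold>1" for j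
    using that m(2) unfolding less_suc by (metis dv_mult mult_commute')
  ultimately show "\<exists>m. m \<noteq> \<^bold>0 \<and> (\<forall>j. j \<prec> k \<boxplus> \<^bold>1 \<longrightarrow> dv (j \<boxplus> \<^bold>1) m)" by blast
qed

text \<open>
  With \<open>l = i + d + 1\<close> the identity \<open>(l + 1) a\<^sub>i = (i + 1) a\<^sub>l + (d + 1)\<close>, where
  \<open>a\<^sub>i = m (i + 1) + 1\<close>, replaces Bezout's identity.
\<close>

lemma modulus_coprime:
  assumes m: "\<And>j. j \<prec> k \<Longrightarrow> dv (j \<boxplus> \<^bold>1) m" and "i \<prec> k" "l \<prec> k" "i \<noteq> l"
    and dv: "dv (modulus m i) (n \<boxdot> modulus m l)"
  shows "dv (modulus m i) n"
proof -
  have id: "(i \<boxplus> d \<boxplus> \<^bold>1 \<boxplus> \<^bold>1) \<boxdot> modulus m i = (i \<boxplus> \<^bold>1) \<boxdot> modulus m (i \<boxplus> d \<boxplus> \<^bold>1) \<boxplus> (d \<boxplus> \<^bold>1)" for i d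
    by (simp only: ring_norm)
  obtain d where d: "d \<prec> k" "dv (modulus m i) (n \<boxdot> (d \<boxplus> \<^bold>1))"
  proof (cases "i \<prec> l")
    case True
    then obtain d where l: "l = i \<boxplus> d \<boxplus> \<^bold>1" unfolding less_iff_add by blast
    have "d \<preceq> l" unfolding l nle_iff_add by (metis add_assoc' add_commute')
    then have "d \<prec> k" using assms(3) by (rule N.le_less_trans)
    moreover have "n \<boxdot> ((l \<boxplus> \<^bold>1) \<boxdot> modulus m i) = n \<boxdot> (d \<boxplus> \<^bold>1) \<boxplus> (n \<boxdot> modulus m l) \<boxdot> (i \<boxplus> \<^bold>1)"
      unfolding l id by (simp only: ring_norm)
    then have "dv (modulus m i) (n \<boxdot> (d \<boxplus> \<^bold>1) \<boxplus> (n \<boxdot> modulus m l) \<boxdot> (i \<boxplus> \<^bold>1))"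
      by (metis mult_assoc' mult_commute')
    then have "dv (modulus m i) (n \<boxdot> (d \<boxplus> \<^bold>1))"
      using dv_add_cancel dv_mult[OF dv] by blast
    ultimately show ?thesis using that by blast
  next
    case False
    then have "l \<prec> i" using assms(4) by (metis N.neq_iff)
    then obtain d where i: "i = l \<boxplus> d \<boxplus> \<^bold>1" unfolding less_iff_add by blast
    have "d \<preceq> i" unfolding i nle_iff_add by (metis add_assoc' add_commute')
    then have "d \<prec> k" using assms(2) by (rule N.le_less_trans)
    moreover have "(n \<boxdot> modulus m l) \<boxdot> (i \<boxplus> \<^bold>1) = n \<boxdot> (d \<boxplus> \<^bold>1) \<boxplus> modulus m i \<boxdot> (n \<boxdot> (l \<boxplus> \<^bold>1))"
      using arg_cong[OF id[of l d], of "\<lambda>x. n \<boxdot> x"]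
      unfolding i[symmetric] by (simp only: ring_norm)
    then have "dv (modulus m i) (n \<boxdot> (d \<boxplus> \<^bold>1) \<boxplus> modulus m i \<boxdot> (n \<boxdot> (l \<boxplus> \<^bold>1)))"
      using dv_mult[OF dv, of "i \<boxplus> \<^bold>1"] by simp
    then have "dv (modulus m i) (n \<boxdot> (d \<boxplus> \<^bold>1))"
      using dv_add_cancel by blast
    ultimately show ?thesis using that by blast
  qed
  \<comment> \<open>Since d + 1 divides m, the modulus a_i divides n m (i + 1). It also divides a_i
    n = n + n m (i + 1), hence it divides n.\<close>
  obtain t where "m = (d \<boxplus> \<^bold>1) \<boxdot> t" using m[OF d(1)] by blast
  then have "n \<boxdot> (m \<boxdot> (i \<boxplus> \<^bold>1)) = n \<boxdot> (d \<boxplus> \<^bold>1) \<boxdot> (t \<boxdot> (i \<boxplus> \<^bold>1))" by (simp add: mult_assoc')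
  then have "dv (modulus m i) (n \<boxdot> (m \<boxdot> (i \<boxplus> \<^bold>1)))" using dv_mult[OF d(2)] by simp
  moreover have "n \<boxplus> n \<boxdot> (m \<boxdot> (i \<boxplus> \<^bold>1)) = modulus m i \<boxdot> n"
    by (simp only: ring_norm)
  ultimately show ?thesis using dv_add_cancel by metis
qed

text \<open>
  The predicate \<open>P\<close> is instantiated by \<open>True\<close>, and, once products are available, by a
  bound for \<open>n\<close>.
\<close>

lemma beta_aux:
  assumes m: "m \<noteq> \<^bold>0" "\<And>j. j \<prec> k \<Longrightarrow> dv (j \<boxplus> \<^bold>1) m" and X: "X \<in> sets_of M"
    and P: "Dec (\<lambda>e. P (e 0) (e 1))" "P \<^bold>1 \<^bold>0" "\<And>n l. P n l \<Longrightarrow> P n (l \<boxplus> \<^bold>1)"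
      "\<And>n l. P n l \<Longrightarrow> P (n \<boxdot> modulus m l) (l \<boxplus> \<^bold>1)"
  shows "\<exists>n. P n l \<and> (\<forall>i. i \<prec> k \<longrightarrow> (dv (modulus m i) n \<longleftrightarrow> i \<in> X \<and> i \<prec> l))"
proof (rule sigma_induct[where A="\<lambda>n l. P n l \<and>
      (\<forall>i. i \<prec> k \<longrightarrow> (dv (modulus m i) n \<longleftrightarrow> i \<in> X \<and> i \<prec> l))"])
  show "Dec (\<lambda>e. P (e 0) (e 1) \<and>
      (\<forall>i. i \<prec> k \<longrightarrow> (dv (modulus m i) (e 0) \<longleftrightarrow> i \<in> X \<and> i \<prec> e 1)))"
    by (intro dec_intros P(1) Dec_dv Dec_mem X)
  \<comment> \<open>Every modulus exceeds 1, so n = 1 describes the empty set.\<close>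
  have "\<not> dv (modulus m i) \<^bold>1" for i
  proof
    assume "dv (modulus m i) \<^bold>1"
    then obtain q where q: "\<^bold>1 = modulus m i \<boxdot> q" by blast
    then obtain q' where "q = q' \<boxplus> \<^bold>1" by (metis zero_or_suc mult_zero N.zero_neq_one)
    then have "\<^bold>1 = modulus m i \<boxdot> q' \<boxplus> m \<boxdot> (i \<boxplus> \<^bold>1) \<boxplus> \<^bold>1"
      using q by (simp add: N.distrib_left N.add_ac)
    then have "m \<boxdot> (i \<boxplus> \<^bold>1) = \<^bold>0"
      by (metis N.add_cancel_left_left N.add_nonneg_eq_0_iff zero_nle)
    then show False using m(1) suc_not_zero by simp
  qed
  then show "\<exists>n. P n \<^bold>0 \<and> (\<forall>i. i \<prec> k \<longrightarrow> (dv (modulus m i) n \<longleftrightarrow> i \<in> X \<and> i \<prec> \<^bold>0))"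
    using P(2) by (metis not_less_zero)
next
  fix l
  assume "\<exists>n. P n l \<and> (\<forall>i. i \<prec> k \<longrightarrow> (dv (modulus m i) n \<longleftrightarrow> i \<in> X \<and> i \<prec> l))"
  then obtain n where n: "P n l" "\<And>i. i \<prec> k \<Longrightarrow> (dv (modulus m i) n \<longleftrightarrow> i \<in> X \<and> i \<prec> l)" by blast
  show "\<exists>n. P n (l \<boxplus> \<^bold>1) \<and> (\<forall>i. i \<prec> k \<longrightarrow> (dv (modulus m i) n \<longleftrightarrow> i \<in> X \<and> i \<prec> l \<boxplus> \<^bold>1))"
  proof (cases "l \<in> X \<and> l \<prec> k")
    case True
    \<comment> \<open>Multiplication by the modulus of l adds l and, by coprimality, leaves all
      other memberships unchanged.\<close>
    have "dv (modulus m i) (n \<boxdot> modulus m l) \<longleftrightarrow> i \<in> X \<and> i \<prec> l \<boxplus> \<^bold>1" if i: "i \<prec> k" for i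
    proof (cases "i = l")
      case True
      then show ?thesis using \<open>l \<in> X \<and> l \<prec> k\<close> by (metis less_suc mult_commute')
    next
      case False
      then have "dv (modulus m i) (n \<boxdot> modulus m l) \<longleftrightarrow> dv (modulus m i) n"
        using modulus_coprime[OF m(2) i conjunct2[OF True] False] dv_mult by blast
      then show ?thesis using False n(2)[OF i] by (simp add: less_suc)
    qed
    then show ?thesis using P(4)[OF n(1)] by blast
  next
    case False
    then have "\<forall>i. i \<prec> k \<longrightarrow> (dv (modulus m i) n \<longleftrightarrow> i \<in> X \<and> i \<prec> l \<boxplus> \<^bold>1)"
      using n(2) unfolding less_suc by blast
    then show ?thesis using P(3)[OF n(1)] by blast
  qed
qed

abbreviation els :: "'a \<Rightarrow> 'a set" where "els \<equiv> elems M"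

lemma mem_els_pr: "i \<in> els (pr k (pr m n)) \<longleftrightarrow> i \<prec> k \<and> dv (modulus m i) n"
  unfolding elems_def by auto

lemma mem_els_less: "i \<in> els c \<Longrightarrow> i \<prec> c"
  unfolding elems_def using pr_bounds(1) by (auto intro: N.less_le_trans)

lemma is_triple_bounded:
  "is_triple M c \<longleftrightarrow> (\<exists>k. k \<preceq> c \<and> (\<exists>m. m \<preceq> c \<and> (\<exists>n. n \<preceq> c \<and> c = pr k (pr m n))))"
  unfolding is_triple_def by (metis pr_bounds N.order_trans)

lemma Dec_is_triple: "Fun t \<Longrightarrow> Dec (\<lambda>e. is_triple M (t e))"
  by (rule Dec_comp) (unfold is_triple_bounded, intro dec_intros)

lemma mem_els_bounded:
  "i \<in> els c \<longleftrightarrow> (\<exists>k. k \<preceq> c \<and> (\<exists>m. m \<preceq> c \<and> (\<exists>n. n \<preceq> c \<and> c = pr k (pr m n) \<and>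
     i \<prec> k \<and> dv (modulus m i) n)))"
  unfolding elems_def by (auto simp only: mem_Collect_eq) (metis pr_bounds N.order_trans)

lemma Dec_mem_els: "Fun s \<Longrightarrow> Fun t \<Longrightarrow> Dec (\<lambda>e. s e \<in> els (t e))"
  by (rule Dec_comp2) (unfold mem_els_bounded, intro dec_intros Dec_dv)

lemma els_eq_bounded:
  "is_triple M d \<and> els d = els c \<and> d \<prec> c \<longleftrightarrow>
   d \<prec> c \<and> is_triple M d \<and> (\<forall>i. i \<prec> c \<longrightarrow> (i \<in> els d \<longleftrightarrow> i \<in> els c))"
  using mem_els_less by (blast intro: N.less_trans)

lemma Dec_finite_set_code: "Fun t \<Longrightarrow> Dec (\<lambda>e. finite_set_code M (t e))"
proof (rule Dec_comp)
  have eq: "finite_set_code M c \<longleftrightarrow>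
      is_triple M c \<and> \<not> (\<exists>d. is_triple M d \<and> els d = els c \<and> d \<prec> c)" for c
    unfolding finite_set_code_def by blast
  show "Dec (\<lambda>e. finite_set_code M (e 0))"
    unfolding eq els_eq_bounded by (intro dec_intros Dec_is_triple Dec_mem_els)
qed

section \<open>Canonical codes of bounded sets\<close>

definition Fin :: "'a set \<Rightarrow> bool" where
  "Fin X \<longleftrightarrow> X \<in> sets_of M \<and> (\<exists>k. \<forall>i\<in>X. i \<prec> k)"

definition code :: "'a set \<Rightarrow> 'a" where
  "code X = (THE c. finite_set_code M c \<and> els c = X)"

lemma finite_set_code_inject:
  "finite_set_code M c \<Longrightarrow> finite_set_code M d \<Longrightarrow> els c = els d \<Longrightarrow> c = d"
  unfolding finite_set_code_def by (metis N.neq_iff)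

lemma code_els: "finite_set_code M c \<Longrightarrow> code (els c) = c"
  unfolding code_def by (rule the_equality) (auto intro: finite_set_code_inject)

text \<open>The bound by the given triple \<open>d\<close> is kept because
  \<open>Fun_code_bound\<close> turns it into a computable bound on codes.\<close>

lemma ex_finite_set_code:
  assumes "Fin X" "is_triple M d" "els d = X"
  shows "\<exists>c. finite_set_code M c \<and> els c = X \<and> c \<preceq> d"
proof -
  obtain k where k: "\<And>i. i \<in> X \<Longrightarrow> i \<prec> k" and X: "X \<in> sets_of M" using assms(1) unfolding Fin_def by blast
  \<comment> \<open>Members of \<open>els c\<close> are below c and members of X are below k, so
    equality need only be tested below c + k and is decidable.\<close>
  have "els c = X \<longleftrightarrow> (\<forall>i. i \<prec> c \<boxplus> k \<longrightarrow> (i \<in> els c \<longleftrightarrow> i \<in> X))" for c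
    using k mem_els_less by (meson N.less_le_trans nle_add_left nle_add_right set_eq_iff)
  then have "Dec (\<lambda>e. is_triple M (e 0) \<and> els (e 0) = X)"
    by (simp only:) (intro dec_intros Dec_is_triple Dec_mem_els Dec_mem X)
  then obtain c where c: "is_triple M c \<and> els c = X" "\<And>d. d \<prec> c \<Longrightarrow> \<not> (is_triple M d \<and> els d = X)"
    by (rule dec_least[of _ d]) (use assms in auto)
  then have "c \<preceq> d" using assms by (metis N.not_le)
  then show ?thesis using c unfolding finite_set_code_def by metis
qed

lemma Fin_code:
  assumes "Fin X"
  shows "finite_set_code M (code X)" "els (code X) = X"
proof -
  obtain k where k: "\<And>i. i \<in> X \<Longrightarrow> i \<prec> k" and X: "X \<in> sets_of M" using assms(1) unfolding Fin_def by blast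
  obtain m where m: "m \<noteq> \<^bold>0" "\<And>j. j \<prec> k \<Longrightarrow> dv (j \<boxplus> \<^bold>1) m" using common_multiple by blast
  have "\<exists>n. True \<and> (\<forall>i. i \<prec> k \<longrightarrow> (dv (modulus m i) n \<longleftrightarrow> i \<in> X \<and> i \<prec> k))"
    by (rule beta_aux[OF m X, where P="\<lambda>_ _. True"]) (simp_all add: Dec_const)
  then obtain n where n: "\<And>i. i \<prec> k \<Longrightarrow> (dv (modulus m i) n \<longleftrightarrow> i \<in> X \<and> i \<prec> k)"
    by blast
  have "els (pr k (pr m n)) = X"
    by (rule Set.set_eqI) (unfold mem_els_pr, use n k in blast)
  moreover have "is_triple M (pr k (pr m n))" unfolding is_triple_def by blast
  ultimately obtain c where c: "finite_set_code M c" "els c = X"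
    using ex_finite_set_code[OF assms] by blast
  then have "code X = c" using code_els by blast
  then show "finite_set_code M (code X)" "els (code X) = X" using c by simp_all
qed

section \<open>Uniformly computable finite sets\<close>

text \<open>A finite set that varies with the environment. The computable bound turns a quantifier
  over its members into a bounded quantifier.\<close>

definition Ff :: "((nat \<Rightarrow> 'a) \<Rightarrow> 'a set) \<Rightarrow> bool" where
  "Ff S \<longleftrightarrow> Dec (\<lambda>e. e 0 \<in> S (\<lambda>i. e (Suc i))) \<and> (\<exists>b. Fun b \<and> (\<forall>e. \<forall>x\<in>S e. x \<prec> b e))"

lemma Ff_I:
  "Fun b \<Longrightarrow> (\<And>e x. x \<in> S e \<Longrightarrow> x \<prec> b e) \<Longrightarrow> Dec (\<lambda>e. e 0 \<in> S (\<lambda>i. e (Suc i))) \<Longrightarrow> Ff S"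
  unfolding Ff_def by blast

lemma Dec_mem_Ff: "Fun t \<Longrightarrow> Ff S \<Longrightarrow> Dec (\<lambda>e. t e \<in> S e)"
  unfolding Ff_def by (rule Dec_subst[where Q="\<lambda>y e. y \<in> S e"]) blast+

lemma Ff_rename: "Ff S \<Longrightarrow> Ff (\<lambda>e. S (\<lambda>i. e (\<rho> i)))"
proof -
  assume S: "Ff S"
  then obtain b where b: "Fun b" "\<And>e x. x \<in> S e \<Longrightarrow> x \<prec> b e" unfolding Ff_def by blast
  have "Dec (\<lambda>e. e 0 \<in> S (\<lambda>i. e (Suc (\<rho> i))))"
    using S Dec_rename[of "\<lambda>e. e 0 \<in> S (\<lambda>i. e (Suc i))" "case_nat 0 (\<lambda>i. Suc (\<rho> i))"]
    unfolding Ff_def by simp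
  then show ?thesis by (rule Ff_I[OF Fun_rename[OF b(1), of \<rho>], rotated]) (rule b(2))
qed

lemma Ff_els: "Fun t \<Longrightarrow> Ff (\<lambda>e. els (t e))"
  by (rule Ff_I[of t], assumption, erule mem_els_less) (rule Dec_mem_els[OF Fun_var Fun_rename])

lemma Ff_Collect:
  assumes "Ff S" "Dec (\<lambda>e. Q (e 0) (\<lambda>i. e (Suc i)))"
  shows "Ff (\<lambda>e. {x \<in> S e. Q x e})"
  using assms unfolding Ff_def by (auto intro: Dec_conj)

lemma Ff_subset:
  assumes "Ff T" "Dec (\<lambda>e. e 0 \<in> S (\<lambda>i. e (Suc i)))" "\<And>e. S e \<subseteq> T e"
  shows "Ff S"
  using assms unfolding Ff_def by blast

lemma Ff_empty: "Ff (\<lambda>e. {})"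
  by (rule Ff_I[of "\<lambda>_. \<^bold>0"]) (auto intro: Fun_const Dec_const)

lemma Ff_single: "Fun t \<Longrightarrow> Ff (\<lambda>e. {t e})"
  by (rule Ff_I[OF Fun_add[OF _ Fun_const[of "\<^bold>1"]]], assumption, simp add: less_suc, unfold singleton_iff)
    (rule Dec_eq[OF Fun_var Fun_rename])

lemma Ff_Un: assumes "Ff S" "Ff T" shows "Ff (\<lambda>e. S e \<union> T e)"
proof -
  obtain b c where b: "Fun b" "\<And>e x. x \<in> S e \<Longrightarrow> x \<prec> b e" and c: "Fun c" "\<And>e x. x \<in> T e \<Longrightarrow> x \<prec> c e"
    using assms unfolding Ff_def by blast
  show ?thesis
  proof (rule Ff_I[of "\<lambda>e. b e \<boxplus> c e"])
    show "x \<prec> b e \<boxplus> c e" if "x \<in> S e \<union> T e" for e x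
      using that b(2)[of x e] c(2)[of x e] by (meson N.less_le_trans nle_add_left nle_add_right Un_iff)
    show "Dec (\<lambda>e. e 0 \<in> S (\<lambda>i. e (Suc i)) \<union> T (\<lambda>i. e (Suc i)))"
      unfolding Un_iff using assms unfolding Ff_def by (intro Dec_disj) blast+
  qed (intro Fun_add b c)
qed

lemma Ff_insert: "Fun t \<Longrightarrow> Ff S \<Longrightarrow> Ff (\<lambda>e. insert (t e) (S e))"
  using Ff_Un[OF Ff_single, of t S] by simp

lemma Ff_Int: "Ff S \<Longrightarrow> Ff T \<Longrightarrow> Ff (\<lambda>e. S e \<inter> T e)"
  unfolding Int_def by (intro Ff_Collect) (auto simp: Ff_def)

lemma Ff_Diff: "Ff S \<Longrightarrow> Ff T \<Longrightarrow> Ff (\<lambda>e. S e - T e)"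
  unfolding set_diff_eq by (intro Ff_Collect Dec_not) (auto simp: Ff_def)

lemma Ff_lessThan: "Fun t \<Longrightarrow> Ff (\<lambda>e. {x. x \<prec> t e})"
  by (rule Ff_I[of t], assumption, simp, unfold mem_Collect_eq) (rule Dec_less[OF Fun_var Fun_rename])

lemma Ff_const: "Fin X \<Longrightarrow> Ff (\<lambda>e. X)"
  unfolding Fin_def by (elim conjE exE, rule Ff_I[OF Fun_const]) (auto intro: Dec_mem Fun_var)

lemma Dec_bex_Ff:
  assumes "Ff S" "Dec (\<lambda>e. Q (e 0) (\<lambda>i. e (Suc i)))"
  shows "Dec (\<lambda>e. \<exists>x\<in>S e. Q x e)"
proof -
  obtain b where b: "Fun b" "\<And>e x. x \<in> S e \<Longrightarrow> x \<prec> b e" using assms unfolding Ff_def by blast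
  have "(\<exists>x\<in>S e. Q x e) \<longleftrightarrow> (\<exists>x. x \<prec> b e \<and> x \<in> S e \<and> Q x e)" for e using b(2) by blast
  moreover have "Dec (\<lambda>e. \<exists>x. x \<prec> b e \<and> x \<in> S e \<and> Q x e)"
    using assms unfolding Ff_def by (intro Dec_bex_less b Dec_conj) blast+
  ultimately show ?thesis by simp
qed

lemma Dec_ball_Ff:
  assumes "Ff S" "Dec (\<lambda>e. Q (e 0) (\<lambda>i. e (Suc i)))"
  shows "Dec (\<lambda>e. \<forall>x\<in>S e. Q x e)"
  using Dec_not[OF Dec_bex_Ff[where Q="\<lambda>x e. \<not> Q x e", OF assms(1) Dec_not[OF assms(2)]]] by simp

lemma Dec_subset_Ff:
  assumes "Ff S" "Ff T" shows "Dec (\<lambda>e. S e \<subseteq> T e)"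
  unfolding subset_iff using Dec_ball_Ff[where Q="\<lambda>x e. x \<in> T e", OF assms(1)] assms(2)
  unfolding Ff_def Ball_def by blast

lemma Dec_eq_Ff: "Ff S \<Longrightarrow> Ff T \<Longrightarrow> Dec (\<lambda>e. S e = T e)"
  unfolding set_eq_subset by (intro Dec_conj Dec_subset_Ff)

lemma Ff_Fin: assumes "Ff S" shows "Fin (S e)"
proof -
  have "Dec (\<lambda>e'. e' 0 \<in> S (\<lambda>i. e i))"
    using assms Dec_instantiate[of "\<lambda>e. e 0 \<in> S (\<lambda>i. e (Suc i))" 1 "\<lambda>i. e (i - 1)"]
    unfolding Ff_def by simp
  then have "{x. x \<in> S e} \<in> sets_of M" by (intro dec_comprehension)
  then show ?thesis using assms unfolding Ff_def Fin_def by auto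
qed

text \<open>No search is involved: a number is the code exactly if it is a canonical code with the
  right members, and both conditions are decidable.\<close>

lemma Fun_code: assumes "Ff S" shows "Fun (\<lambda>e. code (S e))"
proof -
  have "(c = code (S e)) \<longleftrightarrow> finite_set_code M c \<and> els c = S e" for c e
    using Fin_code[OF Ff_Fin[OF assms]] code_els by metis
  then show ?thesis unfolding Fun_def
    by (simp only:) (intro Dec_conj Dec_finite_set_code Dec_eq_Ff Ff_els Fun_var Ff_rename[OF assms])
qed

lemmas Ff_intros = Dec_mem_els Dec_finite_set_code Dec_bex_Ff Dec_ball_Ff Fun_code
  Ff_els Ff_empty Ff_insert Ff_Un Ff_Int Ff_Diff Ff_lessThan Ff_Collect

lemma Fin_empty: "Fin {}" and Fin_insert: "Fin X \<Longrightarrow> Fin (insert a X)"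
  and Fin_Un: "Fin X \<Longrightarrow> Fin Y \<Longrightarrow> Fin (X \<union> Y)" and Fin_els: "Fin (els c)"
  using Ff_Fin[OF Ff_empty] Ff_Fin[OF Ff_insert[OF Fun_const Ff_const]]
    Ff_Fin[OF Ff_Un[OF Ff_const Ff_const]] Ff_Fin[OF Ff_els[OF Fun_const]] by blast+

lemma Fin_Collect: "Fin X \<Longrightarrow> Dec (\<lambda>e. P (e 0)) \<Longrightarrow> Fin {x\<in>X. P x}"
  by (rule Ff_Fin[OF Ff_Collect[where Q="\<lambda>x e. P x" and S="\<lambda>e. X"]]) (rule Ff_const)

section \<open>Primitive recursion\<close>

text \<open>A history of the recursion up to \<open>n\<close>, stored as a finite set of pairs
  (index, value). All values are quantified below the code \<open>c\<close>, so being a history is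
  decidable.\<close>

definition rseq :: "'a \<Rightarrow> ('a \<Rightarrow> 'a \<Rightarrow> 'a) \<Rightarrow> 'a \<Rightarrow> 'a \<Rightarrow> bool" where
  "rseq a h n c \<longleftrightarrow> pr \<^bold>0 a \<in> els c \<and>
     (\<forall>i. i \<prec> n \<longrightarrow> (\<forall>y. y \<preceq> c \<longrightarrow> pr i y \<in> els c \<longrightarrow> pr (i \<boxplus> \<^bold>1) (h i y) \<in> els c)) \<and>
     (\<forall>i. i \<preceq> n \<longrightarrow> (\<forall>y. y \<preceq> c \<longrightarrow> (\<forall>y'. y' \<preceq> c \<longrightarrow> pr i y \<in> els c \<longrightarrow> pr i y' \<in> els c \<longrightarrow> y = y'))) \<and>
     (\<forall>z\<in>els c. \<exists>i. i \<preceq> n \<and> (\<exists>y. y \<preceq> z \<and> z = pr i y))"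

definition nrec :: "'a \<Rightarrow> ('a \<Rightarrow> 'a \<Rightarrow> 'a) \<Rightarrow> 'a \<Rightarrow> 'a" where
  "nrec a h n = (THE y. \<exists>c. rseq a h n c \<and> pr n y \<in> els c)"

lemma pr_mem_els_bounds: "pr i y \<in> els c \<Longrightarrow> i \<prec> c" "pr i y \<in> els c \<Longrightarrow> y \<prec> c"
  using mem_els_less pr_bounds by (blast intro: N.le_less_trans)+

lemma rseq_D:
  assumes "rseq a h n c"
  shows "pr \<^bold>0 a \<in> els c"
    "i \<prec> n \<Longrightarrow> pr i y \<in> els c \<Longrightarrow> pr (i \<boxplus> \<^bold>1) (h i y) \<in> els c"
    "i \<preceq> n \<Longrightarrow> pr i y \<in> els c \<Longrightarrow> pr i y' \<in> els c \<Longrightarrow> y = y'"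
    "pr i y \<in> els c \<Longrightarrow> i \<preceq> n"
proof -
  show "pr \<^bold>0 a \<in> els c" using assms unfolding rseq_def by blast
  show "i \<prec> n \<Longrightarrow> pr i y \<in> els c \<Longrightarrow> pr (i \<boxplus> \<^bold>1) (h i y) \<in> els c"
    using assms pr_mem_els_bounds(2)[of i y c] unfolding rseq_def nle_def by blast
  show "i \<preceq> n \<Longrightarrow> pr i y \<in> els c \<Longrightarrow> pr i y' \<in> els c \<Longrightarrow> y = y'"
    using assms pr_mem_els_bounds(2)[of i y c] pr_mem_els_bounds(2)[of i y' c]
    unfolding rseq_def nle_def by blast
  show "pr i y \<in> els c \<Longrightarrow> i \<preceq> n" using assms unfolding rseq_def by fastforce
qed

text \<open>Induction along the index, with the common value bounded by the code. Comparing a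
  history with itself shows that it has a value at every index up to its length.\<close>

lemma rseq_agree:
  assumes "rseq a h n c" "rseq a h n' c'" "i \<preceq> n" "i \<preceq> n'"
  obtains y where "pr i y \<in> els c" "pr i y \<in> els c'"
proof -
  have "i \<preceq> n \<and> i \<preceq> n' \<longrightarrow> (\<exists>y. y \<preceq> c \<and> pr i y \<in> els c \<and> pr i y \<in> els c')"
  proof (rule dec_induct[where P="\<lambda>i. i \<preceq> n \<and> i \<preceq> n' \<longrightarrow> (\<exists>y. y \<preceq> c \<and> pr i y \<in> els c \<and> pr i y \<in> els c')"])
    show "Dec (\<lambda>e. e 0 \<preceq> n \<and> e 0 \<preceq> n' \<longrightarrow> (\<exists>y. y \<preceq> c \<and> pr (e 0) y \<in> els c \<and> pr (e 0) y \<in> els c'))"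
      by (intro dec_intros Dec_mem_els)
    show "\<^bold>0 \<preceq> n \<and> \<^bold>0 \<preceq> n' \<longrightarrow> (\<exists>y. y \<preceq> c \<and> pr \<^bold>0 y \<in> els c \<and> pr \<^bold>0 y \<in> els c')"
      using rseq_D(1) assms(1,2) pr_mem_els_bounds(2) nle_def by blast
    show "i \<boxplus> \<^bold>1 \<preceq> n \<and> i \<boxplus> \<^bold>1 \<preceq> n' \<longrightarrow> (\<exists>y. y \<preceq> c \<and> pr (i \<boxplus> \<^bold>1) y \<in> els c \<and> pr (i \<boxplus> \<^bold>1) y \<in> els c')"
      if IH: "i \<preceq> n \<and> i \<preceq> n' \<longrightarrow> (\<exists>y. y \<preceq> c \<and> pr i y \<in> els c \<and> pr i y \<in> els c')" for i
    proof
      assume "i \<boxplus> \<^bold>1 \<preceq> n \<and> i \<boxplus> \<^bold>1 \<preceq> n'"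
      then have i: "i \<prec> n" "i \<prec> n'" unfolding suc_nle_iff by blast+
      then obtain y where "pr i y \<in> els c" "pr i y \<in> els c'" using IH unfolding nle_def by blast
      then have "pr (i \<boxplus> \<^bold>1) (h i y) \<in> els c" "pr (i \<boxplus> \<^bold>1) (h i y) \<in> els c'"
        using rseq_D(2)[OF assms(1)] rseq_D(2)[OF assms(2)] i by blast+
      then show "\<exists>y. y \<preceq> c \<and> pr (i \<boxplus> \<^bold>1) y \<in> els c \<and> pr (i \<boxplus> \<^bold>1) y \<in> els c'"
        using pr_mem_els_bounds(2) nle_def by blast
    qed
  qed
  then show ?thesis using that assms(3,4) by blast
qed

lemma Dec_rseq:
  assumes "Fun (\<lambda>e. h (e 0) (e 1) (\<lambda>i. e (Suc (Suc i))))"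
  shows "Dec (\<lambda>e. rseq (e p) (\<lambda>i y. h i y (\<lambda>i. e (\<rho> i))) (e q) (e r))"
proof -
  have "Fun (\<lambda>e. h (e (Suc 0)) (e 0) (\<lambda>i. e (Suc (Suc (\<rho> i)))))"
    using Fun_rename[OF assms, of "case_nat 1 (case_nat 0 (\<lambda>i. Suc (Suc (\<rho> i))))"] by simp
  then show ?thesis unfolding rseq_def by (intro dec_intros Ff_intros)
qed

lemma ex_rseq:
  assumes "Fun (\<lambda>e. h (e 0) (e 1))"
  shows "\<exists>c. rseq a h n c"
proof (rule sigma_induct[where A="\<lambda>c n. rseq a h n c"])
  have "Dec (\<lambda>e. rseq (e 2) h (e 1) (e 0))"
    using Dec_rseq[of "\<lambda>i y e. h i y" 2 undefined 1 0] assms by simp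
  from Dec_instantiate[OF this, of 2 "\<lambda>_. a"] show "Dec (\<lambda>e. rseq a h (e 1) (e 0))" by simp
next
  have F: "Fin {pr \<^bold>0 a}" by (intro Fin_insert Fin_empty)
  show "\<exists>c. rseq a h \<^bold>0 c"
    by (rule exI[of _ "code {pr \<^bold>0 a}"])
      (auto simp: rseq_def Fin_code(2)[OF F] not_less_zero pr_bounds)
next
  fix n assume "\<exists>c. rseq a h n c"
  then obtain c where c: "rseq a h n c" by blast
  obtain y where y: "pr n y \<in> els c" using rseq_agree[OF c c, of n] by auto
  let ?S = "insert (pr (n \<boxplus> \<^bold>1) (h n y)) (els c)"
  have F: "els (code ?S) = ?S" by (intro Fin_code Fin_insert Fin_els)
  have new: "pr (n \<boxplus> \<^bold>1) w \<notin> els c" for w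
    using rseq_D(4)[OF c] by (metis suc_nle_iff N.less_irrefl)
  have "rseq a h (n \<boxplus> \<^bold>1) (code ?S)"
    unfolding rseq_def F
  proof (intro conjI allI impI ballI)
    show "pr \<^bold>0 a \<in> ?S" using rseq_D(1)[OF c] by blast
  next
    fix i w assume i: "i \<prec> n \<boxplus> \<^bold>1" and w: "pr i w \<in> ?S"
    have "i \<noteq> n \<boxplus> \<^bold>1" using i N.less_irrefl by blast
    then have w': "pr i w \<in> els c" using w by simp
    show "pr (i \<boxplus> \<^bold>1) (h i w) \<in> ?S"
    proof (cases "i = n")
      case True
      then have "w = y" using rseq_D(3)[OF c, of n] y w' by simp
      then show ?thesis using True by simp
    next
      case False
      then show ?thesis using i rseq_D(2)[OF c _ w'] unfolding less_suc by blast
    qed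
  next
    fix i w w' assume i: "i \<preceq> n \<boxplus> \<^bold>1" and w: "pr i w \<in> ?S" "pr i w' \<in> ?S"
    show "w = w'"
    proof (cases "i = n \<boxplus> \<^bold>1")
      case True
      then show ?thesis using w new by auto
    next
      case False
      then have "i \<preceq> n" using i by (metis less_suc_iff nle_def)
      then show ?thesis using False w rseq_D(3)[OF c] by auto
    qed
  next
    fix z assume "z \<in> ?S"
    then show "\<exists>i. i \<preceq> n \<boxplus> \<^bold>1 \<and> (\<exists>y. y \<preceq> z \<and> z = pr i y)"
    proof
      assume "z = pr (n \<boxplus> \<^bold>1) (h n y)"
      then show ?thesis using pr_bounds(2) nle_def by blast
    next
      assume "z \<in> els c"
      then obtain i w where i: "i \<preceq> n" "w \<preceq> z" "z = pr i w" using c unfolding rseq_def by blast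
      moreover have "i \<preceq> n \<boxplus> \<^bold>1" using i(1) nle_add_right N.order_trans by blast
      ultimately show ?thesis by blast
    qed
  qed
  then show "\<exists>c. rseq a h (n \<boxplus> \<^bold>1) c" by blast
qed

lemma nrec_eq:
  assumes "rseq a h n c" "pr n y \<in> els c"
  shows "nrec a h n = y"
  unfolding nrec_def
proof (rule the_equality)
  show "\<exists>c. rseq a h n c \<and> pr n y \<in> els c" using assms by blast
  show "\<And>y'. \<exists>c. rseq a h n c \<and> pr n y' \<in> els c \<Longrightarrow> y' = y"
    using rseq_agree[OF assms(1)] rseq_D(3) assms by (metis nle_def)
qed

lemma nrec_prefix:
  assumes "Fun (\<lambda>e. h (e 0) (e 1))" "rseq a h n c" "i \<preceq> n" "pr i y \<in> els c"
  shows "nrec a h i = y"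
proof -
  obtain d where d: "rseq a h i d" using ex_rseq[OF assms(1)] by blast
  obtain y' where y': "pr i y' \<in> els d" "pr i y' \<in> els c"
    using rseq_agree[OF d assms(2)] assms(3) by (auto simp: nle_def)
  then have "y' = y" using rseq_D(3)[OF assms(2,3)] assms(4) by blast
  then show ?thesis using nrec_eq[OF d] y' by simp
qed

theorem
  assumes "Fun (\<lambda>e. h (e 0) (e 1))"
  shows nrec_zero: "nrec a h \<^bold>0 = a"
    and nrec_suc: "nrec a h (n \<boxplus> \<^bold>1) = h n (nrec a h n)"
proof -
  obtain c where c: "rseq a h (n \<boxplus> \<^bold>1) c" using ex_rseq[OF assms] by blast
  have n: "n \<prec> n \<boxplus> \<^bold>1" by (simp add: less_suc)
  show "nrec a h \<^bold>0 = a" using nrec_prefix[OF assms c zero_nle rseq_D(1)[OF c]] .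
  obtain y where y: "pr n y \<in> els c" using rseq_agree[OF c c, of n] n by (auto simp: nle_def)
  then have "nrec a h n = y" using nrec_prefix[OF assms c] n nle_def by blast
  moreover have "pr (n \<boxplus> \<^bold>1) (h n y) \<in> els c" using rseq_D(2)[OF c n y] .
  then have "nrec a h (n \<boxplus> \<^bold>1) = h n y" using nrec_eq[OF c] by blast
  ultimately show "nrec a h (n \<boxplus> \<^bold>1) = h n (nrec a h n)" by simp
qed

text \<open>All histories of the same recursion agree, so the value can be read off some history or
  off every history; hence the graph is Delta_1.\<close>

theorem Fun_nrec:
  assumes h: "Fun (\<lambda>e. h (e 0) (e 1) (\<lambda>i. e (Suc (Suc i))))" and "Fun g" "Fun t"
  shows "Fun (\<lambda>e. nrec (g e) (\<lambda>i y. h i y e) (t e))"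
proof -
  have inst: "Fun (\<lambda>e. h (e 0) (e 1) d)" for d
    using Fun_instantiate[OF h, of 2 "\<lambda>i. d (i - 2)"] by simp
  \<comment> \<open>Start value and length are plain variables at first; the functions g and t are
    substituted for them at the end.\<close>
  have "Dec (\<lambda>e. e 0 = nrec (e 1) (\<lambda>i y. h i y (\<lambda>i. e (i + 3))) (e 2))"
  proof (rule Dec_delta[where
        A="\<lambda>c e. rseq (e 1) (\<lambda>i y. h i y (\<lambda>i. e (i + 3))) (e 2) c \<and> pr (e 2) (e 0) \<in> els c" and
        B="\<lambda>c e. rseq (e 1) (\<lambda>i y. h i y (\<lambda>i. e (i + 3))) (e 2) c \<longrightarrow> pr (e 2) (e 0) \<in> els c"])
    show "Dec (\<lambda>e. rseq (e (Suc 1)) (\<lambda>i y. h i y (\<lambda>i. e (Suc (i + 3)))) (e (Suc 2)) (e 0) \<and>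
        pr (e (Suc 2)) (e (Suc 0)) \<in> els (e 0))"
      "Dec (\<lambda>e. rseq (e (Suc 1)) (\<lambda>i y. h i y (\<lambda>i. e (Suc (i + 3)))) (e (Suc 2)) (e 0) \<longrightarrow>
        pr (e (Suc 2)) (e (Suc 0)) \<in> els (e 0))"
      by (intro dec_intros Ff_intros Dec_rseq[OF h])+
  next
    fix e
    let ?h = "\<lambda>i y. h i y (\<lambda>i. e (i + 3))"
    let ?A = "\<lambda>c. rseq (e 1) ?h (e 2) c"
    obtain c where c: "?A c" using ex_rseq[of ?h] inst by blast
    obtain y where y: "pr (e 2) y \<in> els c" using rseq_agree[OF c c, of "e 2"] by (auto simp: nle_def)
    have eq: "e 0 = nrec (e 1) ?h (e 2) \<longleftrightarrow> pr (e 2) (e 0) \<in> els d" if d: "?A d" for d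
    proof -
      obtain w where "pr (e 2) w \<in> els d" using rseq_agree[OF d d, of "e 2"] by (auto simp: nle_def)
      then show ?thesis using nrec_eq[OF d] by metis
    qed
    show "e 0 = nrec (e 1) ?h (e 2) \<longleftrightarrow>
        (\<exists>c. rseq (e 1) (\<lambda>i y. h i y (\<lambda>i. e (i + 3))) (e 2) c \<and> pr (e 2) (e 0) \<in> els c)"
      using eq c by blast
    show "e 0 = nrec (e 1) ?h (e 2) \<longleftrightarrow>
        (\<forall>c. rseq (e 1) (\<lambda>i y. h i y (\<lambda>i. e (i + 3))) (e 2) c \<longrightarrow> pr (e 2) (e 0) \<in> els c)"
      using eq c by blast
  qed
  then have "Fun (\<lambda>e. nrec (e 0) (\<lambda>i y. h i y (\<lambda>i. e (i + 2))) (e 1))"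
    unfolding Fun_def by (simp add: eval_nat_numeral)
  then have 1: "Fun (\<lambda>e. nrec (e 1) (\<lambda>i y. h i y (\<lambda>i. e (i + 2))) (e 0))"
    using Fun_rename[of _ "case_nat 1 (case_nat 0 (\<lambda>i. i + 2))"] by fastforce
  have "Fun (\<lambda>e. nrec (e 0) (\<lambda>i y. h i y (\<lambda>i. e (Suc i))) (t (\<lambda>i. e (Suc i))))"
    using Fun_subst[where F="\<lambda>y e. nrec (e 0) (\<lambda>i y. h i y (\<lambda>i. e (Suc i))) y", OF Fun_rename[OF assms(3), of Suc]] 1
    by simp
  from Fun_subst[where F="\<lambda>y e. nrec y (\<lambda>i y. h i y e) (t e)", OF assms(2) this]
  show ?thesis .
qed

section \<open>Bounded comprehension\<close>

text \<open>Count the i below \<open>k\<close> that have a witness below w. The count is monotone in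
  w and at most \<open>k\<close>, so it is largest for some w. Beyond that w no further i acquires a
  witness, and the set becomes decidable.\<close>

theorem bounded_sigma_comprehension:
  assumes A: "Dec (\<lambda>e. A (e 0) (e 1))"
  shows "Fin {i. i \<prec> k \<and> (\<exists>x. A x i)}"
proof -
  define H where "H w i y = (if (\<exists>x. x \<prec> w \<and> A x i) then y \<boxplus> \<^bold>1 else y)" for w i y
  define cnt where "cnt w n = nrec \<^bold>0 (H w) n" for w n
  have A': "Dec (\<lambda>e. A (e p) (e q))" for p q
    using Dec_rename[OF A, of "case_nat p (\<lambda>_. q)"] by simp
  have H: "Fun (\<lambda>e. H (e p) (e q) (e r))" for p q r
    unfolding H_def by (intro dec_intros A')
  have Hw: "Fun (\<lambda>e. H w (e 0) (e 1))" for w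
    using Fun_instantiate[OF H[of 2 0 1], of 2 "\<lambda>_. w"] by simp
  have cnt0: "cnt w \<^bold>0 = \<^bold>0" and cntS: "cnt w (n \<boxplus> \<^bold>1) = H w n (cnt w n)" for w n
    unfolding cnt_def using nrec_zero[OF Hw] nrec_suc[OF Hw] by simp_all
  have cnt: "Fun (\<lambda>e. cnt (e p) (e q))" for p q
    unfolding cnt_def using Fun_nrec[where h="\<lambda>i y e. H (e p) i y", OF _ Fun_const Fun_var] H by simp
  have mono: "cnt w n \<preceq> cnt w' n" if "w \<preceq> w'" for w w' n
  proof (rule dec_induct[where P="\<lambda>n. cnt w n \<preceq> cnt w' n"])
    show "Dec (\<lambda>e. cnt w (e 0) \<preceq> cnt w' (e 0))"
      using Dec_instantiate[OF Dec_nle[OF cnt[of 1 0] cnt[of 2 0]], of 1 "case_nat w (case_nat w (\<lambda>_. w'))"]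
      by (simp add: eval_nat_numeral)
    show "cnt w \<^bold>0 \<preceq> cnt w' \<^bold>0" by (simp add: cnt0)
    fix n assume IH: "cnt w n \<preceq> cnt w' n"
    have "\<exists>x. x \<prec> w' \<and> A x n" if "\<exists>x. x \<prec> w \<and> A x n" using that \<open>w \<preceq> w'\<close> by (blast intro: N.less_le_trans)
    then show "cnt w (n \<boxplus> \<^bold>1) \<preceq> cnt w' (n \<boxplus> \<^bold>1)" using IH
      unfolding cntS H_def by (auto intro: N.add_right_mono N.order_trans[OF _ nle_add_right])
  qed
  have strict: "cnt w n \<prec> cnt w' n" if "w \<preceq> w'" "\<not> (\<exists>x. x \<prec> w \<and> A x i)" "\<exists>x. x \<prec> w' \<and> A x i" "i \<prec> n" for w w' n i
  proof -
    have "i \<prec> n \<longrightarrow> cnt w n \<prec> cnt w' n"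
    proof (rule dec_induct[where P="\<lambda>n. i \<prec> n \<longrightarrow> cnt w n \<prec> cnt w' n"])
      have "Dec (\<lambda>e. cnt w (e 0) \<prec> cnt w' (e 0))"
        using Dec_instantiate[OF Dec_less[OF cnt[of 1 0] cnt[of 2 0]], of 1 "case_nat w (case_nat w (\<lambda>_. w'))"]
        by (simp add: eval_nat_numeral)
      then show "Dec (\<lambda>e. i \<prec> e 0 \<longrightarrow> cnt w (e 0) \<prec> cnt w' (e 0))"
        by (rule Dec_imp[OF Dec_less[OF Fun_const Fun_var]])
      show "i \<prec> \<^bold>0 \<longrightarrow> cnt w \<^bold>0 \<prec> cnt w' \<^bold>0" by (simp add: not_less_zero)
      fix n assume IH: "i \<prec> n \<longrightarrow> cnt w n \<prec> cnt w' n"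
      have 1: "\<exists>x. x \<prec> w' \<and> A x n" if "\<exists>x. x \<prec> w \<and> A x n" using that \<open>w \<preceq> w'\<close> by (blast intro: N.less_le_trans)
      show "i \<prec> n \<boxplus> \<^bold>1 \<longrightarrow> cnt w (n \<boxplus> \<^bold>1) \<prec> cnt w' (n \<boxplus> \<^bold>1)"
      proof
        assume "i \<prec> n \<boxplus> \<^bold>1"
        then consider "i \<prec> n" | "i = n" unfolding less_suc by blast
        then show "cnt w (n \<boxplus> \<^bold>1) \<prec> cnt w' (n \<boxplus> \<^bold>1)"
        proof cases
          case 1
          then show ?thesis using IH \<open>(\<exists>x. x \<prec> w \<and> A x n) \<Longrightarrow> _\<close>
            unfolding cntS H_def by (auto intro: N.add_strict_right_mono N.less_le_trans[OF _ nle_add_right])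
        next
          case 2
          then have "\<not> (\<exists>x. x \<prec> w \<and> A x n)" "\<exists>x. x \<prec> w' \<and> A x n" using that by blast+
          then show ?thesis using mono[OF that(1), of n] by (simp only: cntS H_def if_True if_False less_suc_iff)
        qed
      qed
    qed
    then show ?thesis using that by blast
  qed
  have bound: "cnt w n \<preceq> n" for w n
  proof (rule dec_induct[where P="\<lambda>n. cnt w n \<preceq> n"])
    show "Dec (\<lambda>e. cnt w (e 0) \<preceq> e 0)"
      using Dec_instantiate[OF Dec_nle[OF cnt[of 1 0] Fun_var[of 0]], of 1 "\<lambda>_. w"] by simp
    show "cnt w \<^bold>0 \<preceq> \<^bold>0" by (simp add: cnt0)
    show "cnt w (n \<boxplus> \<^bold>1) \<preceq> n \<boxplus> \<^bold>1" if "cnt w n \<preceq> n" for n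
      using that unfolding cntS H_def by (auto intro: N.add_right_mono N.order_trans[OF _ nle_add_right])
  qed
  \<comment> \<open>Without a largest count, Sigma_1 induction on j would produce counts of at least
    j for every j, including k + 1.\<close>
  have "\<exists>w. \<forall>w'. cnt w' k \<preceq> cnt w k"
  proof (rule ccontr)
    assume no: "\<not> (\<exists>w. \<forall>w'. cnt w' k \<preceq> cnt w k)"
    have "\<exists>w. k \<boxplus> \<^bold>1 \<preceq> cnt w k"
    proof (rule sigma_induct[where A="\<lambda>w j. j \<preceq> cnt w k"])
      show "Dec (\<lambda>e. e 1 \<preceq> cnt (e 0) k)"
        using Dec_instantiate[OF Dec_nle[OF Fun_var[of 1] cnt[of 0 2]], of 2 "\<lambda>_. k"] by simp
      show "\<exists>w. j \<boxplus> \<^bold>1 \<preceq> cnt w k" if "\<exists>w. j \<preceq> cnt w k" for j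
        using that no unfolding suc_nle_iff by (metis N.le_less_trans N.not_le)
    qed simp
    then show False using bound by (metis suc_nle_iff N.not_le)
  qed
  then obtain w where w: "\<And>w'. cnt w' k \<preceq> cnt w k" by blast
  have "(\<exists>x. A x i) \<longleftrightarrow> (\<exists>x. x \<prec> w \<and> A x i)" if "i \<prec> k" for i
  proof
    assume "\<exists>x. A x i"
    then obtain x where x: "A x i" by blast
    show "\<exists>x. x \<prec> w \<and> A x i"
    proof (rule ccontr)
      assume no: "\<not> (\<exists>x. x \<prec> w \<and> A x i)"
      have "w \<preceq> w \<boxplus> (x \<boxplus> \<^bold>1)" by (rule nle_add_right)
      moreover have "x \<prec> w \<boxplus> (x \<boxplus> \<^bold>1)" using nle_add_left by (simp add: suc_nle_iff[symmetric])
      ultimately have "cnt w k \<prec> cnt (w \<boxplus> (x \<boxplus> \<^bold>1)) k"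
        using strict[OF _ no _ that] x by blast
      then show False using w by (metis N.not_le)
    qed
  qed blast
  then have "{i. i \<prec> k \<and> (\<exists>x. A x i)} = {i \<in> {i. i \<prec> k}. \<exists>x. x \<prec> w \<and> A x i}" by blast
  moreover have "Ff (\<lambda>e. {i \<in> {i. i \<prec> k}. \<exists>x. x \<prec> w \<and> A x i})"
    by (intro Ff_intros dec_intros A')
  ultimately show ?thesis using Ff_Fin by simp
qed

section \<open>Weak Koenig's lemma as compactness\<close>

lemma finite_bounded: "finite S \<Longrightarrow> \<exists>l. \<forall>x\<in>S. x \<prec> l"
proof (induction S rule: finite_induct)
  case (insert a S)
  then obtain l where l: "\<And>x. x \<in> S \<Longrightarrow> x \<prec> l" by blast
  have "x \<prec> a \<boxplus> \<^bold>1 \<boxplus> l" if "x \<in> insert a S" for x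
  proof (cases "x = a")
    case True
    have "a \<prec> a \<boxplus> \<^bold>1" by (simp add: less_suc)
    then show ?thesis using True by (blast intro: N.less_le_trans nle_add_right)
  next
    case False
    then show ?thesis using that l by (blast intro: N.less_le_trans nle_add_left)
  qed
  then show ?case by blast
qed simp

lemma is_fun_app:
  assumes "is_fun M F X Y" "x \<in> X"
  shows "app M F x \<in> Y" "pr x y \<in> F \<longleftrightarrow> y = app M F x"
proof -
  have ex: "\<exists>!y. pr x y \<in> F" using assms unfolding is_fun_def by blast
  then have *: "pr x (app M F x) \<in> F" unfolding app_def by (rule theI')
  then have "pr x (app M F x) \<in> nprod M X Y" using assms unfolding is_fun_def by blast
  then show "app M F x \<in> Y" unfolding nprod_def by auto
  show "pr x y \<in> F \<longleftrightarrow> y = app M F x" using ex * by blast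
qed

lemma is_fun_graph:
  assumes "\<And>x. x \<in> X \<Longrightarrow> f x \<in> Y"
  shows "is_fun M {pr x (f x) |x. x \<in> X} X Y"
    and "x \<in> X \<Longrightarrow> app M {pr x (f x) |x. x \<in> X} x = f x"
proof -
  show f: "is_fun M {pr x (f x) |x. x \<in> X} X Y"
    unfolding is_fun_def nprod_def using assms by auto
  show "app M {pr x (f x) |x. x \<in> X} x = f x" if "x \<in> X"
    using is_fun_app(2)[OF f that, of "f x"] that by auto
qed

section \<open>Binary sequences as initial segments of sets\<close>

abbreviation bits :: "'a \<Rightarrow> 'a set" where "bits c \<equiv> {i \<in> {i. i \<prec> c}. pr i \<^bold>1 \<in> els c}"

lemma mem_bits: "i \<in> bits c \<longleftrightarrow> pr i \<^bold>1 \<in> els c"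
  using pr_mem_els_bounds(1) by blast

lemma Ff_bits: "Fun t \<Longrightarrow> Ff (\<lambda>e. bits (t e))"
proof -
  assume t: "Fun t"
  have "Dec (\<lambda>e. pr (e 0) \<^bold>1 \<in> els (t (\<lambda>i. e (Suc i))))"
    by (intro Dec_mem_els Fun_pr Fun_var Fun_const Fun_rename[OF t])
  then show ?thesis by (intro Ff_Collect Ff_lessThan t)
qed

lemma binary_seq_iff:
  "binary_seq M c l \<longleftrightarrow> finite_set_code M c \<and>
     (\<forall>z\<in>els c. \<exists>i. i \<prec> l \<and> (z = pr i \<^bold>0 \<or> z = pr i \<^bold>1)) \<and>
     (\<forall>i. i \<prec> l \<longrightarrow> (pr i \<^bold>0 \<in> els c \<longleftrightarrow> pr i \<^bold>1 \<notin> els c))"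
  (is "_ \<longleftrightarrow> ?R")
proof
  assume b: "binary_seq M c l"
  then have sub: "els c \<subseteq> nprod M {i. i \<prec> l} {\<^bold>0, \<^bold>1}"
    and ex: "\<And>i. i \<prec> l \<Longrightarrow> \<exists>!y. pr i y \<in> els c" unfolding binary_seq_def is_fun_def by auto
  have "y = \<^bold>0 \<or> y = \<^bold>1" if "pr i y \<in> els c" for i y using sub that unfolding nprod_def by auto
  then have "pr i \<^bold>0 \<in> els c \<longleftrightarrow> pr i \<^bold>1 \<notin> els c" if "i \<prec> l" for i
    using ex[OF that] N.zero_neq_one by metis
  moreover have "\<forall>z\<in>els c. \<exists>i. i \<prec> l \<and> (z = pr i \<^bold>0 \<or> z = pr i \<^bold>1)"
    using sub unfolding nprod_def by auto
  ultimately show ?R using b unfolding binary_seq_def by blast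
next
  assume r: ?R
  have "els c \<subseteq> nprod M {i. i \<prec> l} {\<^bold>0, \<^bold>1}" unfolding nprod_def using r by fast
  moreover have "\<exists>!y. pr i y \<in> els c" if "i \<prec> l" for i
  proof -
    have "y = \<^bold>0 \<or> y = \<^bold>1" if "pr i y \<in> els c" for y using r that by fastforce
    then show ?thesis using r \<open>i \<prec> l\<close> by metis
  qed
  ultimately show "binary_seq M c l" using r unfolding binary_seq_def is_fun_def by blast
qed

lemma Dec_binary_seq: "Fun s \<Longrightarrow> Fun t \<Longrightarrow> Dec (\<lambda>e. binary_seq M (s e) (t e))"
  by (rule Dec_comp2) (unfold binary_seq_iff, intro dec_intros Ff_intros)

definition bseq :: "'a set \<Rightarrow> 'a \<Rightarrow> 'a" where
  "bseq X l = code {z. \<exists>i. i \<prec> l \<and> (z = pr i \<^bold>0 \<and> i \<notin> X \<or> z = pr i \<^bold>1 \<and> i \<in> X)}"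

lemma els_bseq:
  assumes "X \<in> sets_of M"
  shows "els (bseq X l) = {z. \<exists>i. i \<prec> l \<and> (z = pr i \<^bold>0 \<and> i \<notin> X \<or> z = pr i \<^bold>1 \<and> i \<in> X)}"
    and "finite_set_code M (bseq X l)"
proof -
  have "z \<prec> pr l \<^bold>1 \<boxplus> \<^bold>1" if "\<exists>i. i \<prec> l \<and> (z = pr i \<^bold>0 \<and> i \<notin> X \<or> z = pr i \<^bold>1 \<and> i \<in> X)" for z
    using that unfolding less_suc_iff nle_def[of _ l] by (auto intro: pr_mono simp: nle_def[of _ l])
  then have "Ff (\<lambda>e::nat \<Rightarrow> 'a. {z. \<exists>i. i \<prec> l \<and> (z = pr i \<^bold>0 \<and> i \<notin> X \<or> z = pr i \<^bold>1 \<and> i \<in> X)})"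
    by (intro Ff_I[of "\<lambda>_. pr l \<^bold>1 \<boxplus> \<^bold>1"] dec_intros)
      (auto intro!: Dec_mem assms dec_intros simp only: mem_Collect_eq)
  from Ff_Fin[OF this] show
    "els (bseq X l) = {z. \<exists>i. i \<prec> l \<and> (z = pr i \<^bold>0 \<and> i \<notin> X \<or> z = pr i \<^bold>1 \<and> i \<in> X)}"
    "finite_set_code M (bseq X l)"
    unfolding bseq_def by (rule Fin_code)+
qed

lemma pr_mem_bseq:
  assumes "X \<in> sets_of M"
  shows "pr i \<^bold>0 \<in> els (bseq X l) \<longleftrightarrow> i \<prec> l \<and> i \<notin> X" "pr i \<^bold>1 \<in> els (bseq X l) \<longleftrightarrow> i \<prec> l \<and> i \<in> X"
  unfolding els_bseq[OF assms] by auto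

lemma binary_seq_bseq: "X \<in> sets_of M \<Longrightarrow> binary_seq M (bseq X l) l"
  unfolding binary_seq_iff by (auto simp: pr_mem_bseq els_bseq)

lemma bits_bseq: "X \<in> sets_of M \<Longrightarrow> bits (bseq X l) = {i \<in> X. i \<prec> l}"
  using mem_bits[of _ "bseq X l"] pr_mem_bseq by blast

lemma binary_seq_bseq_bits:
  assumes "binary_seq M c l" shows "c = bseq (bits c) l"
proof -
  have b: "bits c \<in> sets_of M" using Ff_Fin[OF Ff_bits[OF Fun_const]] unfolding Fin_def by blast
  have "els c = els (bseq (bits c) l)"
  proof (rule Set.set_eqI)
    fix z
    have val: "pr i \<^bold>0 \<in> els c \<longleftrightarrow> pr i \<^bold>1 \<notin> els c" if "i \<prec> l" for i
      using assms that unfolding binary_seq_iff by blast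
    have "z \<in> els c \<Longrightarrow> \<exists>i. i \<prec> l \<and> (z = pr i \<^bold>0 \<or> z = pr i \<^bold>1)"
      using assms unfolding binary_seq_iff by blast
    then have "z \<in> els c \<longleftrightarrow> (\<exists>i. i \<prec> l \<and>
        (z = pr i \<^bold>0 \<and> pr i \<^bold>1 \<notin> els c \<or> z = pr i \<^bold>1 \<and> pr i \<^bold>1 \<in> els c))"
      using val by blast
    then show "z \<in> els c \<longleftrightarrow> z \<in> els (bseq (bits c) l)"
      by (simp only: els_bseq(1)[OF b] mem_Collect_eq[of z] mem_bits)
  qed
  then show ?thesis using finite_set_code_inject els_bseq(2)[OF b] assms unfolding binary_seq_iff by blast
qed

text \<open>Keeps the search for the length of a sequence bounded by its code, and shows that long
  sequences have large codes.\<close>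

lemma binary_seq_length_le: assumes "binary_seq M c l" shows "l \<preceq> c"
proof (cases "l = \<^bold>0")
  case False
  then obtain k where k: "l = k \<boxplus> \<^bold>1" using zero_or_suc by blast
  then have "k \<prec> l" by (simp add: less_suc)
  then have "pr k \<^bold>0 \<in> els c \<or> pr k \<^bold>1 \<in> els c" using assms unfolding binary_seq_iff by blast
  then show ?thesis unfolding k suc_nle_iff using pr_mem_els_bounds(1) by blast
qed simp

lemma binary_seq_length_mono:
  assumes "binary_seq M t l'" "binary_seq M s l" "els t \<subseteq> els s"
  shows "l' \<preceq> l" "bits t = {i \<in> bits s. i \<prec> l'}"
proof -
  have idx: "i \<prec> l" if "pr i y \<in> els s" for i y using that assms(2) unfolding binary_seq_iff by fastforce
  have val: "pr i \<^bold>0 \<in> els t \<or> pr i \<^bold>1 \<in> els t" if "i \<prec> l'" for i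
    using that assms(1) unfolding binary_seq_iff by blast
  show "l' \<preceq> l" using idx val assms(3) N.not_le N.less_irrefl by (metis subsetD)
  have "pr i \<^bold>1 \<in> els t \<longleftrightarrow> pr i \<^bold>1 \<in> els s \<and> i \<prec> l'" for i
  proof
    assume t: "pr i \<^bold>1 \<in> els t"
    then have "i \<prec> l'" using assms(1) unfolding binary_seq_iff by fastforce
    then show "pr i \<^bold>1 \<in> els s \<and> i \<prec> l'" using t assms(3) by blast
  next
    assume s: "pr i \<^bold>1 \<in> els s \<and> i \<prec> l'"
    then have "pr i \<^bold>0 \<notin> els s" using assms(2) idx unfolding binary_seq_iff by blast
    then show "pr i \<^bold>1 \<in> els t" using val s assms(3) by blast
  qed
  then show "bits t = {i \<in> bits s. i \<prec> l'}" using mem_bits by blast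
qed

text \<open>The sequences whose bits satisfy \<open>Q\<close> at their own length form a tree:
  \<open>mono\<close> gives closure under initial segments, and \<open>ex\<close> nodes of every
  length. A path is the characteristic function of the required set.\<close>

theorem compactness:
  assumes wkl: "weak_koenig_lemma M"
    and Q: "Dec (\<lambda>e. Q (e 0) (els (e 1)))"
    and ex: "\<And>l. \<exists>X. Fin X \<and> Q l {i \<in> X. i \<prec> l}"
    and mono: "\<And>l l' X. Q l X \<Longrightarrow> l' \<preceq> l \<Longrightarrow> Q l' {i \<in> X. i \<prec> l'}"
  shows "\<exists>X\<in>sets_of M. \<forall>l. Q l {i \<in> X. i \<prec> l}"
proof -
  have Q': "Dec (\<lambda>e. Q (s e) (S e))" if "Fun s" "Ff S" for s S
    using Dec_comp2[of "\<lambda>l c. Q l (els c)" s "\<lambda>e. code (S e)"] Q that Fun_code[OF that(2)]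
      Fin_code(2)[OF Ff_Fin[OF that(2)]] by simp
  let ?T = "{c. \<exists>l. l \<preceq> c \<and> binary_seq M c l \<and> Q l (bits c)}"
  have T: "?T \<in> sets_of M"
    by (intro dec_comprehension dec_intros Dec_binary_seq Q' Ff_bits)
  have tree: "binary_tree M ?T"
    unfolding binary_tree_def
  proof (intro conjI ballI allI impI)
    fix s assume "s \<in> ?T" then show "\<exists>l. binary_seq M s l" by blast
  next
    fix s t assume s: "s \<in> ?T" and t: "(\<exists>l. binary_seq M t l) \<and> els t \<subseteq> els s"
    obtain l where l: "binary_seq M s l" "Q l (bits s)" using s by blast
    obtain l' where l': "binary_seq M t l'" using t by blast
    have "Q l' (bits t)"
      using mono[OF l(2) binary_seq_length_mono(1)[OF l' l(1) conjunct2[OF t]]]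
      by (simp only: binary_seq_length_mono(2)[OF l' l(1) conjunct2[OF t]])
    then show "t \<in> ?T" using l' binary_seq_length_le by blast
  qed
  have unb: "unbounded M ?T"
    unfolding unbounded_def
  proof
    fix k
    obtain X where X: "Fin X" "Q k {i \<in> X. i \<prec> k}" using ex by blast
    then have X': "X \<in> sets_of M" unfolding Fin_def by blast
    have "Q k (bits (bseq X k))" using X bits_bseq[OF X'] by simp
    moreover have "k \<preceq> bseq X k" using binary_seq_length_le[OF binary_seq_bseq[OF X']] .
    ultimately have "bseq X k \<in> ?T" "\<not> bseq X k \<prec> k"
      using binary_seq_bseq[OF X'] by (blast, metis N.not_le)
    then show "\<exists>i\<in>?T. \<not> i \<prec> k" by blast
  qed
  obtain F where F: "F \<in> sets_of M" "path_through M ?T F"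
    using wkl T tree unb unfolding weak_koenig_lemma_def by blast
  then have f: "is_fun M F UNIV {\<^bold>0, \<^bold>1}" unfolding path_through_def by blast
  let ?X = "{n. pr n \<^bold>1 \<in> F}"
  have "?X \<in> sets_of M" by (intro dec_comprehension Dec_mem F(1) dec_intros)
  moreover have "Q l {i \<in> ?X. i \<prec> l}" for l
  proof -
    obtain s where s: "s \<in> ?T" "binary_seq M s l" "els s = {pr i (app M F i) | i. i \<prec> l}"
      using F(2) unfolding path_through_def by blast
    obtain l2 where l2: "binary_seq M s l2" "Q l2 (bits s)" using s(1) by blast
    \<comment> \<open>A sequence determines its length, so the length recorded in the tree is the
      one given by the path.\<close>
    have "l2 = l" using binary_seq_length_mono(1) l2(1) s(2) by (metis nle_antisym subset_refl)
    moreover have "bits s = {i \<in> ?X. i \<prec> l}"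
      using mem_bits[of _ s] unfolding s(3) using is_fun_app(2)[OF f UNIV_I] by auto
    ultimately show ?thesis using l2(2) by simp
  qed
  ultimately show ?thesis by blast
qed

end

section \<open>Rings in a model\<close>

locale model_ring = rca +
  fixes R :: "'a ring"
  assumes countable_ring: "R \<in> countable_rings M"
begin

lemma carrier_in_sets: "carrier R \<in> sets_of M"
  and is_cring: "cring R"
  using countable_ring unfolding countable_rings_def coded_ring_def by auto

sublocale cring R by (rule is_cring)

text \<open>\<open>app\<close> is a definite description and unspecified off the carrier. With a
  default value there, the operation is total and has a decidable graph, as internal recursion
  requires.\<close>

definition ad :: "'a \<Rightarrow> 'a \<Rightarrow> 'a" where
  "ad x y = (if x \<in> carrier R \<and> y \<in> carrier R then x \<oplus>\<^bsub>R\<^esub> y else \<^bold>0)"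

definition ml :: "'a \<Rightarrow> 'a \<Rightarrow> 'a" where
  "ml x y = (if x \<in> carrier R \<and> y \<in> carrier R then x \<otimes>\<^bsub>R\<^esub> y else \<^bold>0)"

lemma Fun_ad_ml_vars: "Fun (\<lambda>e. ad (e 0) (e 1))" "Fun (\<lambda>e. ml (e 0) (e 1))"
proof -
  obtain C P T z u where R: "R = coded_ring M C P T z u" and C: "C \<in> sets_of M" and P: "P \<in> sets_of M"
    and T: "T \<in> sets_of M"
    and f: "is_fun M P (nprod M C C) C" "is_fun M T (nprod M C C) C"
    using countable_ring unfolding countable_rings_def by blast
  have C': "carrier R = C" unfolding R coded_ring_def by simp
  have p: "pr x y \<in> nprod M C C \<longleftrightarrow> x \<in> C \<and> y \<in> C" for x y unfolding nprod_def by auto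
  have "w = ad x y \<longleftrightarrow> (if x \<in> C \<and> y \<in> C then pr (pr x y) w \<in> P else w = \<^bold>0)" for w x y
    unfolding ad_def C' using is_fun_app(2)[OF f(1), of "pr x y" w] p by (auto simp: R coded_ring_def)
  then show "Fun (\<lambda>e. ad (e 0) (e 1))"
    unfolding Fun_def by (simp only:) (intro dec_intros Dec_mem C P)
  have "w = ml x y \<longleftrightarrow> (if x \<in> C \<and> y \<in> C then pr (pr x y) w \<in> T else w = \<^bold>0)" for w x y
    unfolding ml_def C' using is_fun_app(2)[OF f(2), of "pr x y" w] p by (auto simp: R coded_ring_def)
  then show "Fun (\<lambda>e. ml (e 0) (e 1))"
    unfolding Fun_def by (simp only:) (intro dec_intros Dec_mem C T)
qed

lemma Fun_ad: "Fun s \<Longrightarrow> Fun t \<Longrightarrow> Fun (\<lambda>e. ad (s e) (t e))"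
  and Fun_ml: "Fun s \<Longrightarrow> Fun t \<Longrightarrow> Fun (\<lambda>e. ml (s e) (t e))"
  using Fun_comp2 Fun_ad_ml_vars by blast+

lemma Dec_carrier: "Fun t \<Longrightarrow> Dec (\<lambda>e. t e \<in> carrier R)"
  by (intro Dec_mem carrier_in_sets)

section \<open>Powers, radicals and primary ideals in the model\<close>

definition pw :: "'a \<Rightarrow> 'a \<Rightarrow> 'a" where
  "pw a n = nrec \<one>\<^bsub>R\<^esub> (\<lambda>i y. ml y a) n"

lemma Fun_pw: "Fun s \<Longrightarrow> Fun t \<Longrightarrow> Fun (\<lambda>e. pw (s e) (t e))"
proof -
  have "Fun (\<lambda>e. pw (e 0) (e 1))"
    unfolding pw_def
    by (rule Fun_nrec[where h="\<lambda>i y e. ml y (e 0)"]) (intro Fun_ml dec_intros)+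
  then show "Fun s \<Longrightarrow> Fun t \<Longrightarrow> Fun (\<lambda>e. pw (s e) (t e))" by (rule Fun_comp2)
qed

lemma pw_step: "Fun (\<lambda>e. ml (e 1) a)"
  by (intro Fun_ml dec_intros)

lemma pw_zero: "pw a \<^bold>0 = \<one>\<^bsub>R\<^esub>"
  unfolding pw_def by (rule nrec_zero[OF pw_step])

lemma pw_suc_ml: "pw a (n \<boxplus> \<^bold>1) = ml (pw a n) a"
  unfolding pw_def by (rule nrec_suc[OF pw_step])

lemma pw_closed [simp]: "a \<in> carrier R \<Longrightarrow> pw a n \<in> carrier R"
  by (rule dec_induct[where P="\<lambda>n. pw a n \<in> carrier R"])
    (intro Dec_carrier Fun_pw dec_intros, simp_all add: pw_zero pw_suc_ml ml_def)

lemma pw_suc: "a \<in> carrier R \<Longrightarrow> pw a (n \<boxplus> \<^bold>1) = pw a n \<otimes>\<^bsub>R\<^esub> a"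
  by (simp add: pw_suc_ml ml_def)

text \<open>A set of the model that obeys the recursion agrees with \<open>pw\<close> by induction,
  which is available because the set is a parameter. Conversely the graph of \<open>pw\<close> is
  itself a set of the model.\<close>

lemma is_power_iff:
  assumes a: "a \<in> carrier R"
  shows "is_power M R a n c \<longleftrightarrow> c = pw a n"
proof
  assume "is_power M R a n c"
  then obtain F where F: "F \<in> sets_of M" "is_fun M F UNIV (carrier R)" "app M F \<^bold>0 = \<one>\<^bsub>R\<^esub>"
    "\<And>i. app M F (i \<boxplus> \<^bold>1) = app M F i \<otimes>\<^bsub>R\<^esub> a" "app M F n = c" unfolding is_power_def by blast
  have "pr n (pw a n) \<in> F"
  proof (rule dec_induct[where P="\<lambda>n. pr n (pw a n) \<in> F"])
    show "Dec (\<lambda>e. pr (e 0) (pw a (e 0)) \<in> F)" by (intro Dec_mem F(1) Fun_pw dec_intros)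
  qed (simp_all add: is_fun_app(2)[OF F(2) UNIV_I] F(3,4) pw_zero pw_suc[OF a])
  then show "c = pw a n" using F(5) by (simp add: is_fun_app(2)[OF F(2) UNIV_I])
next
  assume c: "c = pw a n"
  let ?F = "{pr i (pw a i) |i. i \<in> UNIV}"
  have "z \<in> ?F \<longleftrightarrow> (\<exists>i. i \<preceq> z \<and> z = pr i (pw a i))" for z
    using pr_bounds(1) by blast
  then have "?F = {z. \<exists>i. i \<preceq> z \<and> z = pr i (pw a i)}" by blast
  also have "\<dots> \<in> sets_of M" by (intro dec_comprehension dec_intros Fun_pw)
  finally have F: "?F \<in> sets_of M" .
  have cl: "pw a i \<in> carrier R" if "i \<in> UNIV" for i using a by simp
  have f: "is_fun M ?F UNIV (carrier R)" by (rule is_fun_graph(1)) (rule cl)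
  have v: "app M ?F i = pw a i" for i by (rule is_fun_graph(2)[where Y="carrier R"]) (auto intro: cl)
  show "is_power M R a n c"
    unfolding is_power_def using F f by (intro bexI[of _ ?F] conjI allI) (simp_all only: v pw_zero pw_suc[OF a] c)
qed

lemma radical_iff:
  "radical M R I = {a \<in> carrier R. \<exists>n. n \<noteq> \<^bold>0 \<and> pw a n \<in> I}"
proof -
  have "\<^bold>0 \<prec> n \<longleftrightarrow> n \<noteq> \<^bold>0" for n using zero_nle[of n] N.less_irrefl nle_def by metis
  then show ?thesis unfolding radical_def using is_power_iff by auto
qed

lemma is_primary_iff:
  "is_primary M R I \<longleftrightarrow> (\<forall>a\<in>carrier R. \<forall>b\<in>carrier R. a \<otimes>\<^bsub>R\<^esub> b \<in> I \<longrightarrow> a \<in> I \<or> (\<exists>n. pw b n \<in> I))"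
  unfolding is_primary_def using is_power_iff by auto

lemma ideal_closed:
  assumes "is_ideal R I"
  shows "a \<in> I \<Longrightarrow> a \<in> carrier R"
    "a \<in> I \<Longrightarrow> r \<in> carrier R \<Longrightarrow> a \<otimes>\<^bsub>R\<^esub> r \<in> I"
    "a \<in> I \<Longrightarrow> b \<in> I \<Longrightarrow> a \<oplus>\<^bsub>R\<^esub> b \<in> I"
proof -
  show 1: "a \<in> I \<Longrightarrow> a \<in> carrier R" for a using assms unfolding is_ideal_def by blast
  show "a \<in> I \<Longrightarrow> b \<in> I \<Longrightarrow> a \<oplus>\<^bsub>R\<^esub> b \<in> I"
    using assms 1 one_closed r_one unfolding is_ideal_def by metis
  show "a \<in> I \<Longrightarrow> r \<in> carrier R \<Longrightarrow> a \<otimes>\<^bsub>R\<^esub> r \<in> I"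
    using assms 1 zero_closed r_null r_zero m_closed unfolding is_ideal_def by metis
qed

lemma ideal_eq_carrier: "is_ideal R I \<Longrightarrow> \<one>\<^bsub>R\<^esub> \<in> I \<Longrightarrow> I = carrier R"
  using ideal_closed l_one by (metis subsetI subset_antisym)

section \<open>Weak Koenig's lemma gives primary ideals\<close>

text \<open>The class \<open>U\<close> need not be a set, but its part below any \<open>l\<close> is
  one by bounded Sigma_1 comprehension, and it serves as the approximation that compactness asks for
  at \<open>l\<close>.\<close>

theorem sigma_ideal_extension:
  assumes wkl: "weak_koenig_lemma M"
    and V: "Dec (\<lambda>e. V (e 0) (e 1))"
    and U: "\<And>x. x \<in> U \<longleftrightarrow> (\<exists>w. V w x)" "is_ideal R U" "\<one>\<^bsub>R\<^esub> \<notin> U"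
  shows "\<exists>J\<in>sets_of M. is_ideal R J \<and> \<one>\<^bsub>R\<^esub> \<notin> J \<and> U \<subseteq> J"
proof -
  \<comment> \<open>Multipliers, witnesses and values are all confined below l: this makes the
    condition decidable and lets it survive restriction to smaller l. In the limit it says that the
    set is a proper ideal containing U.\<close>
  define Q where "Q l S \<longleftrightarrow>
    (\<forall>x\<in>S. x \<in> carrier R \<and> x \<noteq> \<one>\<^bsub>R\<^esub>) \<and>
    (\<forall>x. x \<prec> l \<longrightarrow> (\<forall>w. w \<prec> l \<longrightarrow> V w x \<longrightarrow> x \<in> S)) \<and>
    (\<forall>x\<in>S. \<forall>y\<in>S. \<forall>r. r \<prec> l \<longrightarrow> (\<forall>s. s \<prec> l \<longrightarrow> r \<in> carrier R \<longrightarrow> s \<in> carrier R \<longrightarrow>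
       ad (ml x r) (ml y s) \<prec> l \<longrightarrow> ad (ml x r) (ml y s) \<in> S))" for l S
  have V': "Dec (\<lambda>e. V (e p) (e q))" for p q
    using Dec_rename[OF V, of "case_nat p (\<lambda>_. q)"] by simp
  have op: "ad (ml x r) (ml y s) = x \<otimes>\<^bsub>R\<^esub> r \<oplus>\<^bsub>R\<^esub> y \<otimes>\<^bsub>R\<^esub> s"
    if "x \<in> carrier R" "y \<in> carrier R" "r \<in> carrier R" "s \<in> carrier R" for x y r s
    using that by (simp add: ad_def ml_def)
  have "\<exists>X\<in>sets_of M. \<forall>l. Q l {i \<in> X. i \<prec> l}"
  proof (rule compactness[OF wkl])
    show "Dec (\<lambda>e. Q (e 0) (els (e 1)))"
      unfolding Q_def by (intro dec_intros Ff_intros Dec_carrier Fun_ad Fun_ml V')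
    show "\<exists>X. Fin X \<and> Q l {i \<in> X. i \<prec> l}" for l
    proof (intro exI conjI)
      show "Fin {x. x \<prec> l \<and> (\<exists>w. V w x)}" by (rule bounded_sigma_comprehension[OF V])
      have "{i \<in> {x. x \<prec> l \<and> (\<exists>w. V w x)}. i \<prec> l} = {x \<in> U. x \<prec> l}" using U(1) by blast
      moreover have "x \<in> carrier R" if "x \<in> U" for x using that ideal_closed(1)[OF U(2)] by blast
      moreover have "ad (ml x r) (ml y s) \<in> U"
        if "x \<in> U" "y \<in> U" "r \<in> carrier R" "s \<in> carrier R" for x y r s
        using op that ideal_closed[OF U(2)] by metis
      ultimately show "Q l {i \<in> {x. x \<prec> l \<and> (\<exists>w. V w x)}. i \<prec> l}"
        unfolding Q_def using U(1,3) by auto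
    qed
    show "Q l' {i \<in> X. i \<prec> l'}" if q: "Q l X" and l: "l' \<preceq> l" for l l' X
    proof -
      have up: "x \<prec> l" if "x \<prec> l'" for x using that l by (rule N.less_le_trans)
      show ?thesis
        unfolding Q_def mem_Collect_eq
      proof (intro conjI ballI allI impI; (elim CollectE conjE)?)
        show "x \<in> carrier R" "x \<noteq> \<one>\<^bsub>R\<^esub>" if "x \<in> X" for x using q that unfolding Q_def by blast+
        show "x \<in> X" if "x \<prec> l'" "w \<prec> l'" "V w x" for x w
          using q[unfolded Q_def, THEN conjunct2, THEN conjunct1, rule_format, OF up up] that by simp
        show "ad (ml x r) (ml y s) \<in> X" if "x \<in> X" "y \<in> X" "r \<prec> l'" "s \<prec> l'" "r \<in> carrier R"
          "s \<in> carrier R" "ad (ml x r) (ml y s) \<prec> l'" for x y r s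
          using q[unfolded Q_def, THEN conjunct2, THEN conjunct2, rule_format, OF _ _ up up _ _ up] that by simp
      qed
    qed
  qed
  then obtain J where J: "J \<in> sets_of M" "\<And>l. Q l {i \<in> J. i \<prec> l}" by blast
  have J1: "x \<in> carrier R" "x \<noteq> \<one>\<^bsub>R\<^esub>" if "x \<in> J" for x
    using J(2)[of "x \<boxplus> \<^bold>1"] that unfolding Q_def by (simp_all add: less_suc)
  have "U \<subseteq> J"
  proof
    fix x assume "x \<in> U"
    then obtain w where w: "V w x" using U(1) by blast
    obtain l where "x \<prec> l" "w \<prec> l" using finite_bounded[of "{x, w}"] by auto
    then show "x \<in> J" using J(2)[of l] w unfolding Q_def by blast
  qed
  moreover have "x \<otimes>\<^bsub>R\<^esub> r \<oplus>\<^bsub>R\<^esub> y \<otimes>\<^bsub>R\<^esub> s \<in> J"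
    if "x \<in> J" "y \<in> J" "r \<in> carrier R" "s \<in> carrier R" for x y r s
  proof -
    obtain l where "x \<prec> l" "y \<prec> l" "r \<prec> l" "s \<prec> l" "ad (ml x r) (ml y s) \<prec> l"
      using finite_bounded[of "{x, y, r, s, ad (ml x r) (ml y s)}"] by auto
    then have "ad (ml x r) (ml y s) \<in> J" using J(2)[of l] that unfolding Q_def by blast
    then show ?thesis using op that J1 by metis
  qed
  then have "is_ideal R J" unfolding is_ideal_def using J1(1) by (simp add: subset_eq)
  ultimately show ?thesis using J(1) J1(2) by (intro bexI[of _ J]) auto
qed

theorem wkl_primary:
  assumes wkl: "weak_koenig_lemma M" and I: "I \<in> sets_of M" "is_ideal R I"
    and max: "is_maximal_ideal M R (radical M R I)"
  shows "is_primary M R I"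
  unfolding is_primary_iff
proof (intro ballI impI, rule ccontr)
  fix a b
  assume a: "a \<in> carrier R" and b: "b \<in> carrier R" and ab: "a \<otimes>\<^bsub>R\<^esub> b \<in> I"
    and no: "\<not> (a \<in> I \<or> (\<exists>n. pw b n \<in> I))"
  let ?K = "radical M R I"
  have K: "is_ideal R ?K" using max unfolding is_maximal_ideal_def by blast
  have Kiff: "y \<in> ?K \<longleftrightarrow> y \<in> carrier R \<and> (\<exists>n. n \<noteq> \<^bold>0 \<and> pw y n \<in> I)" for y
    unfolding radical_iff by blast
  \<comment> \<open>A member y + b r of the sum needs the witnesses y, r and an exponent n. A common
    bound w for all three gives the one existential quantifier of a Sigma_1 class.\<close>
  define W where "W y r n x \<longleftrightarrow> y \<in> carrier R \<and> r \<in> carrier R \<and> n \<noteq> \<^bold>0 \<and> pw y n \<in> I \<and> x = ad y (ml b r)"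
    for y r n x
  define V where "V w x \<longleftrightarrow> (\<exists>y. y \<preceq> w \<and> (\<exists>r. r \<preceq> w \<and> (\<exists>n. n \<preceq> w \<and> W y r n x)))" for w x
  define U where "U = {x. \<exists>w. V w x}"
  have V: "Dec (\<lambda>e. V (e 0) (e 1))"
    unfolding V_def W_def by (intro dec_intros Dec_carrier Dec_mem I Fun_ad Fun_ml Fun_pw)
  have U: "x \<in> U \<longleftrightarrow> (\<exists>y\<in>?K. \<exists>r\<in>carrier R. x = y \<oplus>\<^bsub>R\<^esub> b \<otimes>\<^bsub>R\<^esub> r)" for x
  proof -
    have 1: "(\<exists>w. V w x) \<longleftrightarrow> (\<exists>y r n. W y r n x)"
    proof
      assume "\<exists>y r n. W y r n x"
      then obtain y r n where "W y r n x" by blast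
      moreover obtain w where "y \<preceq> w" "r \<preceq> w" "n \<preceq> w"
        using finite_bounded[of "{y, r, n}"] by (auto simp: nle_def)
      ultimately show "\<exists>w. V w x" unfolding V_def by blast
    qed (auto simp: V_def)
    have 2: "W y r n x \<longleftrightarrow> y \<in> carrier R \<and> r \<in> carrier R \<and> n \<noteq> \<^bold>0 \<and> pw y n \<in> I \<and>
        x = y \<oplus>\<^bsub>R\<^esub> b \<otimes>\<^bsub>R\<^esub> r" for y r n
      unfolding W_def using b by (auto simp: ad_def ml_def)
    show ?thesis unfolding U_def mem_Collect_eq Bex_def Kiff 1 2 by blast
  qed
  have "\<zero>\<^bsub>R\<^esub> \<in> I" using ideal_closed(2)[OF I(2) ab zero_closed] a b by simp
  then have K0: "\<zero>\<^bsub>R\<^esub> \<in> ?K"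
    unfolding Kiff using pw_suc[of "\<zero>\<^bsub>R\<^esub>" "\<^bold>0"] by (intro conjI exI[of _ "\<^bold>1"]) (simp_all add: pw_zero)
  have ideal: "is_ideal R U"
    unfolding is_ideal_def
  proof (intro conjI subsetI ballI)
    fix x assume "x \<in> U"
    then show "x \<in> carrier R" unfolding U using b ideal_closed(1)[OF K] by auto
  next
    fix x1 x2 r s assume x: "x1 \<in> U" "x2 \<in> U" and r: "r \<in> carrier R" and s: "s \<in> carrier R"
    obtain y1 r1 where 1: "y1 \<in> ?K" "r1 \<in> carrier R" "x1 = y1 \<oplus>\<^bsub>R\<^esub> b \<otimes>\<^bsub>R\<^esub> r1" using x U by blast
    obtain y2 r2 where 2: "y2 \<in> ?K" "r2 \<in> carrier R" "x2 = y2 \<oplus>\<^bsub>R\<^esub> b \<otimes>\<^bsub>R\<^esub> r2" using x U by blast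
    have c: "y1 \<in> carrier R" "y2 \<in> carrier R" using 1 2 ideal_closed(1)[OF K] by blast+
    have "x1 \<otimes>\<^bsub>R\<^esub> r \<oplus>\<^bsub>R\<^esub> x2 \<otimes>\<^bsub>R\<^esub> s =
        (y1 \<otimes>\<^bsub>R\<^esub> r \<oplus>\<^bsub>R\<^esub> y2 \<otimes>\<^bsub>R\<^esub> s) \<oplus>\<^bsub>R\<^esub> b \<otimes>\<^bsub>R\<^esub> (r1 \<otimes>\<^bsub>R\<^esub> r \<oplus>\<^bsub>R\<^esub> r2 \<otimes>\<^bsub>R\<^esub> s)"
      using 1 2 c b r s by (simp add: l_distr r_distr a_ac m_ac)
    moreover have "y1 \<otimes>\<^bsub>R\<^esub> r \<oplus>\<^bsub>R\<^esub> y2 \<otimes>\<^bsub>R\<^esub> s \<in> ?K" using K 1 2 r s unfolding is_ideal_def by blast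
    moreover have "r1 \<otimes>\<^bsub>R\<^esub> r \<oplus>\<^bsub>R\<^esub> r2 \<otimes>\<^bsub>R\<^esub> s \<in> carrier R" using 1 2 r s by simp
    ultimately show "x1 \<otimes>\<^bsub>R\<^esub> r \<oplus>\<^bsub>R\<^esub> x2 \<otimes>\<^bsub>R\<^esub> s \<in> U" unfolding U by blast
  qed
  have "\<one>\<^bsub>R\<^esub> \<notin> U"
  proof
    assume "\<one>\<^bsub>R\<^esub> \<in> U"
    then obtain y r where "y \<in> ?K" and r: "r \<in> carrier R"
      and one: "\<one>\<^bsub>R\<^esub> = y \<oplus>\<^bsub>R\<^esub> b \<otimes>\<^bsub>R\<^esub> r" unfolding U by blast
    then obtain n where y: "y \<in> carrier R" "pw y n \<in> I" unfolding Kiff by blast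
    \<comment> \<open>Here t stands for a - a y^i, which makes the claim Sigma_1 without
      subtraction. Since a = a y + (a b) r, the next t is t y + (a b) r. At i = n the power of y
      lies in I, and then so does a.\<close>
    have "\<exists>t. t \<in> I \<and> a = ad t (ml a (pw y n))"
    proof (rule sigma_induct[where A="\<lambda>t i. t \<in> I \<and> a = ad t (ml a (pw y i))"])
      show "Dec (\<lambda>e. e 0 \<in> I \<and> a = ad (e 0) (ml a (pw y (e 1))))"
        by (intro dec_intros Dec_mem I Fun_ad Fun_ml Fun_pw)
      show "\<exists>t. t \<in> I \<and> a = ad t (ml a (pw y \<^bold>0))"
        using \<open>\<zero>\<^bsub>R\<^esub> \<in> I\<close> a by (intro exI[of _ "\<zero>\<^bsub>R\<^esub>"]) (simp add: pw_zero ad_def ml_def)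
    next
      fix i assume "\<exists>t. t \<in> I \<and> a = ad t (ml a (pw y i))"
      then obtain t where t: "t \<in> I" "a = ad t (ml a (pw y i))" by blast
      have tc: "t \<in> carrier R" using ideal_closed(1)[OF I(2) t(1)] .
      have at: "a = t \<oplus>\<^bsub>R\<^esub> a \<otimes>\<^bsub>R\<^esub> pw y i" using t(2) tc a y(1) by (simp add: ad_def ml_def)
      let ?t = "t \<otimes>\<^bsub>R\<^esub> y \<oplus>\<^bsub>R\<^esub> (a \<otimes>\<^bsub>R\<^esub> b) \<otimes>\<^bsub>R\<^esub> r"
      have tI: "?t \<in> I" using t(1) ab y(1) r I(2) unfolding is_ideal_def by blast
      have "a = a \<otimes>\<^bsub>R\<^esub> (y \<oplus>\<^bsub>R\<^esub> b \<otimes>\<^bsub>R\<^esub> r)" by (simp only: one[symmetric] r_one[OF a])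
      also have "\<dots> = a \<otimes>\<^bsub>R\<^esub> y \<oplus>\<^bsub>R\<^esub> (a \<otimes>\<^bsub>R\<^esub> b) \<otimes>\<^bsub>R\<^esub> r"
        using a b y(1) r by (simp add: r_distr m_assoc)
      also have "a \<otimes>\<^bsub>R\<^esub> y = (t \<oplus>\<^bsub>R\<^esub> a \<otimes>\<^bsub>R\<^esub> pw y i) \<otimes>\<^bsub>R\<^esub> y" using at by simp
      also have "\<dots> \<oplus>\<^bsub>R\<^esub> (a \<otimes>\<^bsub>R\<^esub> b) \<otimes>\<^bsub>R\<^esub> r = ?t \<oplus>\<^bsub>R\<^esub> a \<otimes>\<^bsub>R\<^esub> pw y (i \<boxplus> \<^bold>1)"
        using a b y(1) r tc by (simp add: l_distr a_ac m_assoc pw_suc)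
      finally have "a = ad ?t (ml a (pw y (i \<boxplus> \<^bold>1)))"
        using ideal_closed(1)[OF I(2) tI] a y(1) by (simp add: ad_def ml_def)
      then show "\<exists>t. t \<in> I \<and> a = ad t (ml a (pw y (i \<boxplus> \<^bold>1)))" using tI by blast
    qed
    then obtain t where t: "t \<in> I" "a = ad t (ml a (pw y n))" by blast
    have "a = t \<oplus>\<^bsub>R\<^esub> pw y n \<otimes>\<^bsub>R\<^esub> a"
      using t ideal_closed(1)[OF I(2) t(1)] a y(1) by (simp add: ad_def ml_def m_comm)
    moreover have "t \<oplus>\<^bsub>R\<^esub> pw y n \<otimes>\<^bsub>R\<^esub> a \<in> I"
      using ideal_closed[OF I(2)] t(1) y(2) a by blast
    ultimately show False using no by simp
  qed
  then obtain J where J: "J \<in> sets_of M" "is_ideal R J" "\<one>\<^bsub>R\<^esub> \<notin> J" "U \<subseteq> J"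
    using sigma_ideal_extension[OF wkl V _ ideal] unfolding U_def by blast
  have "?K \<subseteq> U"
  proof
    fix y assume y: "y \<in> ?K"
    then have "y = y \<oplus>\<^bsub>R\<^esub> b \<otimes>\<^bsub>R\<^esub> \<zero>\<^bsub>R\<^esub>" using b ideal_closed(1)[OF K] by simp
    then show "y \<in> U" unfolding U using y zero_closed by blast
  qed
  moreover have "b = \<zero>\<^bsub>R\<^esub> \<oplus>\<^bsub>R\<^esub> b \<otimes>\<^bsub>R\<^esub> \<one>\<^bsub>R\<^esub>" using b by simp
  then have "b \<in> U" unfolding U using K0 one_closed by blast
  moreover have "b \<notin> ?K" unfolding Kiff using no by blast
  ultimately have "?K \<subset> J" using J(4) by blast
  moreover have "J \<noteq> carrier R" using J(3) one_closed by blast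
  ultimately show False using max J(1,2) unfolding is_maximal_ideal_def by blast
qed

end

theorem (in rca) wkl_maximal_radical_implies_primary:
  "weak_koenig_lemma M \<Longrightarrow> maximal_radical_implies_primary M"
  unfolding maximal_radical_implies_primary_def
proof (intro ballI impI)
  fix R I assume a: "weak_koenig_lemma M" "R \<in> countable_rings M" "I \<in> sets_of M" "is_ideal R I"
    "is_maximal_ideal M R (radical M R I)"
  interpret model_ring M R by unfold_locales (rule a(2))
  show "is_primary M R I" using a by (intro wkl_primary)
qed

section \<open>Parity of finite sets\<close>

context rca
begin

text \<open>The bound is the sum of \<open>f i e\<close> + 1 over all i below \<open>t e\<close>,
  computed by recursion.\<close>

lemma Fun_bound:
  assumes f: "Fun (\<lambda>e. f (e 0) (\<lambda>i. e (Suc i)))" and t: "Fun t"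
  obtains b where "Fun b" "\<And>e i. i \<prec> t e \<Longrightarrow> f i e \<prec> b e"
proof
  let ?h = "\<lambda>i y e. y \<boxplus> (f i e \<boxplus> \<^bold>1)"
  have "Fun (\<lambda>e. f (e 0) (\<lambda>i. e (Suc (Suc i))))"
    using Fun_rename[OF f, of "case_nat 0 (\<lambda>i. i + 2)"] by simp
  then have h: "Fun (\<lambda>e. ?h (e 0) (e 1) (\<lambda>i. e (Suc (Suc i))))" by (intro dec_intros)
  then show "Fun (\<lambda>e. nrec \<^bold>0 (\<lambda>i y. ?h i y e) (t e))" by (rule Fun_nrec) (intro Fun_const t)+
  fix e i
  have h': "Fun (\<lambda>e'. ?h (e' 0) (e' 1) e)"
    using Fun_instantiate[OF h, of 2 "\<lambda>i. e (i - 2)"] by simp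
  have "i \<prec> n \<longrightarrow> f i e \<prec> nrec \<^bold>0 (\<lambda>i y. ?h i y e) n" for n
  proof (rule dec_induct[where P="\<lambda>n. i \<prec> n \<longrightarrow> f i e \<prec> nrec \<^bold>0 (\<lambda>i y. ?h i y e) n"])
    have "Fun (\<lambda>e'. nrec \<^bold>0 (\<lambda>i y. ?h i y e) (e' 0))"
      by (rule Fun_nrec[where h="\<lambda>i y _. ?h i y e"]) (intro h' Fun_const Fun_var)+
    then show "Dec (\<lambda>e'. i \<prec> e' 0 \<longrightarrow> f i e \<prec> nrec \<^bold>0 (\<lambda>i y. ?h i y e) (e' 0))"
      by (intro Dec_imp Dec_less Fun_const Fun_var)
    show "i \<prec> \<^bold>0 \<longrightarrow> f i e \<prec> nrec \<^bold>0 (\<lambda>i y. ?h i y e) \<^bold>0" by (simp add: not_less_zero)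
    show "i \<prec> n \<boxplus> \<^bold>1 \<longrightarrow> f i e \<prec> nrec \<^bold>0 (\<lambda>i y. ?h i y e) (n \<boxplus> \<^bold>1)"
      if IH: "i \<prec> n \<longrightarrow> f i e \<prec> nrec \<^bold>0 (\<lambda>i y. ?h i y e) n" for n
    proof
      assume "i \<prec> n \<boxplus> \<^bold>1"
      then consider "i = n" | "i \<prec> n" unfolding less_suc by blast
      then show "f i e \<prec> nrec \<^bold>0 (\<lambda>i y. ?h i y e) (n \<boxplus> \<^bold>1)"
      proof cases
        case 1
        have "f n e \<prec> f n e \<boxplus> \<^bold>1" by (simp add: less_suc)
        then show ?thesis unfolding nrec_suc[OF h'] 1 by (rule N.less_le_trans) (rule nle_add_left)
      next
        case 2
        then have "f i e \<prec> nrec \<^bold>0 (\<lambda>i y. ?h i y e) n" using IH by blast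
        then show ?thesis unfolding nrec_suc[OF h'] by (rule N.less_le_trans) (rule nle_add_right)
      qed
    qed
  qed
  then show "i \<prec> t e \<Longrightarrow> f i e \<prec> nrec \<^bold>0 (\<lambda>i y. ?h i y e) (t e)" by blast
qed

text \<open>Each member x brings its own bound for \<open>T x e\<close>; \<open>Fun_bound\<close>
  bounds these bounds uniformly.\<close>

lemma Ff_UN:
  assumes S: "Ff S" and T: "Ff (\<lambda>e. T (e 0) (\<lambda>i. e (Suc i)))"
  shows "Ff (\<lambda>e. \<Union>x\<in>S e. T x e)"
proof -
  obtain b where b: "Fun b" "\<And>e x. x \<in> S e \<Longrightarrow> x \<prec> b e" using S unfolding Ff_def by blast
  obtain c where c: "Fun c" "\<And>e y. y \<in> T (e 0) (\<lambda>i. e (Suc i)) \<Longrightarrow> y \<prec> c e" using T unfolding Ff_def by blast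
  have "Fun (\<lambda>e. c (case_nat (e 0) (\<lambda>i. e (Suc i))))"
    using Fun_rename[OF c(1), of "case_nat 0 Suc"] by (simp add: nat.case_distrib)
  then obtain d where d: "Fun d" "\<And>e i. i \<prec> b e \<Longrightarrow> c (case_nat i e) \<prec> d e"
    using Fun_bound[where f="\<lambda>i e. c (case_nat i e)", OF _ b(1)] by blast
  show ?thesis
  proof (rule Ff_I[OF d(1)])
    show "y \<prec> d e" if y: "y \<in> (\<Union>x\<in>S e. T x e)" for e y
    proof -
      obtain x where x: "x \<in> S e" "y \<in> T x e" using y by blast
      have "y \<prec> c (case_nat x e)" using c(2)[of y "case_nat x e"] x(2) by simp
      moreover have "c (case_nat x e) \<prec> d e" using d(2) b(2) x(1) by blast
      ultimately show ?thesis by (rule N.less_trans)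
    qed
    have "Ff (\<lambda>e. T (e 0) (\<lambda>i. e (Suc (Suc i))))"
      using Ff_rename[OF T, of "case_nat 0 (\<lambda>i. i + 2)"] by simp
    then show "Dec (\<lambda>e. e 0 \<in> (\<Union>x\<in>S (\<lambda>i. e (Suc i)). T x (\<lambda>i. e (Suc i))))"
      unfolding UN_iff by (intro Dec_bex_Ff Ff_rename[OF S] Dec_mem_Ff Fun_var)
  qed
qed

definition sdiff :: "'a set \<Rightarrow> 'a set \<Rightarrow> 'a set" where
  "sdiff X Y = (X - Y) \<union> (Y - X)"

lemma mem_sdiff [simp]: "x \<in> sdiff X Y \<longleftrightarrow> (x \<in> X) \<noteq> (x \<in> Y)"
  unfolding sdiff_def by blast

lemma Ff_sdiff: "Ff S \<Longrightarrow> Ff T \<Longrightarrow> Ff (\<lambda>e. sdiff (S e) (T e))"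
  unfolding sdiff_def by (intro Ff_intros)

lemma Fin_sdiff: "Fin X \<Longrightarrow> Fin Y \<Longrightarrow> Fin (sdiff X Y)"
  using Ff_Fin[OF Ff_sdiff[OF Ff_const Ff_const]] .

text \<open>The state of a two-valued counter. The parity that it computes serves as the sum over a
  finite set of the model with values in the field with two elements.\<close>

definition flip :: "'a set \<Rightarrow> 'a \<Rightarrow> 'a \<Rightarrow> 'a" where
  "flip X i y = (if i \<in> X then if y = \<^bold>0 then \<^bold>1 else \<^bold>0 else y)"

definition parity :: "'a set \<Rightarrow> 'a \<Rightarrow> bool" where
  "parity X n \<longleftrightarrow> nrec \<^bold>0 (flip X) n = \<^bold>1"

definition odd_card :: "'a set \<Rightarrow> bool" where
  "odd_card X \<longleftrightarrow> (\<exists>k. (\<forall>i\<in>X. i \<prec> k) \<and> parity X k)"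

lemma Fun_flip: "X \<in> sets_of M \<Longrightarrow> Fun (\<lambda>e. flip X (e 0) (e 1))"
  unfolding flip_def by (intro dec_intros Dec_mem)

lemma Dec_parity_Ff: assumes "Ff S" "Fun t" shows "Dec (\<lambda>e. parity (S e) (t e))"
proof -
  have "Fun (\<lambda>e. nrec \<^bold>0 (\<lambda>i y. flip (S e) i y) (t e))"
    unfolding flip_def
    by (rule Fun_nrec, intro dec_intros Dec_mem_Ff Ff_rename[OF assms(1)]) (intro Fun_const assms(2))+
  then show ?thesis unfolding parity_def by (intro Dec_eq Fun_const)
qed

lemma Dec_parity: "X \<in> sets_of M \<Longrightarrow> Fun t \<Longrightarrow> Dec (\<lambda>e. parity X (t e))"
  unfolding parity_def
  by (intro Dec_eq Fun_const Fun_nrec[where h="\<lambda>i y _. flip X i y" and g="\<lambda>_. \<^bold>0"] Fun_flip)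

lemma
  assumes "X \<in> sets_of M"
  shows parity_zero: "\<not> parity X \<^bold>0" and parity_suc: "parity X (n \<boxplus> \<^bold>1) \<longleftrightarrow> parity X n \<noteq> (n \<in> X)"
proof -
  note z = nrec_zero[OF Fun_flip[OF assms]] and s = nrec_suc[OF Fun_flip[OF assms]]
  have flip: "flip X i y = \<^bold>0 \<or> flip X i y = \<^bold>1" if "y = \<^bold>0 \<or> y = \<^bold>1" for i y
    using that unfolding flip_def by auto
  have "nrec \<^bold>0 (flip X) n = \<^bold>0 \<or> nrec \<^bold>0 (flip X) n = \<^bold>1"
    by (rule dec_induct[where P="\<lambda>n. nrec \<^bold>0 (flip X) n = \<^bold>0 \<or> nrec \<^bold>0 (flip X) n = \<^bold>1"])
      (intro dec_intros Fun_nrec[where h="\<lambda>i y _. flip X i y" and g="\<lambda>_. \<^bold>0"] Fun_flip assms,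
        simp add: z, simp only: s flip)
  then show "parity X (n \<boxplus> \<^bold>1) \<longleftrightarrow> parity X n \<noteq> (n \<in> X)"
    unfolding parity_def s flip_def by auto
  show "\<not> parity X \<^bold>0" unfolding parity_def z by simp
qed

lemma parity_sdiff:
  assumes "X \<in> sets_of M" "Y \<in> sets_of M" "sdiff X Y \<in> sets_of M"
  shows "parity (sdiff X Y) n \<longleftrightarrow> parity X n \<noteq> parity Y n"
  by (rule dec_induct[where P="\<lambda>n. parity (sdiff X Y) n \<longleftrightarrow> parity X n \<noteq> parity Y n"])
    (intro dec_intros Dec_parity assms, auto simp: parity_zero parity_suc assms)

lemma parity_beyond:
  assumes "X \<in> sets_of M" "\<And>i. i \<in> X \<Longrightarrow> i \<prec> k"
  shows "parity X (k \<boxplus> d) \<longleftrightarrow> parity X k"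
proof (rule dec_induct[where P="\<lambda>d. parity X (k \<boxplus> d) \<longleftrightarrow> parity X k"])
  show "Dec (\<lambda>e. parity X (k \<boxplus> e 0) \<longleftrightarrow> parity X k)" by (intro dec_intros Dec_parity assms)
  show "parity X (k \<boxplus> (n \<boxplus> \<^bold>1)) \<longleftrightarrow> parity X k" if "parity X (k \<boxplus> n) \<longleftrightarrow> parity X k" for n
  proof -
    have "k \<boxplus> n \<notin> X" using assms(2) nle_add_right N.not_le by blast
    then show ?thesis using that by (simp only: add_suc parity_suc[OF assms(1)]) simp
  qed
qed (simp add: add_zero)

lemma odd_card_iff:
  assumes "Fin X" "\<And>i. i \<in> X \<Longrightarrow> i \<prec> k"
  shows "odd_card X \<longleftrightarrow> parity X k"
proof -
  have X: "X \<in> sets_of M" using assms(1) unfolding Fin_def by blast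
  have "parity X k' \<longleftrightarrow> parity X k" if "\<forall>i\<in>X. i \<prec> k'" for k'
    using parity_beyond[OF X, of k k'] parity_beyond[OF X, of k' k] assms(2) that add_commute' by metis
  then show ?thesis unfolding odd_card_def using assms(2) by blast
qed

lemma Fin_bound: assumes "Fin X" obtains k where "\<And>i. i \<in> X \<Longrightarrow> i \<prec> k"
  using assms unfolding Fin_def by blast

lemma Dec_odd_card: assumes "Ff S" shows "Dec (\<lambda>e. odd_card (S e))"
proof -
  obtain b where b: "Fun b" "\<And>e x. x \<in> S e \<Longrightarrow> x \<prec> b e" using assms unfolding Ff_def by blast
  have "odd_card (S e) \<longleftrightarrow> parity (S e) (b e)" for e
    by (rule odd_card_iff[OF Ff_Fin[OF assms] b(2)])
  then show ?thesis using Dec_parity_Ff[OF assms b(1)] by simp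
qed

lemma odd_card_empty [simp]: "\<not> odd_card {}"
  using odd_card_iff[OF Fin_empty, of "\<^bold>0"] parity_zero Fin_empty unfolding Fin_def by blast

lemma odd_card_sdiff:
  assumes "Fin X" "Fin Y"
  shows "odd_card (sdiff X Y) \<longleftrightarrow> odd_card X \<noteq> odd_card Y"
proof -
  obtain k where k: "\<And>i. i \<in> X \<union> Y \<Longrightarrow> i \<prec> k" using Fin_bound[OF Fin_Un[OF assms]] by blast
  have "odd_card (sdiff X Y) \<longleftrightarrow> parity (sdiff X Y) k"
    by (rule odd_card_iff[OF Fin_sdiff[OF assms]]) (use k in auto)
  moreover have "odd_card X \<longleftrightarrow> parity X k" "odd_card Y \<longleftrightarrow> parity Y k"
    using odd_card_iff assms k by blast+
  ultimately show ?thesis using parity_sdiff assms Fin_sdiff[OF assms] unfolding Fin_def by simp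
qed

lemma odd_card_single [simp]: "odd_card {a}"
proof -
  have F: "Fin {a}" by (intro Fin_insert Fin_empty)
  then have X: "{a} \<in> sets_of M" unfolding Fin_def by blast
  have "n \<preceq> a \<longrightarrow> \<not> parity {a} n" for n
  proof (rule dec_induct[where P="\<lambda>n. n \<preceq> a \<longrightarrow> \<not> parity {a} n"])
    show "Dec (\<lambda>e. e 0 \<preceq> a \<longrightarrow> \<not> parity {a} (e 0))" by (intro dec_intros Dec_parity X)
    show "n \<boxplus> \<^bold>1 \<preceq> a \<longrightarrow> \<not> parity {a} (n \<boxplus> \<^bold>1)" if "n \<preceq> a \<longrightarrow> \<not> parity {a} n" for n
      using that unfolding suc_nle_iff parity_suc[OF X] by (auto simp: nle_def)
  qed (simp add: parity_zero[OF X])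
  then have "parity {a} (a \<boxplus> \<^bold>1)" unfolding parity_suc[OF X] by (simp add: nle_def)
  then show ?thesis using odd_card_iff[OF F, of "a \<boxplus> \<^bold>1"] by (simp add: less_suc)
qed

lemma odd_card_filter_single: "odd_card {x \<in> {y}. Q x} \<longleftrightarrow> Q y"
proof (cases "Q y")
  case True
  then have "{x \<in> {y}. Q x} = {y}" by blast
  then show ?thesis using True by (simp only: odd_card_single)
next
  case False
  then have "{x \<in> {y}. Q x} = {}" by blast
  then show ?thesis using False by (simp only: odd_card_empty)
qed

lemma odd_card_filter_sdiff:
  assumes "Fin X" "Fin Y" "Dec (\<lambda>e. Q (e 0))"
  shows "odd_card {x \<in> sdiff X Y. Q x} \<longleftrightarrow> odd_card {x \<in> X. Q x} \<noteq> odd_card {x \<in> Y. Q x}"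
proof -
  have "{x \<in> sdiff X Y. Q x} = sdiff {x \<in> X. Q x} {x \<in> Y. Q x}" by auto
  then show ?thesis using odd_card_sdiff Fin_Collect assms by simp
qed

text \<open>Ordinary induction along the initial segments of \<open>X\<close>, so decidability is
  required on that chain only. The step uses \<open>sdiff\<close> because the maps to be compared
  are additive for it.\<close>

lemma fin_induct:
  assumes X: "Fin X" and P: "Dec (\<lambda>e. P {i \<in> X. i \<prec> e 0})" "P {}"
    and step: "\<And>Y a. Fin Y \<Longrightarrow> Y \<subseteq> X \<Longrightarrow> a \<in> X \<Longrightarrow> a \<notin> Y \<Longrightarrow> P Y \<Longrightarrow> P (sdiff {a} Y)"
  shows "P X"
proof -
  obtain k where k: "\<And>i. i \<in> X \<Longrightarrow> i \<prec> k" using Fin_bound[OF X] by blast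
  have "P {i \<in> X. i \<prec> k}"
  proof (rule dec_induct[where P="\<lambda>n. P {i \<in> X. i \<prec> n}", OF P(1)])
    show "P {i \<in> X. i \<prec> \<^bold>0}" using P(2) by (simp add: not_less_zero)
    fix n assume IH: "P {i \<in> X. i \<prec> n}"
    show "P {i \<in> X. i \<prec> n \<boxplus> \<^bold>1}"
    proof (cases "n \<in> X")
      case True
      have "P (sdiff {n} {i \<in> X. i \<prec> n})"
        by (rule step[OF _ _ True _ IH]) (auto intro!: Fin_Collect X dec_intros)
      moreover have "sdiff {n} {i \<in> X. i \<prec> n} = {i \<in> X. i \<prec> n \<boxplus> \<^bold>1}"
        using True by (auto simp: less_suc)
      ultimately show ?thesis by simp
    next
      case False
      then have "{i \<in> X. i \<prec> n \<boxplus> \<^bold>1} = {i \<in> X. i \<prec> n}" by (auto simp: less_suc)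
      then show ?thesis using IH by simp
    qed
  qed
  moreover have "{i \<in> X. i \<prec> k} = X" using k by blast
  ultimately show ?thesis by simp
qed

text \<open>\<open>sdiff\<close> is vector addition over the field with two elements, and the
  singletons form a basis.\<close>

lemma linear_maps_eq:
  assumes X: "Fin X"
    and F: "F {} = {}" "\<And>Y Z. Fin Y \<Longrightarrow> Fin Z \<Longrightarrow> F (sdiff Y Z) = sdiff (F Y) (F Z)"
    and G: "G {} = {}" "\<And>Y Z. Fin Y \<Longrightarrow> Fin Z \<Longrightarrow> G (sdiff Y Z) = sdiff (G Y) (G Z)"
    and single: "\<And>a. a \<in> X \<Longrightarrow> F {a} = G {a}"
    and dec: "Ff (\<lambda>e. F {i \<in> X. i \<prec> e 0})" "Ff (\<lambda>e. G {i \<in> X. i \<prec> e 0})"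
  shows "F X = G X"
proof (rule fin_induct[where P="\<lambda>X. F X = G X", OF X])
  show "F (sdiff {a} Y) = G (sdiff {a} Y)" if "Fin Y" "a \<in> X" "F Y = G Y" for Y a
    using that F(2) G(2) single Fin_insert[OF Fin_empty] by simp
qed (simp_all add: F(1) G(1) Dec_eq_Ff[OF dec])

text \<open>Remove the classes one at a time: \<open>Y n\<close> keeps the elements not equivalent
  to any member of \<open>S\<close> below n. If n still belongs to \<open>Y n\<close>, the next step
  removes exactly its class, which is even; otherwise nothing changes. In the end nothing is
  left.\<close>

lemma even_classes:
  assumes S: "Fin S" and E: "Dec (\<lambda>e. E (e 0) (e 1))"
    and refl: "\<And>a. a \<in> S \<Longrightarrow> E a a"
    and sym: "\<And>a b. a \<in> S \<Longrightarrow> b \<in> S \<Longrightarrow> E a b \<Longrightarrow> E b a"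
    and trans: "\<And>a b c. a \<in> S \<Longrightarrow> b \<in> S \<Longrightarrow> c \<in> S \<Longrightarrow> E a b \<Longrightarrow> E b c \<Longrightarrow> E a c"
    and even: "\<And>a. a \<in> S \<Longrightarrow> \<not> odd_card {b \<in> S. E b a}"
  shows "\<not> odd_card S"
proof -
  have E': "Dec (\<lambda>e. E (e p) (e q))" for p q
    using Dec_rename[OF E, of "case_nat p (\<lambda>_. q)"] by simp
  have E1: "Dec (\<lambda>e. E (e 0) a)" for a using Dec_instantiate[OF E, of 1 "\<lambda>_. a"] by simp
  have S': "S \<in> sets_of M" using S unfolding Fin_def by blast
  define Y where "Y n = {a \<in> S. \<forall>b. b \<prec> n \<longrightarrow> b \<in> S \<longrightarrow> \<not> E b a}" for n
  have Y: "Ff (\<lambda>e. Y (e 0))" unfolding Y_def by (intro Ff_Collect Ff_const S dec_intros Dec_mem S' E')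
  have FY: "Fin (Y n)" for n using Ff_Fin[OF Y, of "\<lambda>_. n"] by simp
  have par: "odd_card (Y n) \<longleftrightarrow> odd_card S" for n
  proof (rule dec_induct[where P="\<lambda>n. odd_card (Y n) \<longleftrightarrow> odd_card S"])
    show "Dec (\<lambda>e. odd_card (Y (e 0)) \<longleftrightarrow> odd_card S)" by (intro dec_intros Dec_odd_card Y)
    show "odd_card (Y \<^bold>0) \<longleftrightarrow> odd_card S" unfolding Y_def by (simp add: not_less_zero)
    fix n assume IH: "odd_card (Y n) \<longleftrightarrow> odd_card S"
    show "odd_card (Y (n \<boxplus> \<^bold>1)) \<longleftrightarrow> odd_card S"
    proof (cases "n \<in> Y n")
      case True
      then have n: "n \<in> S" "\<And>b. b \<prec> n \<Longrightarrow> b \<in> S \<Longrightarrow> \<not> E b n" unfolding Y_def by blast+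
      have F: "Fin {b \<in> S. E b n}" by (intro Fin_Collect S E1)
      have "Y (n \<boxplus> \<^bold>1) = sdiff (Y n) {b \<in> S. E b n}"
      proof (rule Set.set_eqI)
        fix a
        have "a \<in> Y n" if "a \<in> S" "E a n"
          unfolding Y_def using that n trans[of _ a n] by blast
        moreover have "a \<in> Y (n \<boxplus> \<^bold>1) \<longleftrightarrow> a \<in> Y n \<and> \<not> E n a"
          unfolding Y_def less_suc using n(1) by blast
        moreover have "E n a \<longleftrightarrow> E a n" if "a \<in> S" using sym n(1) that by blast
        moreover have "a \<in> Y n \<Longrightarrow> a \<in> S" unfolding Y_def by blast
        ultimately show "a \<in> Y (n \<boxplus> \<^bold>1) \<longleftrightarrow> a \<in> sdiff (Y n) {b \<in> S. E b n}" by auto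
      qed
      then show ?thesis using IH odd_card_sdiff[OF FY F] even[OF n(1)] by simp
    next
      case False
      have "Y (n \<boxplus> \<^bold>1) = Y n"
      proof (rule Set.set_eqI)
        fix a
        show "a \<in> Y (n \<boxplus> \<^bold>1) \<longleftrightarrow> a \<in> Y n"
        proof (cases "n \<in> S")
          case True
          then obtain b where b: "b \<prec> n" "b \<in> S" "E b n" using False unfolding Y_def by blast
          then have "\<not> E n a" if "a \<in> Y n" using that True trans[of b n a] unfolding Y_def by blast
          then show ?thesis unfolding Y_def less_suc by blast
        qed (auto simp: Y_def less_suc)
      qed
      then show ?thesis using IH by simp
    qed
  qed
  obtain k where k: "\<And>i. i \<in> S \<Longrightarrow> i \<prec> k" using Fin_bound[OF S] by blast
  have "Y k = {}" unfolding Y_def using k refl by blast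
  then show ?thesis using par[of k] by simp
qed

end

section \<open>Monoid algebras over the field with two elements\<close>

locale model_monoid = rca +
  fixes Mon :: "'a set" and mu :: "'a \<Rightarrow> 'a \<Rightarrow> 'a" and unit :: 'a
  assumes Mon: "Mon \<in> sets_of M"
    and Fun_mu_vars: "Fun (\<lambda>e. mu (e 0) (e 1))"
    and mu_closed: "a \<in> Mon \<Longrightarrow> b \<in> Mon \<Longrightarrow> mu a b \<in> Mon"
    and mu_assoc: "a \<in> Mon \<Longrightarrow> b \<in> Mon \<Longrightarrow> c \<in> Mon \<Longrightarrow> mu (mu a b) c = mu a (mu b c)"
    and mu_comm: "a \<in> Mon \<Longrightarrow> b \<in> Mon \<Longrightarrow> mu a b = mu b a"
    and unit: "unit \<in> Mon" "a \<in> Mon \<Longrightarrow> mu unit a = a"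
begin

lemma Fun_mu: "Fun s \<Longrightarrow> Fun t \<Longrightarrow> Fun (\<lambda>e. mu (s e) (t e))"
  by (rule Fun_comp2[OF Fun_mu_vars])

text \<open>The support of the product of the polynomials with supports \<open>X\<close> and
  \<open>Y\<close>: the coefficient of c is a double sum modulo two, written as a parity of
  parities.\<close>

definition conv :: "'a set \<Rightarrow> 'a set \<Rightarrow> 'a set" where
  "conv X Y = {c. odd_card {a \<in> X. odd_card {b \<in> Y. mu a b = c}}}"

lemma odd_card_nonempty: "odd_card X \<Longrightarrow> \<exists>a. a \<in> X"
  by (cases "X = {}") auto

lemma conv_subset: "c \<in> conv X Y \<Longrightarrow> \<exists>a\<in>X. \<exists>b\<in>Y. mu a b = c"
  unfolding conv_def by (auto dest!: odd_card_nonempty)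

lemma Ff_conv: assumes S: "Ff S" and T: "Ff T" shows "Ff (\<lambda>e. conv (S e) (T e))"
proof (rule Ff_subset)
  show "Ff (\<lambda>e. \<Union>a\<in>S e. \<Union>b\<in>T e. {mu a b})"
    by (intro Ff_UN S Ff_rename[OF T] Ff_insert Ff_empty Fun_mu Fun_var)
  show "conv (S e) (T e) \<subseteq> (\<Union>a\<in>S e. \<Union>b\<in>T e. {mu a b})" for e
    using conv_subset by fastforce
  show "Dec (\<lambda>e. e 0 \<in> conv (S (\<lambda>i. e (Suc i))) (T (\<lambda>i. e (Suc i))))"
    unfolding conv_def mem_Collect_eq
    by (intro Dec_odd_card Ff_Collect Ff_rename[OF S] Ff_rename[OF T] Dec_eq Fun_mu Fun_var)
qed

lemma Fin_conv: "Fin X \<Longrightarrow> Fin Y \<Longrightarrow> Fin (conv X Y)"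
  using Ff_Fin[OF Ff_conv[OF Ff_const Ff_const]] .

lemma conv_empty [simp]: "conv {} Y = {}" "conv X {} = {}"
  using conv_subset by blast+

lemma conv_single: "conv {a} {b} = {mu a b}"
  unfolding conv_def odd_card_filter_single by auto

lemma Fin_fibre: "Fin Y \<Longrightarrow> Fin {b \<in> Y. mu a b = c}"
  by (intro Fin_Collect dec_intros Fun_mu)

lemma Fin_odd_fibres:
  assumes "Fin X" "Fin Y" shows "Fin {a \<in> X. odd_card {b \<in> Y. mu a b = c}}"
  by (intro Fin_Collect assms Dec_odd_card Ff_Collect Ff_const dec_intros Fun_mu)

lemma conv_sdiff_left:
  assumes "Fin X" "Fin X'" "Fin Y"
  shows "conv (sdiff X X') Y = sdiff (conv X Y) (conv X' Y)"
proof (rule Set.set_eqI)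
  fix c
  have "{a \<in> sdiff X X'. odd_card {b \<in> Y. mu a b = c}} =
      sdiff {a \<in> X. odd_card {b \<in> Y. mu a b = c}} {a \<in> X'. odd_card {b \<in> Y. mu a b = c}}"
    by auto
  then show "c \<in> conv (sdiff X X') Y \<longleftrightarrow> c \<in> sdiff (conv X Y) (conv X' Y)"
    by (simp only: conv_def mem_Collect_eq mem_sdiff
        odd_card_sdiff[OF Fin_odd_fibres[OF assms(1,3)] Fin_odd_fibres[OF assms(2,3)]])
qed

lemma conv_sdiff_right:
  assumes "Fin X" "Fin Y" "Fin Y'"
  shows "conv X (sdiff Y Y') = sdiff (conv X Y) (conv X Y')"
proof (rule Set.set_eqI)
  fix c
  have "{b \<in> sdiff Y Y'. mu a b = c} = sdiff {b \<in> Y. mu a b = c} {b \<in> Y'. mu a b = c}" for a by auto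
  then have *: "odd_card {b \<in> sdiff Y Y'. mu a b = c} \<longleftrightarrow>
      odd_card {b \<in> Y. mu a b = c} \<noteq> odd_card {b \<in> Y'. mu a b = c}" for a
    using odd_card_sdiff[OF Fin_fibre[OF assms(2)] Fin_fibre[OF assms(3)]] by (simp only:)
  have "{a \<in> X. odd_card {b \<in> sdiff Y Y'. mu a b = c}} =
      sdiff {a \<in> X. odd_card {b \<in> Y. mu a b = c}} {a \<in> X. odd_card {b \<in> Y'. mu a b = c}}"
    unfolding * by auto
  then show "c \<in> conv X (sdiff Y Y') \<longleftrightarrow> c \<in> sdiff (conv X Y) (conv X Y')"
    by (simp only: conv_def mem_Collect_eq mem_sdiff
        odd_card_sdiff[OF Fin_odd_fibres[OF assms(1,2)] Fin_odd_fibres[OF assms(1,3)]])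
qed

lemma Ff_below: "Fin X \<Longrightarrow> Ff (\<lambda>e. {i \<in> X. i \<prec> e n})"
  by (intro Ff_Collect Ff_const dec_intros)

lemma Fin_single: "Fin {a}"
  by (intro Fin_insert Fin_empty)

text \<open>Both sides are additive in each argument, which reduces the claim to singletons, that
  is, to the monoid law. \<open>conv_assoc\<close> repeats this with three arguments.\<close>

lemma conv_comm:
  assumes X: "Fin X" "X \<subseteq> Mon" and Y: "Fin Y" "Y \<subseteq> Mon"
  shows "conv X Y = conv Y X"
proof (rule linear_maps_eq[where F="\<lambda>X. conv X Y" and G="\<lambda>X. conv Y X", OF X(1)])
  fix a assume a: "a \<in> X"
  show "conv {a} Y = conv Y {a}"
    by (rule linear_maps_eq[where F="\<lambda>Y. conv {a} Y" and G="\<lambda>Y. conv Y {a}", OF Y(1)])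
      (use a X(2) Y(2) in \<open>simp_all add: conv_single conv_sdiff_left conv_sdiff_right Fin_single
        Ff_conv Ff_below Ff_const Y mu_comm subset_eq\<close>)
qed (simp_all add: conv_sdiff_left conv_sdiff_right Ff_conv Ff_below Ff_const X Y)

lemma conv_assoc:
  assumes X: "Fin X" "X \<subseteq> Mon" and Y: "Fin Y" "Y \<subseteq> Mon" and Z: "Fin Z" "Z \<subseteq> Mon"
  shows "conv (conv X Y) Z = conv X (conv Y Z)"
proof (rule linear_maps_eq[where F="\<lambda>X. conv (conv X Y) Z" and G="\<lambda>X. conv X (conv Y Z)", OF X(1)])
  fix a assume a: "a \<in> X"
  show "conv (conv {a} Y) Z = conv {a} (conv Y Z)"
  proof (rule linear_maps_eq[where F="\<lambda>Y. conv (conv {a} Y) Z" and G="\<lambda>Y. conv {a} (conv Y Z)", OF Y(1)])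
    fix b assume b: "b \<in> Y"
    show "conv (conv {a} {b}) Z = conv {a} (conv {b} Z)"
    proof (rule linear_maps_eq[where F="\<lambda>Z. conv (conv {a} {b}) Z" and G="\<lambda>Z. conv {a} (conv {b} Z)", OF Z(1)])
      fix c assume "c \<in> Z"
      then have "a \<in> Mon" "b \<in> Mon" "c \<in> Mon" using a b X Y Z by blast+
      then show "conv (conv {a} {b}) {c} = conv {a} (conv {b} {c})"
        by (simp add: conv_single mu_assoc)
    qed (simp_all add: conv_sdiff_right Fin_single Fin_conv Ff_conv Ff_below Ff_const Z)
  qed (simp_all add: conv_sdiff_left conv_sdiff_right Fin_single Fin_conv Ff_conv Ff_below Ff_const Y Z)
qed (simp_all add: conv_sdiff_left Fin_conv Ff_conv Ff_below Ff_const X Y Z)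

lemma conv_unit:
  assumes X: "Fin X" "X \<subseteq> Mon"
  shows "conv {unit} X = X"
  by (rule linear_maps_eq[where F="\<lambda>X. conv {unit} X" and G="\<lambda>X. X", OF X(1)])
    (use X(2) in \<open>auto simp: conv_single conv_sdiff_right Fin_single Ff_conv Ff_below Ff_const X unit subset_eq\<close>)

lemma conv_closed: "X \<subseteq> Mon \<Longrightarrow> Y \<subseteq> Mon \<Longrightarrow> conv X Y \<subseteq> Mon"
  using conv_subset mu_closed by blast

text \<open>A polynomial over the field with two elements is its support. Admitting canonical codes
  only makes equality of polynomials equality of numbers.\<close>

definition Pol :: "'a set" where
  "Pol = {x. finite_set_code M x \<and> els x \<subseteq> Mon}"

definition padd :: "'a \<Rightarrow> 'a \<Rightarrow> 'a" where
  "padd x y = code (sdiff (els x) (els y))"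

definition pmul :: "'a \<Rightarrow> 'a \<Rightarrow> 'a" where
  "pmul x y = code (conv (els x) (els y))"

lemma els_padd [simp]: "els (padd x y) = sdiff (els x) (els y)"
  unfolding padd_def by (intro Fin_code Fin_sdiff Fin_els)

lemma els_pmul [simp]: "els (pmul x y) = conv (els x) (els y)"
  unfolding pmul_def by (intro Fin_code Fin_conv Fin_els)

lemma Fun_padd: "Fun s \<Longrightarrow> Fun t \<Longrightarrow> Fun (\<lambda>e. padd (s e) (t e))"
  and Fun_pmul: "Fun s \<Longrightarrow> Fun t \<Longrightarrow> Fun (\<lambda>e. pmul (s e) (t e))"
  unfolding padd_def pmul_def by (intro Fun_code Ff_sdiff Ff_conv Ff_els; assumption)+

lemma Pol_eqI: "x \<in> Pol \<Longrightarrow> y \<in> Pol \<Longrightarrow> els x = els y \<Longrightarrow> x = y"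
  unfolding Pol_def using finite_set_code_inject by blast

lemma code_in_Pol: "Fin X \<Longrightarrow> X \<subseteq> Mon \<Longrightarrow> code X \<in> Pol"
  unfolding Pol_def by (simp add: Fin_code)

lemma els_code: "Fin X \<Longrightarrow> els (code X) = X"
  by (rule Fin_code)

lemma els_Pol: "x \<in> Pol \<Longrightarrow> els x \<subseteq> Mon"
  unfolding Pol_def by blast

lemma padd_closed: "x \<in> Pol \<Longrightarrow> y \<in> Pol \<Longrightarrow> padd x y \<in> Pol"
  unfolding padd_def sdiff_def using els_Pol by (intro code_in_Pol Fin_sdiff[unfolded sdiff_def] Fin_els) blast

lemma pmul_closed: "x \<in> Pol \<Longrightarrow> y \<in> Pol \<Longrightarrow> pmul x y \<in> Pol"
  unfolding pmul_def by (intro code_in_Pol Fin_conv Fin_els conv_closed els_Pol)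

lemma Pol_in_sets: "Pol \<in> sets_of M"
proof -
  have eq: "els x \<subseteq> Mon \<longleftrightarrow> (\<forall>a\<in>els x. a \<in> Mon)" for x by blast
  show ?thesis unfolding Pol_def eq
    by (intro dec_comprehension dec_intros Ff_intros Dec_mem Mon)
qed

definition op_graph :: "('a \<Rightarrow> 'a \<Rightarrow> 'a) \<Rightarrow> 'a set" where
  "op_graph f = {z. \<exists>x. x \<preceq> z \<and> (\<exists>y. y \<preceq> z \<and> x \<in> Pol \<and> y \<in> Pol \<and> z = pr (pr x y) (f x y))}"

lemma op_graph_in_sets: "Fun (\<lambda>e. f (e (Suc 0)) (e 0)) \<Longrightarrow> op_graph f \<in> sets_of M"
  unfolding op_graph_def by (intro dec_comprehension dec_intros Dec_mem Pol_in_sets)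

lemma mem_op_graph: "z \<in> op_graph f \<longleftrightarrow> (\<exists>x\<in>Pol. \<exists>y\<in>Pol. z = pr (pr x y) (f x y))"
proof
  assume "\<exists>x\<in>Pol. \<exists>y\<in>Pol. z = pr (pr x y) (f x y)"
  then obtain x y where xy: "x \<in> Pol" "y \<in> Pol" "z = pr (pr x y) (f x y)" by blast
  then have "pr x y \<preceq> z" using pr_bounds(1) by blast
  then have "x \<preceq> z" "y \<preceq> z" using pr_bounds N.order_trans by blast+
  then show "z \<in> op_graph f" using xy unfolding op_graph_def by blast
qed (auto simp: op_graph_def)

lemma op_graph_fun:
  assumes "\<And>x y. x \<in> Pol \<Longrightarrow> y \<in> Pol \<Longrightarrow> f x y \<in> Pol"
  shows "is_fun M (op_graph f) (nprod M Pol Pol) Pol"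
    and "x \<in> Pol \<Longrightarrow> y \<in> Pol \<Longrightarrow> app M (op_graph f) (pr x y) = f x y"
proof -
  show f: "is_fun M (op_graph f) (nprod M Pol Pol) Pol"
    unfolding is_fun_def nprod_def using assms by (auto simp: mem_op_graph)
  show "app M (op_graph f) (pr x y) = f x y" if "x \<in> Pol" "y \<in> Pol"
  proof -
    have "pr x y \<in> nprod M Pol Pol" unfolding nprod_def using that by blast
    from is_fun_app(2)[OF f this, of "f x y"] that show ?thesis by (auto simp: mem_op_graph)
  qed
qed

definition algebra :: "'a ring" where
  "algebra = coded_ring M Pol (op_graph padd) (op_graph pmul) (code {}) (code {unit})"

lemma algebra_simps:
  "carrier algebra = Pol" "\<zero>\<^bsub>algebra\<^esub> = code {}" "\<one>\<^bsub>algebra\<^esub> = code {unit}"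
  "x \<in> Pol \<Longrightarrow> y \<in> Pol \<Longrightarrow> x \<oplus>\<^bsub>algebra\<^esub> y = padd x y"
  "x \<in> Pol \<Longrightarrow> y \<in> Pol \<Longrightarrow> x \<otimes>\<^bsub>algebra\<^esub> y = pmul x y"
  unfolding algebra_def coded_ring_def
  using op_graph_fun(2)[of padd] op_graph_fun(2)[of pmul] padd_closed pmul_closed by simp_all

lemma zero_one_Pol: "code {} \<in> Pol" "code {unit} \<in> Pol"
  using unit by (auto intro: code_in_Pol Fin_empty Fin_single)

lemma cring_algebra: "cring algebra"
proof (rule cringI)
  show "abelian_group algebra"
  proof (rule abelian_groupI, unfold algebra_simps(1,2))
    fix x y z assume x: "x \<in> Pol" and y: "y \<in> Pol"
    show "x \<oplus>\<^bsub>algebra\<^esub> y \<in> Pol" using x y padd_closed algebra_simps by simp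
    show "x \<oplus>\<^bsub>algebra\<^esub> y = y \<oplus>\<^bsub>algebra\<^esub> x"
      using x y by (simp add: algebra_simps) (rule Pol_eqI, auto intro: padd_closed)
    show "x \<oplus>\<^bsub>algebra\<^esub> y \<oplus>\<^bsub>algebra\<^esub> z = x \<oplus>\<^bsub>algebra\<^esub> (y \<oplus>\<^bsub>algebra\<^esub> z)" if "z \<in> Pol"
      using x y that by (simp add: algebra_simps padd_closed) (rule Pol_eqI, auto intro: padd_closed)
  next
    fix x assume x: "x \<in> Pol"
    show "code {} \<oplus>\<^bsub>algebra\<^esub> x = x"
      using x zero_one_Pol by (simp add: algebra_simps)
        (rule Pol_eqI, auto intro: padd_closed simp: els_code Fin_empty)
    have "x \<oplus>\<^bsub>algebra\<^esub> x = code {}"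
      using x zero_one_Pol by (simp add: algebra_simps)
        (rule Pol_eqI, auto intro: padd_closed simp: els_code Fin_empty)
    then show "\<exists>y\<in>Pol. y \<oplus>\<^bsub>algebra\<^esub> x = code {}" using x by blast
  qed (rule zero_one_Pol)
  show "comm_monoid algebra"
  proof (rule comm_monoidI, unfold algebra_simps(1,3))
    fix x y z assume x: "x \<in> Pol" and y: "y \<in> Pol"
    show "x \<otimes>\<^bsub>algebra\<^esub> y \<in> Pol" using x y pmul_closed algebra_simps by simp
    show "x \<otimes>\<^bsub>algebra\<^esub> y = y \<otimes>\<^bsub>algebra\<^esub> x"
      using x y by (simp add: algebra_simps)
        (rule Pol_eqI, auto intro!: pmul_closed simp: conv_comm[OF Fin_els els_Pol Fin_els els_Pol])
    show "x \<otimes>\<^bsub>algebra\<^esub> y \<otimes>\<^bsub>algebra\<^esub> z = x \<otimes>\<^bsub>algebra\<^esub> (y \<otimes>\<^bsub>algebra\<^esub> z)" if "z \<in> Pol"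
      using x y that by (simp add: algebra_simps pmul_closed)
        (rule Pol_eqI, auto intro!: pmul_closed simp: conv_assoc[OF Fin_els els_Pol Fin_els els_Pol Fin_els els_Pol])
  next
    fix x assume x: "x \<in> Pol"
    show "code {unit} \<otimes>\<^bsub>algebra\<^esub> x = x"
      using x zero_one_Pol by (simp add: algebra_simps)
        (rule Pol_eqI, auto intro!: pmul_closed simp: els_code Fin_single conv_unit[OF Fin_els els_Pol])
  qed (rule zero_one_Pol)
  fix x y z assume "x \<in> carrier algebra" "y \<in> carrier algebra" "z \<in> carrier algebra"
  then show "(x \<oplus>\<^bsub>algebra\<^esub> y) \<otimes>\<^bsub>algebra\<^esub> z = x \<otimes>\<^bsub>algebra\<^esub> z \<oplus>\<^bsub>algebra\<^esub> y \<otimes>\<^bsub>algebra\<^esub> z"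
    by (simp add: algebra_simps padd_closed pmul_closed)
      (rule Pol_eqI, auto intro!: pmul_closed padd_closed simp: conv_sdiff_left Fin_els)
qed

lemma algebra_countable: "algebra \<in> countable_rings M"
  unfolding countable_rings_def mem_Collect_eq
proof (intro exI conjI)
  show "algebra = coded_ring M Pol (op_graph padd) (op_graph pmul) (code {}) (code {unit})"
    by (rule algebra_def)
  show "cring (coded_ring M Pol (op_graph padd) (op_graph pmul) (code {}) (code {unit}))"
    using cring_algebra unfolding algebra_def .
  show "op_graph padd \<in> sets_of M" "op_graph pmul \<in> sets_of M"
    by (intro op_graph_in_sets Fun_padd Fun_pmul Fun_var)+
  show "is_fun M (op_graph padd) (nprod M Pol Pol) Pol" "is_fun M (op_graph pmul) (nprod M Pol Pol) Pol"
    by (rule op_graph_fun(1), erule (1) padd_closed pmul_closed)+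
qed (rule Pol_in_sets)

sublocale A: model_ring M algebra
  by unfold_locales (rule algebra_countable)

end

section \<open>Powers of two and the Frobenius map\<close>

context rca
begin

definition p2 :: "'a \<Rightarrow> 'a" where "p2 n = nrec \<^bold>1 (\<lambda>i y. y \<boxplus> y) n"

lemma p2_zero: "p2 \<^bold>0 = \<^bold>1" and p2_suc: "p2 (n \<boxplus> \<^bold>1) = p2 n \<boxplus> p2 n"
proof -
  have F: "Fun (\<lambda>e. e 1 \<boxplus> e 1)" by (intro dec_intros)
  show "p2 \<^bold>0 = \<^bold>1" "p2 (n \<boxplus> \<^bold>1) = p2 n \<boxplus> p2 n"
    unfolding p2_def by (rule nrec_zero[OF F] nrec_suc[OF F])+
qed

lemma Fun_p2: "Fun t \<Longrightarrow> Fun (\<lambda>e. p2 (t e))"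
  unfolding p2_def
  by (rule Fun_nrec[where h="\<lambda>i y _. y \<boxplus> y" and g="\<lambda>_. \<^bold>1"]) (intro dec_intros, rule Fun_const, assumption)

lemma less_p2: "n \<prec> p2 n"
proof (rule dec_induct[where P="\<lambda>n. n \<prec> p2 n"])
  show "Dec (\<lambda>e. e 0 \<prec> p2 (e 0))" by (intro dec_intros Fun_p2)
  show "\<^bold>0 \<prec> p2 \<^bold>0" by (simp add: p2_zero)
  fix n assume IH: "n \<prec> p2 n"
  then have "\<^bold>1 \<preceq> p2 n" by (metis suc_nle_iff N.le_less_trans zero_nle zero_add)
  then have "n \<boxplus> \<^bold>1 \<prec> p2 n \<boxplus> p2 n" using IH by (intro N.add_less_le_mono)
  then show "n \<boxplus> \<^bold>1 \<prec> p2 (n \<boxplus> \<^bold>1)" by (simp only: p2_suc)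
qed

lemma p2_nonzero: "p2 n \<noteq> \<^bold>0"
  using less_p2 not_less_zero by metis

end

context model_ring
begin

lemma ml_eq: "x \<in> carrier R \<Longrightarrow> y \<in> carrier R \<Longrightarrow> ml x y = x \<otimes>\<^bsub>R\<^esub> y"
  and ad_eq: "x \<in> carrier R \<Longrightarrow> y \<in> carrier R \<Longrightarrow> ad x y = x \<oplus>\<^bsub>R\<^esub> y"
  by (simp_all add: ml_def ad_def)

lemma pw_add:
  assumes x: "x \<in> carrier R"
  shows "pw x (m \<boxplus> n) = pw x m \<otimes>\<^bsub>R\<^esub> pw x n"
proof -
  have "pw x (m \<boxplus> n) = ml (pw x m) (pw x n)"
  proof (rule dec_induct[where P="\<lambda>n. pw x (m \<boxplus> n) = ml (pw x m) (pw x n)"])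
    show "Dec (\<lambda>e. pw x (m \<boxplus> e 0) = ml (pw x m) (pw x (e 0)))"
      by (intro dec_intros Fun_pw Fun_ml)
    show "pw x (m \<boxplus> \<^bold>0) = ml (pw x m) (pw x \<^bold>0)" using x by (simp add: add_zero pw_zero ml_eq)
    show "pw x (m \<boxplus> (n \<boxplus> \<^bold>1)) = ml (pw x m) (pw x (n \<boxplus> \<^bold>1))"
      if "pw x (m \<boxplus> n) = ml (pw x m) (pw x n)" for n
      unfolding add_suc pw_suc[OF x] that using x by (simp add: ml_eq m_assoc)
  qed
  then show ?thesis using x by (simp add: ml_eq)
qed

lemma pw_mult:
  assumes x: "x \<in> carrier R" and y: "y \<in> carrier R"
  shows "pw (x \<otimes>\<^bsub>R\<^esub> y) n = pw x n \<otimes>\<^bsub>R\<^esub> pw y n"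
proof -
  have xy: "x \<otimes>\<^bsub>R\<^esub> y \<in> carrier R" using x y by simp
  have "pw (x \<otimes>\<^bsub>R\<^esub> y) n = ml (pw x n) (pw y n)"
  proof (rule dec_induct[where P="\<lambda>n. pw (x \<otimes>\<^bsub>R\<^esub> y) n = ml (pw x n) (pw y n)"])
    show "Dec (\<lambda>e. pw (x \<otimes>\<^bsub>R\<^esub> y) (e 0) = ml (pw x (e 0)) (pw y (e 0)))"
      by (intro dec_intros Fun_pw Fun_ml)
    show "pw (x \<otimes>\<^bsub>R\<^esub> y) \<^bold>0 = ml (pw x \<^bold>0) (pw y \<^bold>0)" by (simp add: pw_zero ml_eq)
    show "pw (x \<otimes>\<^bsub>R\<^esub> y) (n \<boxplus> \<^bold>1) = ml (pw x (n \<boxplus> \<^bold>1)) (pw y (n \<boxplus> \<^bold>1))"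
      if "pw (x \<otimes>\<^bsub>R\<^esub> y) n = ml (pw x n) (pw y n)" for n
      unfolding pw_suc[OF x] pw_suc[OF y] pw_suc[OF xy] that using x y by (simp add: ml_eq m_ac)
  qed
  then show ?thesis using x y by (simp add: ml_eq)
qed

lemma pw_one: "pw \<one>\<^bsub>R\<^esub> n = \<one>\<^bsub>R\<^esub>"
  by (rule dec_induct[where P="\<lambda>n. pw \<one>\<^bsub>R\<^esub> n = \<one>\<^bsub>R\<^esub>"])
    (intro dec_intros Fun_pw, simp_all add: pw_zero pw_suc)

text \<open>In characteristic two the mixed term of a square occurs twice and vanishes. Internal
  induction on \<open>i\<close> iterates this, so the exponent may be nonstandard.\<close>

lemma frobenius:
  assumes char: "\<And>x. x \<in> carrier R \<Longrightarrow> x \<oplus>\<^bsub>R\<^esub> x = \<zero>\<^bsub>R\<^esub>"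
    and x: "x \<in> carrier R" and y: "y \<in> carrier R"
  shows "pw (x \<oplus>\<^bsub>R\<^esub> y) (p2 i) = pw x (p2 i) \<oplus>\<^bsub>R\<^esub> pw y (p2 i)"
proof -
  have xy: "x \<oplus>\<^bsub>R\<^esub> y \<in> carrier R" using x y by simp
  have one: "pw z \<^bold>1 = z" if "z \<in> carrier R" for z
    using pw_suc[OF that, of "\<^bold>0"] that by (simp add: pw_zero)
  have "pw (x \<oplus>\<^bsub>R\<^esub> y) (p2 i) = ad (pw x (p2 i)) (pw y (p2 i))"
  proof (rule dec_induct[where P="\<lambda>i. pw (x \<oplus>\<^bsub>R\<^esub> y) (p2 i) = ad (pw x (p2 i)) (pw y (p2 i))"])
    show "Dec (\<lambda>e. pw (x \<oplus>\<^bsub>R\<^esub> y) (p2 (e 0)) = ad (pw x (p2 (e 0))) (pw y (p2 (e 0))))"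
      by (intro dec_intros Fun_pw Fun_ad Fun_p2)
    show "pw (x \<oplus>\<^bsub>R\<^esub> y) (p2 \<^bold>0) = ad (pw x (p2 \<^bold>0)) (pw y (p2 \<^bold>0))"
      by (simp add: p2_zero one x y xy ad_eq)
    fix i
    assume IH: "pw (x \<oplus>\<^bsub>R\<^esub> y) (p2 i) = ad (pw x (p2 i)) (pw y (p2 i))"
    define u v where "u = pw x (p2 i)" and "v = pw y (p2 i)"
    have u: "u \<in> carrier R" and v: "v \<in> carrier R" unfolding u_def v_def using x y by simp_all
    have "(u \<oplus>\<^bsub>R\<^esub> v) \<otimes>\<^bsub>R\<^esub> (u \<oplus>\<^bsub>R\<^esub> v) =
        u \<otimes>\<^bsub>R\<^esub> u \<oplus>\<^bsub>R\<^esub> (u \<otimes>\<^bsub>R\<^esub> v \<oplus>\<^bsub>R\<^esub> u \<otimes>\<^bsub>R\<^esub> v) \<oplus>\<^bsub>R\<^esub> v \<otimes>\<^bsub>R\<^esub> v"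
      using u v by (simp add: l_distr r_distr a_ac m_comm)
    also have "\<dots> = u \<otimes>\<^bsub>R\<^esub> u \<oplus>\<^bsub>R\<^esub> v \<otimes>\<^bsub>R\<^esub> v" using u v char by simp
    finally show "pw (x \<oplus>\<^bsub>R\<^esub> y) (p2 (i \<boxplus> \<^bold>1)) = ad (pw x (p2 (i \<boxplus> \<^bold>1))) (pw y (p2 (i \<boxplus> \<^bold>1)))"
      unfolding p2_suc pw_add[OF x] pw_add[OF y] pw_add[OF xy] IH
      unfolding u_def[symmetric] v_def[symmetric] using u v by (simp add: ad_eq)
  qed
  then show ?thesis using x y by (simp add: ad_eq)
qed

text \<open>If a^m and b^n lie in the ideal, the exponent d = 2^(m + n) exceeds both m and n. Thus
  a^d and b^d lie in it, and with them the d-th power of every combination.\<close>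

lemma radical_ideal:
  assumes char: "\<And>x. x \<in> carrier R \<Longrightarrow> x \<oplus>\<^bsub>R\<^esub> x = \<zero>\<^bsub>R\<^esub>" and I: "is_ideal R I"
  shows "is_ideal R (radical M R I)"
proof -
  have pow: "pw x (p2 i) \<in> I" if "x \<in> carrier R" "pw x n \<in> I" "n \<preceq> i" for x n i
  proof -
    have "n \<preceq> p2 i" using that(3) less_p2[of i] N.le_less_trans nle_def by blast
    then obtain k where "p2 i = n \<boxplus> k" unfolding nle_iff_add by blast
    then show ?thesis using pw_add[OF that(1)] ideal_closed(2)[OF I that(2)] that(1) by simp
  qed
  have "a \<otimes>\<^bsub>R\<^esub> r \<oplus>\<^bsub>R\<^esub> b \<otimes>\<^bsub>R\<^esub> s \<in> radical M R I"
    if a: "a \<in> carrier R" "pw a m \<in> I" and b: "b \<in> carrier R" "pw b n \<in> I"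
      and r: "r \<in> carrier R" and s: "s \<in> carrier R" for a b r s m n
  proof -
    have "pw a (p2 (m \<boxplus> n)) \<in> I" "pw b (p2 (m \<boxplus> n)) \<in> I"
      using pow a b nle_add_right nle_add_left by blast+
    then have "pw (a \<otimes>\<^bsub>R\<^esub> r \<oplus>\<^bsub>R\<^esub> b \<otimes>\<^bsub>R\<^esub> s) (p2 (m \<boxplus> n)) \<in> I"
      using a b r s ideal_closed[OF I] by (simp add: frobenius[OF char] pw_mult)
    then show ?thesis unfolding radical_iff using p2_nonzero a b r s by auto
  qed
  then show ?thesis unfolding is_ideal_def using radical_iff by auto
qed

end

section \<open>Quotients of monoid algebras by congruences\<close>

text \<open>Monomials of \<open>dead\<close> are to become zero and monomials related by
  \<open>E\<close> are to become equal. The last two assumptions make \<open>dead\<close> a union of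
  classes that absorbs multiplication.\<close>

locale model_congruence = model_monoid +
  fixes dead :: "'a \<Rightarrow> bool" and E :: "'a \<Rightarrow> 'a \<Rightarrow> bool"
  assumes Dec_dead: "Dec (\<lambda>e. dead (e 0))" and Dec_E: "Dec (\<lambda>e. E (e 0) (e 1))"
    and E_refl: "a \<in> Mon \<Longrightarrow> E a a"
    and E_sym: "E a b \<Longrightarrow> E b a"
    and E_trans: "E a b \<Longrightarrow> E b c \<Longrightarrow> E a c"
    and E_mu: "a \<in> Mon \<Longrightarrow> b \<in> Mon \<Longrightarrow> c \<in> Mon \<Longrightarrow> E a b \<Longrightarrow> E (mu a c) (mu b c)"
    and dead_E: "dead a \<Longrightarrow> E a b \<Longrightarrow> dead b"
    and dead_mu: "a \<in> Mon \<Longrightarrow> b \<in> Mon \<Longrightarrow> dead a \<Longrightarrow> dead (mu a b)"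
begin

lemma Dec_E_right: "Dec (\<lambda>e. E (e 0) c)"
  using Dec_instantiate[OF Dec_E, of 1 "\<lambda>_. c"] by simp

text \<open>The image in the quotient vanishes: every class that is not dead contains an even number
  of the monomials.\<close>

definition null :: "'a set \<Rightarrow> bool" where
  "null X \<longleftrightarrow> (\<forall>c\<in>Mon. \<not> dead c \<longrightarrow> \<not> odd_card {a \<in> X. E a c})"

text \<open>An odd class is nonempty and hence represented by a member of \<open>X\<close>. This
  replaces a quantifier over all monomials by a bounded one, so that \<open>kernel\<close> is a set
  of the model.\<close>

lemma null_iff:
  assumes "X \<subseteq> Mon"
  shows "null X \<longleftrightarrow> (\<forall>c\<in>X. \<not> dead c \<longrightarrow> \<not> odd_card {a \<in> X. E a c})"
proof
  assume *: "\<forall>c\<in>X. \<not> dead c \<longrightarrow> \<not> odd_card {a \<in> X. E a c}"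
  show "null X"
    unfolding null_def
  proof (intro ballI impI notI)
    fix c assume c: "c \<in> Mon" "\<not> dead c" "odd_card {a \<in> X. E a c}"
    then obtain a where a: "a \<in> X" "E a c" using odd_card_nonempty by blast
    have "{b \<in> X. E b a} = {b \<in> X. E b c}" using a(2) E_sym E_trans by blast
    moreover have "\<not> dead a" using dead_E a(2) c(2) by blast
    ultimately show False using * a(1) c(3) by force
  qed
qed (use assms in \<open>auto simp: null_def\<close>)

lemma null_sdiff:
  assumes "Fin X" "Fin Y" "null X" "null Y" shows "null (sdiff X Y)"
  using assms(3,4) unfolding null_def odd_card_filter_sdiff[OF assms(1,2) Dec_E_right] by blast

text \<open>Both parities are additive in \<open>X\<close>, so it is enough to compare them on
  singletons.\<close>

lemma odd_card_conv_single:
  assumes X: "Fin X"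
  shows "odd_card {x \<in> conv X {b}. E x c} \<longleftrightarrow> odd_card {a \<in> X. E (mu a b) c}"
proof (rule fin_induct[where P="\<lambda>X. odd_card {x \<in> conv X {b}. E x c} \<longleftrightarrow> odd_card {a \<in> X. E (mu a b) c}", OF X])
  have D: "Dec (\<lambda>e. E (mu (e 0) b) c)"
    using Dec_comp[OF Dec_E_right Fun_mu[OF Fun_var Fun_const]] .
  show "Dec (\<lambda>e. odd_card {x \<in> conv {i \<in> X. i \<prec> e 0} {b}. E x c} \<longleftrightarrow>
      odd_card {a \<in> {i \<in> X. i \<prec> e 0}. E (mu a b) c})"
    by (intro Dec_iff Dec_odd_card Ff_Collect[OF _ Dec_E_right] Ff_Collect[OF _ D] Ff_conv
        Ff_below X Ff_const Fin_single)
  show "odd_card {x \<in> conv (sdiff {a} Y) {b}. E x c} \<longleftrightarrow> odd_card {d \<in> sdiff {a} Y. E (mu d b) c}"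
    if Y: "Fin Y" and IH: "odd_card {x \<in> conv Y {b}. E x c} \<longleftrightarrow> odd_card {a \<in> Y. E (mu a b) c}" for Y a
    unfolding conv_sdiff_left[OF Fin_single Y Fin_single] conv_single
      odd_card_filter_sdiff[OF Fin_single Fin_conv[OF Y Fin_single] Dec_E_right]
      odd_card_filter_sdiff[OF Fin_single Y D] odd_card_filter_single IH ..
qed simp

text \<open>Multiplication by \<open>b\<close> respects \<open>E\<close>, so the monomials of
  \<open>X\<close> that it sends into the class of \<open>c\<close> form a union of classes of
  \<open>X\<close>. None of these is dead, as \<open>c\<close> is not; hence all are even, and so is
  the union.\<close>

lemma null_conv_single:
  assumes X: "Fin X" "X \<subseteq> Mon" "null X" and b: "b \<in> Mon" and c: "\<not> dead c"
  shows "\<not> odd_card {x \<in> conv X {b}. E x c}"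
proof -
  have D: "Dec (\<lambda>e. E (mu (e 0) b) c)"
    using Dec_comp[OF Dec_E_right Fun_mu[OF Fun_var Fun_const]] .
  let ?S = "{a \<in> X. E (mu a b) c}"
  have "\<not> odd_card ?S"
  proof (rule even_classes[where E=E])
    show "Fin ?S" by (rule Fin_Collect[OF X(1) D])
    fix a assume a: "a \<in> ?S"
    then have aM: "a \<in> Mon" using X(2) by blast
    have "b' \<in> ?S" if "b' \<in> X" "E b' a" for b'
      using E_mu[OF _ aM b that(2)] that(1) X(2) a E_trans by blast
    then have "{b' \<in> ?S. E b' a} = {b' \<in> X. E b' a}" by blast
    moreover have "\<not> dead a" using dead_mu[OF aM b] dead_E a c by blast
    ultimately show "\<not> odd_card {b' \<in> ?S. E b' a}" using X(3) aM unfolding null_def by simp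
  qed (use Dec_E E_refl X(2) E_sym E_trans in blast)+
  then show ?thesis unfolding odd_card_conv_single[OF X(1)] .
qed

lemma null_conv:
  assumes X: "Fin X" "X \<subseteq> Mon" "null X" and Y: "Fin Y" "Y \<subseteq> Mon"
  shows "null (conv X Y)"
  unfolding null_def
proof (intro ballI impI)
  fix c assume c: "c \<in> Mon" "\<not> dead c"
  show "\<not> odd_card {x \<in> conv X Y. E x c}"
  proof (rule fin_induct[where P="\<lambda>Y. \<not> odd_card {x \<in> conv X Y. E x c}", OF Y(1)])
    show "Dec (\<lambda>e. \<not> odd_card {x \<in> conv X {i \<in> Y. i \<prec> e 0}. E x c})"
      by (intro Dec_not Dec_odd_card Ff_Collect[OF _ Dec_E_right] Ff_conv Ff_below X Y Ff_const)
    show "\<not> odd_card {x \<in> conv X (sdiff {b} Z). E x c}"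
      if Z: "Fin Z" "b \<in> Y" "\<not> odd_card {x \<in> conv X Z. E x c}" for Z b
      unfolding conv_sdiff_right[OF X(1) Fin_single Z(1)]
        odd_card_filter_sdiff[OF Fin_conv[OF X(1) Fin_single] Fin_conv[OF X(1) Z(1)] Dec_E_right]
      using Z(3) null_conv_single[OF X _ c(2)] Z(2) Y(2) by blast
  qed simp
qed

definition kernel :: "'a set" where
  "kernel = {x \<in> Pol. null (els x)}"

lemma kernel_in_sets: "kernel \<in> sets_of M"
proof -
  have "kernel = {x. x \<in> Pol \<and> (\<forall>c\<in>els x. \<not> dead c \<longrightarrow> \<not> odd_card {a \<in> els x. E a c})}"
    unfolding kernel_def using null_iff els_Pol by blast
  also have "Dec (\<lambda>e. E (e 0) (e (Suc 0)))" using Dec_E by simp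
  then have "{x. x \<in> Pol \<and> (\<forall>c\<in>els x. \<not> dead c \<longrightarrow> \<not> odd_card {a \<in> els x. E a c})} \<in> sets_of M"
    by (intro dec_comprehension dec_intros Dec_ball_Ff Dec_odd_card Ff_Collect Ff_els Dec_mem
        Pol_in_sets Dec_dead)
  finally show ?thesis .
qed

lemma kernel_ideal: "is_ideal algebra kernel"
proof -
  have "a \<otimes>\<^bsub>algebra\<^esub> r \<oplus>\<^bsub>algebra\<^esub> b \<otimes>\<^bsub>algebra\<^esub> s \<in> kernel"
    if "a \<in> kernel" "b \<in> kernel" "r \<in> Pol" "s \<in> Pol" for a b r s
  proof -
    have p: "a \<in> Pol" "b \<in> Pol" "null (els a)" "null (els b)" using that unfolding kernel_def by blast+
    have "null (els (padd (pmul a r) (pmul b s)))"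
      unfolding els_padd els_pmul
      by (intro null_sdiff null_conv Fin_conv Fin_els els_Pol p that)
    then show ?thesis using p that padd_closed pmul_closed by (simp add: algebra_simps kernel_def)
  qed
  then show ?thesis unfolding is_ideal_def algebra_simps kernel_def by blast
qed

lemma char_two: "x \<in> carrier algebra \<Longrightarrow> x \<oplus>\<^bsub>algebra\<^esub> x = \<zero>\<^bsub>algebra\<^esub>"
  using zero_one_Pol(1) unfolding algebra_simps(1,2)
  by (simp add: algebra_simps) (rule Pol_eqI, auto intro: padd_closed simp: els_code Fin_empty)

end

section \<open>Monomials as finitely supported functions\<close>

context rca
begin

text \<open>An exponent function of finite support is stored as its graph without the zero values,
  which makes the representation unique.\<close>

definition Mns :: "'a set" where
  "Mns = {a. finite_set_code M a \<and>
     (\<forall>z\<in>els a. \<exists>n. n \<preceq> z \<and> (\<exists>w. w \<preceq> z \<and> z = pr n w \<and> w \<noteq> \<^bold>0)) \<and>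
     (\<forall>n. n \<preceq> a \<longrightarrow> (\<forall>w. w \<preceq> a \<longrightarrow> (\<forall>w'. w' \<preceq> a \<longrightarrow>
        pr n w \<in> els a \<longrightarrow> pr n w' \<in> els a \<longrightarrow> w = w')))}"

definition val :: "'a \<Rightarrow> 'a \<Rightarrow> 'a" where
  "val a n = (if a \<in> Mns \<and> (\<exists>w. pr n w \<in> els a) then THE w. pr n w \<in> els a else \<^bold>0)"

lemma Mns_in_sets: "Mns \<in> sets_of M"
  unfolding Mns_def by (intro dec_comprehension dec_intros Ff_intros)

lemma Mns_D:
  assumes "a \<in> Mns"
  shows "finite_set_code M a" "pr n w \<in> els a \<Longrightarrow> pr n w' \<in> els a \<Longrightarrow> w = w'"
    "z \<in> els a \<Longrightarrow> \<exists>n w. z = pr n w \<and> w \<noteq> \<^bold>0"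
proof -
  show "pr n w \<in> els a \<Longrightarrow> pr n w' \<in> els a \<Longrightarrow> w = w'"
    using assms pr_mem_els_bounds[of n w a] pr_mem_els_bounds[of n w' a]
    unfolding Mns_def nle_def by blast
qed (use assms in \<open>auto simp: Mns_def\<close>)

lemma Mns_I:
  assumes "finite_set_code M a" "\<And>n w w'. pr n w \<in> els a \<Longrightarrow> pr n w' \<in> els a \<Longrightarrow> w = w'"
    "\<And>z. z \<in> els a \<Longrightarrow> \<exists>n w. z = pr n w \<and> w \<noteq> \<^bold>0"
  shows "a \<in> Mns"
proof -
  have "\<exists>n. n \<preceq> z \<and> (\<exists>w. w \<preceq> z \<and> z = pr n w \<and> w \<noteq> \<^bold>0)" if "z \<in> els a" for z
    using assms(3)[OF that] pr_bounds by blast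
  then show ?thesis using assms(1,2) unfolding Mns_def by blast
qed

lemma val_iff:
  assumes "a \<in> Mns" shows "w = val a n \<longleftrightarrow> pr n w \<in> els a \<or> w = \<^bold>0 \<and> (\<forall>w'. pr n w' \<notin> els a)"
proof (cases "\<exists>w. pr n w \<in> els a")
  case True
  then obtain v where v: "pr n v \<in> els a" by blast
  have "(THE w. pr n w \<in> els a) = v" using v Mns_D(2)[OF assms] by (intro the_equality) blast+
  then have "val a n = v" using True assms unfolding val_def by simp
  then show ?thesis using v Mns_D(2)[OF assms] by blast
qed (auto simp: val_def)

lemma Fun_val: "Fun s \<Longrightarrow> Fun t \<Longrightarrow> Fun (\<lambda>e. val (s e) (t e))"
proof -
  have "(\<forall>w'. pr n w' \<notin> els a) \<longleftrightarrow> (\<forall>w'. w' \<prec> a \<longrightarrow> pr n w' \<notin> els a)" for n a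
    using pr_mem_els_bounds(2) by blast
  then have "w = val a n \<longleftrightarrow>
      (if a \<in> Mns then pr n w \<in> els a \<or> w = \<^bold>0 \<and> (\<forall>w'. w' \<prec> a \<longrightarrow> pr n w' \<notin> els a) else w = \<^bold>0)" for w a n
    using val_iff[of a w n] by (simp add: val_def)
  then have "Fun (\<lambda>e. val (e 0) (e 1))"
    unfolding Fun_def by (simp only:) (intro dec_intros Ff_intros Dec_mem Mns_in_sets)
  then show "Fun s \<Longrightarrow> Fun t \<Longrightarrow> Fun (\<lambda>e. val (s e) (t e))" by (rule Fun_comp2)
qed

lemma val_nonzero: "val a n \<noteq> \<^bold>0 \<Longrightarrow> pr n (val a n) \<in> els a"
  using val_iff[of a "val a n" n] by (cases "a \<in> Mns") (auto simp: val_def)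

lemma val_nle: "val a n \<preceq> a" "val a n \<noteq> \<^bold>0 \<Longrightarrow> n \<preceq> a"
proof -
  show "val a n \<preceq> a"
    using pr_mem_els_bounds(2)[OF val_nonzero[of a n]] by (cases "val a n = \<^bold>0") (auto simp: nle_def[of "val a n"])
  show "val a n \<noteq> \<^bold>0 \<Longrightarrow> n \<preceq> a" using pr_mem_els_bounds(1)[OF val_nonzero[of a n]] nle_def by blast
qed

lemma Mns_eqI: assumes "a \<in> Mns" "b \<in> Mns" "\<And>n. val a n = val b n" shows "a = b"
proof -
  have mem: "z \<in> els a \<longleftrightarrow> (\<exists>n. z = pr n (val a n) \<and> val a n \<noteq> \<^bold>0)" if a: "a \<in> Mns" for a z
  proof
    assume z: "z \<in> els a"
    then obtain n w where nw: "z = pr n w" "w \<noteq> \<^bold>0" using Mns_D(3)[OF a] by blast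
    then have "w = val a n" using z val_iff[OF a] by blast
    then show "\<exists>n. z = pr n (val a n) \<and> val a n \<noteq> \<^bold>0" using nw by blast
  qed (use val_nonzero in blast)
  have "els a = els b"
    by (rule Set.set_eqI) (simp only: mem[OF assms(1)] mem[OF assms(2)] assms(3))
  then show ?thesis by (rule finite_set_code_inject[OF Mns_D(1)[OF assms(1)] Mns_D(1)[OF assms(2)]])
qed

definition mk :: "('a \<Rightarrow> 'a) \<Rightarrow> 'a" where
  "mk f = code {z. \<exists>n. n \<preceq> z \<and> (\<exists>w. w \<preceq> z \<and> (z = pr n w \<and> w \<noteq> \<^bold>0 \<and> w = f n))}"

text \<open>One bound \<open>k\<close> controls both support and values, so all pairs of the graph
  are at most \<open>pr (k e) (k e)\<close>.\<close>

lemma Ff_mk: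
  assumes f: "Fun (\<lambda>e. f (e 0) (\<lambda>i. e (Suc i)))" and k: "Fun k"
    and bound: "\<And>n e. f n e \<preceq> k e" "\<And>n e. f n e \<noteq> \<^bold>0 \<Longrightarrow> n \<preceq> k e"
  shows "Ff (\<lambda>e. {z. \<exists>n. n \<preceq> z \<and> (\<exists>w. w \<preceq> z \<and> (z = pr n w \<and> w \<noteq> \<^bold>0 \<and> w = f n e))})"
proof (rule Ff_I[of "\<lambda>e. pr (k e) (k e) \<boxplus> \<^bold>1"])
  show "Fun (\<lambda>e. pr (k e) (k e) \<boxplus> \<^bold>1)" by (intro dec_intros k)
  show "x \<prec> pr (k e) (k e) \<boxplus> \<^bold>1"
    if "x \<in> {z. \<exists>n. n \<preceq> z \<and> (\<exists>w. w \<preceq> z \<and> (z = pr n w \<and> w \<noteq> \<^bold>0 \<and> w = f n e))}" for x e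
    using that bound pr_mono unfolding less_suc_iff by auto
  have "Fun (\<lambda>e. f (e (Suc 0)) (\<lambda>i. e (Suc (Suc (Suc i)))))"
    using Fun_rename[OF f, of "case_nat 1 (\<lambda>i. i + 3)"] by (simp add: eval_nat_numeral)
  then show "Dec (\<lambda>e. e 0 \<in> {z. \<exists>n. n \<preceq> z \<and> (\<exists>w. w \<preceq> z \<and> (z = pr n w \<and> w \<noteq> \<^bold>0 \<and>
      w = f n (\<lambda>i. e (Suc i))))})"
    unfolding mem_Collect_eq by (intro dec_intros)
qed

lemma Fun_mk:
  assumes "Fun (\<lambda>e. f (e 0) (\<lambda>i. e (Suc i)))" "Fun k"
    and "\<And>n e. f n e \<preceq> k e" "\<And>n e. f n e \<noteq> \<^bold>0 \<Longrightarrow> n \<preceq> k e"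
  shows "Fun (\<lambda>e. mk (\<lambda>n. f n e))"
  unfolding mk_def by (rule Fun_code[OF Ff_mk[OF assms]])

lemma mk_Mns:
  assumes f: "Fun (\<lambda>e. f (e 0))" and bound: "\<And>n. f n \<preceq> k" "\<And>n. f n \<noteq> \<^bold>0 \<Longrightarrow> n \<preceq> k"
  shows "mk f \<in> Mns" "val (mk f) n = f n"
    "els (mk f) = {z. \<exists>n. n \<preceq> z \<and> (\<exists>w. w \<preceq> z \<and> (z = pr n w \<and> w \<noteq> \<^bold>0 \<and> w = f n))}"
proof -
  have F: "Fin {z. \<exists>n. n \<preceq> z \<and> (\<exists>w. w \<preceq> z \<and> (z = pr n w \<and> w \<noteq> \<^bold>0 \<and> w = f n))}"
    using Ff_Fin[OF Ff_mk[of "\<lambda>n e. f n" "\<lambda>e. k", OF f Fun_const bound]] by simp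
  show els: "els (mk f) = {z. \<exists>n. n \<preceq> z \<and> (\<exists>w. w \<preceq> z \<and> (z = pr n w \<and> w \<noteq> \<^bold>0 \<and> w = f n))}"
    unfolding mk_def by (rule Fin_code(2)[OF F])
  have mem: "pr n w \<in> els (mk f) \<longleftrightarrow> w \<noteq> \<^bold>0 \<and> w = f n" for n w
    unfolding els using pr_bounds by auto
  show mns: "mk f \<in> Mns"
  proof (rule Mns_I)
    show "finite_set_code M (mk f)" unfolding mk_def by (rule Fin_code(1)[OF F])
    show "\<exists>n w. z = pr n w \<and> w \<noteq> \<^bold>0" if "z \<in> els (mk f)" for z using that unfolding els by blast
  qed (simp add: mem)
  show "val (mk f) n = f n" using val_iff[OF mns, of "f n" n] mem by auto
qed

section \<open>Multiplication of monomials by adding exponents\<close>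

definition mplus :: "'a \<Rightarrow> 'a \<Rightarrow> 'a" where
  "mplus a b = mk (\<lambda>n. val a n \<boxplus> val b n)"

definition mzero :: 'a where "mzero = mk (\<lambda>n. \<^bold>0)"

definition dl :: "'a \<Rightarrow> 'a \<Rightarrow> 'a" where
  "dl n v = mk (\<lambda>i. if i = n then v else \<^bold>0)"

lemma mplus_bound: "val a n \<boxplus> val b n \<preceq> a \<boxplus> b" "val a n \<boxplus> val b n \<noteq> \<^bold>0 \<Longrightarrow> n \<preceq> a \<boxplus> b"
proof -
  show "val a n \<boxplus> val b n \<preceq> a \<boxplus> b" by (intro N.add_mono val_nle)
  assume "val a n \<boxplus> val b n \<noteq> \<^bold>0"
  then have "val a n \<noteq> \<^bold>0 \<or> val b n \<noteq> \<^bold>0" by (auto simp: add_zero)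
  then show "n \<preceq> a \<boxplus> b" using val_nle(2) nle_add_left nle_add_right N.order_trans by blast
qed

lemma mplus: "mplus a b \<in> Mns" "val (mplus a b) n = val a n \<boxplus> val b n"
  unfolding mplus_def
  by (rule mk_Mns[where k="a \<boxplus> b"], intro dec_intros Fun_val, (rule mplus_bound, assumption?)+)+

lemma Fun_mplus: "Fun (\<lambda>e. mplus (e 0) (e 1))"
  unfolding mplus_def
  by (rule Fun_mk[where k="\<lambda>e. e 0 \<boxplus> e 1"], (intro dec_intros Fun_val)+, (rule mplus_bound, assumption?)+)

lemma mzero: "mzero \<in> Mns" "val mzero n = \<^bold>0"
  unfolding mzero_def by (rule mk_Mns[where k="\<^bold>0"]; simp add: Fun_const)+

lemma dl_bound: "(if i = n then v else \<^bold>0) \<preceq> n \<boxplus> v" "(if i = n then v else \<^bold>0) \<noteq> \<^bold>0 \<Longrightarrow> i \<preceq> n \<boxplus> v"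
  by (auto simp: nle_add_left nle_add_right split: if_splits)

lemma dl: "dl n v \<in> Mns" "val (dl n v) i = (if i = n then v else \<^bold>0)"
  unfolding dl_def by (rule mk_Mns[where k="n \<boxplus> v"], intro dec_intros, (rule dl_bound, assumption?)+)+

lemma Fun_dl: "Fun s \<Longrightarrow> Fun t \<Longrightarrow> Fun (\<lambda>e. dl (s e) (t e))"
proof -
  have "Fun (\<lambda>e. dl (e 0) (e 1))"
    unfolding dl_def
    by (rule Fun_mk[where k="\<lambda>e. e 0 \<boxplus> e 1"], (intro dec_intros)+, (rule dl_bound, assumption?)+)
  then show "Fun s \<Longrightarrow> Fun t \<Longrightarrow> Fun (\<lambda>e. dl (s e) (t e))" by (rule Fun_comp2)
qed

lemma mplus_dl: "mplus (dl n v) (dl n w) = dl n (v \<boxplus> w)"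
  by (rule Mns_eqI) (simp_all add: mplus dl add_zero)

lemma dl_zero: "dl n \<^bold>0 = mzero"
  by (rule Mns_eqI) (simp_all add: dl mzero)

lemma model_monoid_Mns: "model_monoid M Mns mplus mzero"
proof
  show "Mns \<in> sets_of M" by (rule Mns_in_sets)
  show "Fun (\<lambda>e. mplus (e 0) (e 1))" by (rule Fun_mplus)
  fix a b c assume a: "a \<in> Mns" and "b \<in> Mns" "c \<in> Mns"
  show "mplus (mplus a b) c = mplus a (mplus b c)"
    by (rule Mns_eqI[OF mplus(1) mplus(1)]) (unfold mplus(2), rule add_assoc')
next
  fix a b assume a: "a \<in> Mns" and "b \<in> Mns"
  show "mplus a b = mplus b a" by (rule Mns_eqI[OF mplus(1) mplus(1)]) (unfold mplus(2), rule add_commute')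
next
  fix a assume "a \<in> Mns"
  then show "mplus mzero a = a" by (rule Mns_eqI[OF mplus(1)]) (simp only: mplus(2) mzero(2) zero_add)
qed (simp_all add: mplus mzero)

end

section \<open>Separation of disjoint \<open>\<Sigma>\<^sub>1\<close> classes\<close>

text \<open>
  \<open>A n e\<close> says that \<open>n\<close> has entered the first class by stage \<open>e\<close>, and \<open>B n i\<close> that stage
  \<open>i\<close> witnesses that \<open>n\<close> belongs to the second class. The ideal contains \<open>x\<^sub>n\<^sup>e\<close> if
  \<open>A n e\<close>, the polynomial \<open>x\<^sub>n\<^bsup>d\<^esup> - 1 = (x\<^sub>n - 1)\<^bsup>d\<^esup>\<close> with \<open>d = 2\<^bsup>i\<^esup>\<close> if \<open>i\<close> is the
  least witness for \<open>n\<close>, and \<open>x\<^sub>0 x\<^sub>1\<close>, which keeps it from being primary.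
\<close>

locale separation = rca +
  fixes A B :: "'a \<Rightarrow> 'a \<Rightarrow> bool"
  assumes Dec_A: "Dec (\<lambda>e. A (e 0) (e 1))" and Dec_B: "Dec (\<lambda>e. B (e 0) (e 1))"
    and A_mono: "A n e \<Longrightarrow> e \<preceq> e' \<Longrightarrow> A n e'"
    and A_zero: "\<not> A n \<^bold>0"
    and disjoint: "A n e \<Longrightarrow> \<not> B n e'"
    and special: "\<not> A \<^bold>0 e" "\<not> A \<^bold>1 e" "\<not> B \<^bold>0 e" "\<not> B \<^bold>1 e"
begin

text \<open>Fixing the least witness gives each \<open>n\<close> at most one modulus; otherwise
  \<open>expo_eq\<close> might fail to be transitive.\<close>

definition fst_stage :: "'a \<Rightarrow> 'a \<Rightarrow> bool" where
  "fst_stage n i \<longleftrightarrow> B n i \<and> (\<forall>j. j \<prec> i \<longrightarrow> \<not> B n j)"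

definition congr :: "'a \<Rightarrow> 'a \<Rightarrow> 'a \<Rightarrow> bool" where
  "congr d v w \<longleftrightarrow> (\<exists>q r. v \<boxplus> d \<boxdot> q = w \<boxplus> d \<boxdot> r)"

definition expo_eq :: "'a \<Rightarrow> 'a \<Rightarrow> 'a \<Rightarrow> bool" where
  "expo_eq n v w \<longleftrightarrow> v = w \<or> (\<exists>i. fst_stage n i \<and> congr (p2 i) v w)"

definition mon_eq :: "'a \<Rightarrow> 'a \<Rightarrow> bool" where
  "mon_eq a b \<longleftrightarrow> (\<forall>n. expo_eq n (val a n) (val b n))"

definition mon_dead :: "'a \<Rightarrow> bool" where
  "mon_dead a \<longleftrightarrow> (\<exists>n. A n (val a n)) \<or> (val a \<^bold>0 \<noteq> \<^bold>0 \<and> val a \<^bold>1 \<noteq> \<^bold>0)"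

lemma Dec_B': "Dec (\<lambda>e. B (e p) (e q))"
  using Dec_rename[OF Dec_B, of "case_nat p (\<lambda>_. q)"] by simp

lemma congr_cases: "congr d v w \<longleftrightarrow> (\<exists>s. v = w \<boxplus> d \<boxdot> s \<or> w = v \<boxplus> d \<boxdot> s)"
proof
  assume "congr d v w"
  then obtain q r where qr: "v \<boxplus> d \<boxdot> q = w \<boxplus> d \<boxdot> r" unfolding congr_def by blast
  consider s where "r = q \<boxplus> s" | s where "q = r \<boxplus> s" using nle_total[of q r] unfolding nle_iff_add by blast
  then show "\<exists>s. v = w \<boxplus> d \<boxdot> s \<or> w = v \<boxplus> d \<boxdot> s"
  proof cases
    case 1
    then have "v \<boxplus> d \<boxdot> q = (w \<boxplus> d \<boxdot> s) \<boxplus> d \<boxdot> q" using qr by (simp add: ring_norm)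
    then show ?thesis unfolding add_cancel by blast
  next
    case 2
    then have "(v \<boxplus> d \<boxdot> s) \<boxplus> d \<boxdot> r = w \<boxplus> d \<boxdot> r" using qr by (simp add: ring_norm)
    then show ?thesis unfolding add_cancel by blast
  qed
next
  assume "\<exists>s. v = w \<boxplus> d \<boxdot> s \<or> w = v \<boxplus> d \<boxdot> s"
  then show "congr d v w" unfolding congr_def by (metis mult_zero add_zero)
qed

text \<open>Distinct exponents congruent modulo 2^i differ by a nonzero multiple 2^i s, which is at
  least i and at least s. Hence i and s are at most \<open>v \<boxplus> w\<close>: the unbounded
  search for a stage becomes bounded.\<close>

lemma expo_eq_bounded:
  "expo_eq n v w \<longleftrightarrow> v = w \<or> (\<exists>i. i \<preceq> v \<boxplus> w \<and> fst_stage n i \<and>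
     (\<exists>s. s \<preceq> v \<boxplus> w \<and> (v = w \<boxplus> p2 i \<boxdot> s \<or> w = v \<boxplus> p2 i \<boxdot> s)))"
proof -
  have *: "i \<preceq> v \<boxplus> w \<and> s \<preceq> v \<boxplus> w" if "v \<noteq> w" "v = w \<boxplus> p2 i \<boxdot> s \<or> w = v \<boxplus> p2 i \<boxdot> s" for i s
  proof -
    have s: "s \<noteq> \<^bold>0" using that by (auto simp: mult_zero add_zero)
    then have "\<^bold>1 \<preceq> s" by (metis zero_or_suc nle_add_left)
    then have "p2 i \<boxdot> \<^bold>1 \<preceq> p2 i \<boxdot> s" by (intro N.mult_left_mono) simp_all
    then have i: "i \<preceq> p2 i \<boxdot> s" using less_p2[of i] by (simp add: nle_def) (metis N.less_trans)
    have "\<^bold>1 \<preceq> p2 i" by (metis p2_nonzero zero_or_suc nle_add_left)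
    then have "\<^bold>1 \<boxdot> s \<preceq> p2 i \<boxdot> s" by (intro N.mult_right_mono) simp_all
    then have s: "s \<preceq> p2 i \<boxdot> s" by simp
    have "p2 i \<boxdot> s \<preceq> v \<boxplus> w"
      using that(2) nle_add_left nle_add_right N.order_trans by metis
    then show ?thesis using i s N.order_trans by blast
  qed
  show ?thesis unfolding expo_eq_def congr_cases using * by blast
qed

lemma Dec_expo_eq: "Fun r \<Longrightarrow> Fun s \<Longrightarrow> Fun t \<Longrightarrow> Dec (\<lambda>e. expo_eq (r e) (s e) (t e))"
proof -
  assume r: "Fun r" and s: "Fun s" and t: "Fun t"
  have "Dec (\<lambda>e. expo_eq (e 2) (e 0) (e 1))"
    unfolding expo_eq_bounded fst_stage_def by (intro dec_intros Dec_B' Fun_p2)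
  then have "Dec (\<lambda>e. expo_eq (e 0) (e (Suc 0)) (e (Suc (Suc 0))))"
    using Dec_rename[of "\<lambda>e. expo_eq (e 2) (e 0) (e 1)" "case_nat 1 (case_nat 2 (\<lambda>_. 0))"]
    by (simp add: eval_nat_numeral)
  from Dec_subst[where Q="\<lambda>n e. expo_eq n (e 0) (e (Suc 0))",
      OF Fun_rename[OF r, of "\<lambda>i. Suc (Suc i)"] this]
  have "Dec (\<lambda>e. expo_eq (r (\<lambda>i. e (Suc (Suc i)))) (e 0) (e (Suc 0)))" .
  from Dec_subst[where Q="\<lambda>v e. expo_eq (r (\<lambda>i. e (Suc i))) v (e 0)", OF Fun_rename[OF s, of Suc] this]
  have "Dec (\<lambda>e. expo_eq (r (\<lambda>i. e (Suc i))) (s (\<lambda>i. e (Suc i))) (e 0))" .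
  from Dec_subst[where Q="\<lambda>w e. expo_eq (r e) (s e) w", OF t this] show ?thesis .
qed

lemma expo_eq_refl: "expo_eq n v v"
  unfolding expo_eq_def by simp

lemma expo_eq_sym: "expo_eq n v w \<Longrightarrow> expo_eq n w v"
  unfolding expo_eq_def congr_def by metis

lemma fst_stage_unique: "fst_stage n i \<Longrightarrow> fst_stage n j \<Longrightarrow> i = j"
  unfolding fst_stage_def by (metis N.neq_iff)

lemma expo_eq_trans: assumes "expo_eq n u v" "expo_eq n v w" shows "expo_eq n u w"
proof (cases "u = v \<or> v = w")
  case False
  then obtain i where i: "fst_stage n i" "congr (p2 i) u v" "congr (p2 i) v w"
    using assms fst_stage_unique unfolding expo_eq_def by metis
  then obtain q r q' r' where "u \<boxplus> p2 i \<boxdot> q = v \<boxplus> p2 i \<boxdot> r" "v \<boxplus> p2 i \<boxdot> q' = w \<boxplus> p2 i \<boxdot> r'"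
    unfolding congr_def by blast
  then have "u \<boxplus> p2 i \<boxdot> (q \<boxplus> q') = w \<boxplus> p2 i \<boxdot> (r' \<boxplus> r)"
    by (metis N.distrib_left add_assoc' add_commute')
  then show ?thesis using i(1) unfolding expo_eq_def congr_def by blast
qed (use assms in auto)

lemma expo_eq_add: assumes "expo_eq n v w" shows "expo_eq n (v \<boxplus> x) (w \<boxplus> x)"
proof (cases "v = w")
  case False
  then obtain i q r where "fst_stage n i" "v \<boxplus> p2 i \<boxdot> q = w \<boxplus> p2 i \<boxdot> r"
    using assms unfolding expo_eq_def congr_def by blast
  moreover from this(2) have "v \<boxplus> x \<boxplus> p2 i \<boxdot> q = w \<boxplus> x \<boxplus> p2 i \<boxdot> r"
    by (metis add_assoc' add_commute')
  ultimately show ?thesis unfolding expo_eq_def congr_def by blast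
qed (simp add: expo_eq_refl)

lemma expo_eq_A: "A n e \<Longrightarrow> expo_eq n v w \<Longrightarrow> v = w"
  unfolding expo_eq_def fst_stage_def using disjoint by blast

lemma expo_eq_special: "expo_eq \<^bold>0 v w \<Longrightarrow> v = w" "expo_eq \<^bold>1 v w \<Longrightarrow> v = w"
  unfolding expo_eq_def fst_stage_def using special by blast+

lemma model_congruence_mon: "model_congruence M Mns mplus mzero mon_dead mon_eq"
proof (intro model_congruence.intro model_monoid_Mns model_congruence_axioms.intro)
  \<comment> \<open>A variable beyond the code of a has exponent zero, and stage zero is excluded by
    \<open>A_zero\<close>; so only n up to a can matter.\<close>
  have "mon_dead a \<longleftrightarrow> (\<exists>n. n \<preceq> a \<and> A n (val a n)) \<or> (val a \<^bold>0 \<noteq> \<^bold>0 \<and> val a \<^bold>1 \<noteq> \<^bold>0)" for a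
    unfolding mon_dead_def using val_nle(2)[of a] A_zero by metis
  then show "Dec (\<lambda>e. mon_dead (e 0))"
    by (simp only:) (intro dec_intros Fun_val Dec_comp2[OF Dec_A])
  have "expo_eq n (val a n) (val b n)" if "\<not> n \<preceq> a \<boxplus> b" for a b n
  proof -
    have "\<not> n \<preceq> a" "\<not> n \<preceq> b" using that nle_add_left nle_add_right N.order_trans by blast+
    then show ?thesis using val_nle(2) expo_eq_refl by metis
  qed
  then have "mon_eq a b \<longleftrightarrow> (\<forall>n. n \<preceq> a \<boxplus> b \<longrightarrow> expo_eq n (val a n) (val b n))" for a b
    unfolding mon_eq_def by blast
  then show "Dec (\<lambda>e. mon_eq (e 0) (e 1))"
    by (simp only:) (intro dec_intros Fun_val Dec_expo_eq)
  fix a b c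
  show "mon_eq a a" unfolding mon_eq_def using expo_eq_refl by blast
  show "mon_eq a b \<Longrightarrow> mon_eq b a" unfolding mon_eq_def using expo_eq_sym by blast
  show "mon_eq a b \<Longrightarrow> mon_eq b c \<Longrightarrow> mon_eq a c" unfolding mon_eq_def using expo_eq_trans by blast
  show "mon_eq a b \<Longrightarrow> mon_eq (mplus a c) (mplus b c)"
    unfolding mon_eq_def mplus using expo_eq_add by blast
  show "mon_dead a \<Longrightarrow> mon_dead (mplus a b)"
    unfolding mon_dead_def mplus using A_mono nle_add_right
    by (metis N.add_nonneg_eq_0_iff zero_nle)
  \<comment> \<open>The cause of death lies at an n of the first class or at the variables 0 and 1.
    No modulus exists there, so equivalent monomials have the same exponent.\<close>
  show "mon_dead b" if "mon_dead a" "mon_eq a b"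
  proof -
    have eq: "expo_eq n (val a n) (val b n)" for n using that(2) unfolding mon_eq_def by blast
    show ?thesis using that(1) eq expo_eq_A expo_eq_special unfolding mon_dead_def by metis
  qed
qed

sublocale C: model_congruence M Mns mplus mzero mon_dead mon_eq
  by (rule model_congruence_mon)

section \<open>Variables, their powers and the radical\<close>

abbreviation R where "R \<equiv> C.algebra"
abbreviation I where "I \<equiv> C.kernel"
abbreviation var :: "'a \<Rightarrow> 'a" where "var n \<equiv> code {dl n \<^bold>1}"

lemma monomial: "a \<in> Mns \<Longrightarrow> code {a} \<in> C.Pol" "els (code {a}) = {a}"
  by (auto intro!: C.code_in_Pol C.Fin_single C.els_code)

text \<open>A single monomial is odd in its own class, so it can be null only by being dead.\<close>

lemma monomial_in_kernel: "a \<in> Mns \<Longrightarrow> code {a} \<in> I \<longleftrightarrow> mon_dead a"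
  unfolding C.kernel_def
  by (simp add: monomial C.null_iff odd_card_filter_single[simplified] C.E_refl)

lemma monomial_mult:
  assumes "a \<in> Mns" "b \<in> Mns" shows "code {a} \<otimes>\<^bsub>R\<^esub> code {b} = code {mplus a b}"
proof -
  have "C.pmul (code {a}) (code {b}) = code {mplus a b}"
    unfolding C.pmul_def monomial(2) C.conv_single ..
  then show ?thesis using C.algebra_simps(5) monomial(1) assms by simp
qed

lemma pw_var: "C.A.pw (var n) v = code {dl n v}"
proof (rule dec_induct[where P="\<lambda>v. C.A.pw (var n) v = code {dl n v}"])
  show "Dec (\<lambda>e. C.A.pw (var n) (e 0) = code {dl n (e 0)})"
    by (intro dec_intros C.A.Fun_pw Fun_code Ff_insert Ff_empty Fun_dl)
  show "C.A.pw (var n) \<^bold>0 = code {dl n \<^bold>0}" by (simp add: C.A.pw_zero C.algebra_simps dl_zero)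
  have v: "var n \<in> carrier R" unfolding C.algebra_simps by (rule monomial(1)[OF dl(1)])
  show "C.A.pw (var n) (v \<boxplus> \<^bold>1) = code {dl n (v \<boxplus> \<^bold>1)}" if "C.A.pw (var n) v = code {dl n v}" for v
    unfolding C.A.pw_suc[OF v] that monomial_mult[OF dl(1) dl(1)] mplus_dl ..
qed

lemma var_in_radical: assumes "A n e" shows "var n \<in> radical M R I"
proof -
  have "mon_dead (dl n e)" unfolding mon_dead_def using assms by (auto simp: dl)
  then have "C.A.pw (var n) e \<in> I" unfolding pw_var using monomial_in_kernel dl(1) by blast
  moreover have "e \<noteq> \<^bold>0" using assms A_zero by blast
  ultimately show ?thesis
    unfolding C.A.radical_iff C.algebra_simps using monomial(1) dl(1) by blast
qed

lemma var_plus_one_in_radical: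
  assumes "B n e" shows "\<one>\<^bsub>R\<^esub> \<oplus>\<^bsub>R\<^esub> var n \<in> radical M R I"
proof -
  have "Dec (\<lambda>e. B n (e 0))" using Dec_instantiate[OF Dec_B'[of 1 0], of 1 "\<lambda>_. n"] by simp
  then obtain i where i: "fst_stage n i"
    unfolding fst_stage_def using dec_least[of "B n"] assms by metis
  have v: "var n \<in> carrier R" unfolding C.algebra_simps by (rule monomial(1)[OF dl(1)])
  have "C.A.pw (\<one>\<^bsub>R\<^esub> \<oplus>\<^bsub>R\<^esub> var n) (p2 i) = \<one>\<^bsub>R\<^esub> \<oplus>\<^bsub>R\<^esub> code {dl n (p2 i)}"
    using C.A.frobenius[OF C.char_two C.A.one_closed v] C.A.pw_one by (simp add: pw_var)
  also have "\<dots> = C.padd (code {mzero}) (code {dl n (p2 i)})"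
    using monomial(1) mzero(1) dl(1) by (simp add: C.algebra_simps)
  also have "\<dots> \<in> I"
  proof -
    have eq: "mon_eq mzero (dl n (p2 i))"
      unfolding mon_eq_def
    proof
      fix m
      have "congr (p2 i) \<^bold>0 (p2 i)" unfolding congr_def
        by (rule exI[of _ "\<^bold>1"], rule exI[of _ "\<^bold>0"]) (simp add: mult_zero add_zero zero_add)
      then show "expo_eq m (val mzero m) (val (dl n (p2 i)) m)"
        using i unfolding mzero dl by (auto simp: expo_eq_def)
    qed
    \<comment> \<open>Both monomials lie in the same class and contribute to its parity
      twice.\<close>
    have "C.null (sdiff {mzero} {dl n (p2 i)})"
      unfolding C.null_def odd_card_filter_sdiff[OF C.Fin_single C.Fin_single C.Dec_E_right]
        odd_card_filter_single
      using eq C.E_sym C.E_trans by blast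
    then show ?thesis
      unfolding C.kernel_def using C.padd_closed monomial mzero(1) dl(1) by simp
  qed
  finally have "C.A.pw (\<one>\<^bsub>R\<^esub> \<oplus>\<^bsub>R\<^esub> var n) (p2 i) \<in> I" .
  moreover have "\<one>\<^bsub>R\<^esub> \<oplus>\<^bsub>R\<^esub> var n \<in> carrier R" using v by simp
  ultimately show ?thesis unfolding C.A.radical_iff using p2_nonzero by blast
qed

lemma not_dead_dl: assumes "n = \<^bold>0 \<or> n = \<^bold>1" shows "\<not> mon_dead (dl n v)"
  unfolding mon_dead_def dl using assms special A_zero by (auto split: if_splits)

theorem separating_set:
  assumes "maximal_radical_implies_primary M"
  shows "\<exists>Z\<in>sets_of M. \<forall>n e. (A n e \<longrightarrow> n \<in> Z) \<and> (B n e \<longrightarrow> n \<notin> Z)"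
proof (rule ccontr)
  assume no: "\<not> ?thesis"
  let ?K = "radical M R I"
  have K: "is_ideal R ?K" by (rule C.A.radical_ideal[OF C.char_two C.kernel_ideal])
  have "\<not> mon_dead mzero" using not_dead_dl[of "\<^bold>0" "\<^bold>0"] by (simp add: dl_zero)
  then have "\<one>\<^bsub>R\<^esub> \<notin> ?K"
    unfolding C.A.radical_iff using C.A.pw_one monomial_in_kernel mzero(1)
    by (auto simp: C.algebra_simps)
  then have K1: "?K \<noteq> carrier R" using C.A.one_closed by blast
  have "is_maximal_ideal M R ?K"
    unfolding is_maximal_ideal_def
  proof (intro conjI K K1 notI)
    assume "\<exists>J\<in>sets_of M. is_ideal R J \<and> J \<noteq> carrier R \<and> ?K \<subset> J"
    then obtain J where J: "J \<in> sets_of M" "is_ideal R J" "J \<noteq> carrier R" "?K \<subseteq> J" by blast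
    let ?Z = "{n. var n \<in> J}"
    have "?Z \<in> sets_of M"
      by (intro dec_comprehension Dec_mem J Fun_code Ff_insert Ff_empty Fun_dl dec_intros)
    moreover have "n \<in> ?Z" if "A n e" for n e using var_in_radical[OF that] J(4) by blast
    moreover have "n \<notin> ?Z" if "B n e" for n e
    proof
      assume "n \<in> ?Z"
      then have v: "var n \<in> J" "var n \<in> carrier R" using C.A.ideal_closed(1)[OF J(2)] by blast+
      have "(\<one>\<^bsub>R\<^esub> \<oplus>\<^bsub>R\<^esub> var n) \<oplus>\<^bsub>R\<^esub> var n \<in> J"
        using var_plus_one_in_radical[OF that] J(4) v(1) C.A.ideal_closed(3)[OF J(2)] by blast
      \<comment> \<open>In characteristic two the unit is the sum of 1 + x_n and x_n, so an ideal
        containing both is improper.\<close>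
      moreover have "(\<one>\<^bsub>R\<^esub> \<oplus>\<^bsub>R\<^esub> var n) \<oplus>\<^bsub>R\<^esub> var n = \<one>\<^bsub>R\<^esub>"
        using v(2) C.char_two by (simp add: C.A.a_assoc)
      ultimately show False using C.A.ideal_eq_carrier J(2,3) by simp
    qed
    ultimately show False using no by blast
  qed
  then have "is_primary M R I"
    using assms C.algebra_countable C.kernel_in_sets C.kernel_ideal
    unfolding maximal_radical_implies_primary_def by blast
  moreover have v: "var \<^bold>0 \<in> carrier R" "var \<^bold>1 \<in> carrier R"
    unfolding C.algebra_simps by (rule monomial(1)[OF dl(1)])+
  moreover have "var \<^bold>0 \<otimes>\<^bsub>R\<^esub> var \<^bold>1 \<in> I"
  proof -
    have "mon_dead (mplus (dl \<^bold>0 \<^bold>1) (dl \<^bold>1 \<^bold>1))" unfolding mon_dead_def by (simp add: mplus dl zero_add add_zero)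
    then show ?thesis unfolding monomial_mult[OF dl(1) dl(1)] using monomial_in_kernel mplus(1) by blast
  qed
  \<comment> \<open>Both alternatives fail: a monomial in x_0 alone or in x_1 alone is never dead,
    by \<open>special\<close> and \<open>A_zero\<close>.\<close>
  ultimately have "var \<^bold>0 \<in> I \<or> (\<exists>n. C.A.pw (var \<^bold>1) n \<in> I)" unfolding C.A.is_primary_iff by blast
  then show False unfolding pw_var using monomial_in_kernel dl(1) not_dead_dl by blast
qed

end

section \<open>Separation gives weak Koenig's lemma\<close>

context rca
begin

text \<open>Unbounded search is legitimate because a solution always exists; being the least
  solution is decidable, hence so is the graph.\<close>

lemma Fun_least:
  assumes Q: "Dec (\<lambda>e. Q (e 0) (\<lambda>i. e (Suc i)))" and ex: "\<And>e. \<exists>y. Q y e"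
  obtains f where "Fun f" "\<And>e. Q (f e) e"
proof
  let ?f = "\<lambda>e. THE y. Q y e \<and> (\<forall>z. z \<prec> y \<longrightarrow> \<not> Q z e)"
  have inst: "Dec (\<lambda>e'. Q (e' 0) e)" for e
    using Dec_instantiate[OF Q, of 1 "\<lambda>i. e (i - 1)"] by simp
  have ex1: "\<exists>!y. Q y e \<and> (\<forall>z. z \<prec> y \<longrightarrow> \<not> Q z e)" for e
  proof -
    obtain w where "Q w e" using ex by blast
    then obtain y where "Q y e" "\<And>z. z \<prec> y \<Longrightarrow> \<not> Q z e"
      using dec_least[of "\<lambda>y. Q y e", OF inst] by metis
    then show ?thesis by (intro ex1I[of _ y]) (auto, metis N.neq_iff)
  qed
  have "y = ?f e \<longleftrightarrow> Q y e \<and> (\<forall>z. z \<prec> y \<longrightarrow> \<not> Q z e)" for y e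
  proof
    show "y = ?f e \<Longrightarrow> Q y e \<and> (\<forall>z. z \<prec> y \<longrightarrow> \<not> Q z e)" by (erule ssubst) (rule theI'[OF ex1])
    show "Q y e \<and> (\<forall>z. z \<prec> y \<longrightarrow> \<not> Q z e) \<Longrightarrow> y = ?f e" by (rule the1_equality[OF ex1, symmetric])
  qed
  moreover have "Dec (\<lambda>e. Q (e 0) (\<lambda>i. e (Suc (Suc i))))"
    using Dec_rename[OF Q, of "case_nat 0 (\<lambda>i. i + 2)"] by simp
  ultimately show "Fun ?f" unfolding Fun_def by (simp only:) (intro dec_intros Q)
  show "Q (?f e) e" for e using theI'[OF ex1[of e]] by blast
qed

text \<open>A set below \<open>k\<close> is described by a product of some of the moduli with index
  below \<open>k\<close>. The product of all of them, \<open>pd k k\<close>, is at least as large,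
  so the corresponding triple bounds the canonical code. The bound is needed to quantify over
  sequences of given length.\<close>

lemma Fun_code_bound:
  obtains b where "Fun (\<lambda>e. b (e 0))" "\<And>k X. Fin X \<Longrightarrow> (\<And>i. i \<in> X \<Longrightarrow> i \<prec> k) \<Longrightarrow> code X \<preceq> b k"
proof -
  let ?Q = "\<lambda>m e. m \<noteq> \<^bold>0 \<and> (\<forall>j. j \<prec> e 0 \<longrightarrow> dv (j \<boxplus> \<^bold>1) m)"
  obtain f where f: "Fun f" "\<And>e. ?Q (f e) e"
    by (rule Fun_least[of ?Q]) (intro dec_intros Dec_dv, rule common_multiple, blast)
  define mm where "mm k = f (\<lambda>_. k)" for k
  have mm: "Fun (\<lambda>e. mm (e n))" for n unfolding mm_def by (rule Fun_rename[OF f(1)])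
  have m: "mm k \<noteq> \<^bold>0" "\<And>j. j \<prec> k \<Longrightarrow> dv (j \<boxplus> \<^bold>1) (mm k)" for k
    using f(2)[of "\<lambda>_. k"] unfolding mm_def by blast+
  define pd where "pd k l = nrec \<^bold>1 (\<lambda>i y. y \<boxdot> modulus (mm k) i) l" for k l
  have F: "Fun (\<lambda>e. e 1 \<boxdot> modulus (mm k) (e 0))" for k by (intro dec_intros)
  have pd0: "pd k \<^bold>0 = \<^bold>1" and pdS: "pd k (l \<boxplus> \<^bold>1) = pd k l \<boxdot> modulus (mm k) l" for k l
    unfolding pd_def using nrec_zero[OF F] nrec_suc[OF F] by simp_all
  have code: "code X \<preceq> pr k (pr (mm k) (pd k k))" if fin: "Fin X" "\<And>i. i \<in> X \<Longrightarrow> i \<prec> k" for X k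
  proof -
    have X: "X \<in> sets_of M" using fin unfolding Fin_def by blast
    have "\<exists>n. n \<preceq> pd k k \<and> (\<forall>i. i \<prec> k \<longrightarrow> (dv (modulus (mm k) i) n \<longleftrightarrow> i \<in> X \<and> i \<prec> k))"
    proof (rule beta_aux[OF m X, where P="\<lambda>n l. n \<preceq> pd k l"])
      show "Dec (\<lambda>e. e 0 \<preceq> pd k (e 1))" unfolding pd_def by (intro dec_intros Fun_nrec)
      show "n \<preceq> pd k (l \<boxplus> \<^bold>1)" if "n \<preceq> pd k l" for n l
      proof -
        have "pd k l \<boxdot> \<^bold>1 \<preceq> pd k l \<boxdot> modulus (mm k) l" by (intro N.mult_left_mono nle_add_left) simp
        then show ?thesis using that unfolding pdS by (simp add: N.order_trans[OF that])
      qed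
      show "n \<boxdot> modulus (mm k) l \<preceq> pd k (l \<boxplus> \<^bold>1)" if "n \<preceq> pd k l" for n l
        unfolding pdS using that by (intro N.mult_right_mono) simp_all
    qed (simp_all add: pd0)
    then obtain n where n: "n \<preceq> pd k k"
      "\<And>i. i \<prec> k \<Longrightarrow> (dv (modulus (mm k) i) n \<longleftrightarrow> i \<in> X \<and> i \<prec> k)" by blast
    have "els (pr k (pr (mm k) n)) = X"
      by (rule Set.set_eqI) (unfold mem_els_pr, use n(2) fin(2) in blast)
    moreover have "is_triple M (pr k (pr (mm k) n))" unfolding is_triple_def by blast
    ultimately obtain c where c: "finite_set_code M c" "els c = X" "c \<preceq> pr k (pr (mm k) n)"
      using ex_finite_set_code[OF fin(1)] by blast
    have "code X = c" using c code_els by blast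
    moreover have "pr k (pr (mm k) n) \<preceq> pr k (pr (mm k) (pd k k))" using n(1) by (intro pr_mono) simp_all
    ultimately show ?thesis using c(3) by (simp add: N.order_trans)
  qed
  have "Fun (\<lambda>e. pr (e 0) (pr (mm (e 0)) (pd (e 0) (e 0))))"
    unfolding pd_def
    by (intro dec_intros mm Fun_nrec[where h="\<lambda>i y e. y \<boxdot> modulus (mm (e 0)) i" and g="\<lambda>_. \<^bold>1"])
  then show ?thesis using that[of "\<lambda>k. pr k (pr (mm k) (pd k k))"] code by blast
qed

lemma separation_of_classes:
  assumes prim: "maximal_radical_implies_primary M"
    and A: "Dec (\<lambda>e. A (e 0) (e 1))" and B: "Dec (\<lambda>e. B (e 0) (e 1))"
    and disj: "\<And>n m m'. A n m \<Longrightarrow> \<not> B n m'"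
  shows "\<exists>Z\<in>sets_of M. \<forall>n m. (A n m \<longrightarrow> n \<in> Z) \<and> (B n m \<longrightarrow> n \<notin> Z)"
proof -
  \<comment> \<open>Shifting indices by two reserves 0 and 1 for the two extra variables. Collecting
    the witnesses m below e makes the first class monotone in the stage and empty at stage zero, as
    the locale demands.\<close>
  define A' where "A' n e \<longleftrightarrow> (\<exists>k. k \<prec> n \<and> (n = k \<boxplus> \<^bold>1 \<boxplus> \<^bold>1 \<and> (\<exists>m. m \<prec> e \<and> A k m)))" for n e
  define B' where "B' n e \<longleftrightarrow> (\<exists>k. k \<prec> n \<and> (n = k \<boxplus> \<^bold>1 \<boxplus> \<^bold>1 \<and> B k e))" for n e
  have A1: "Dec (\<lambda>e. A (e p) (e q))" and B1: "Dec (\<lambda>e. B (e p) (e q))" for p q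
    using Dec_rename[OF A, of "case_nat p (\<lambda>_. q)"] Dec_rename[OF B, of "case_nat p (\<lambda>_. q)"]
    by simp_all
  have less: "k \<prec> k \<boxplus> \<^bold>1 \<boxplus> \<^bold>1" for k by (simp add: less_suc)
  have ne: "k \<boxplus> \<^bold>1 \<boxplus> \<^bold>1 \<noteq> \<^bold>0" "k \<boxplus> \<^bold>1 \<boxplus> \<^bold>1 \<noteq> \<^bold>1" for k
    using suc_not_zero suc_inject[of "k \<boxplus> \<^bold>1" "\<^bold>0"] by (auto simp: zero_add)
  interpret separation M A' B'
  proof
    show "Dec (\<lambda>e. A' (e 0) (e 1))" unfolding A'_def by (intro dec_intros A1)
    show "Dec (\<lambda>e. B' (e 0) (e 1))" unfolding B'_def by (intro dec_intros B1)
    fix n e e'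
    show "A' n e \<Longrightarrow> e \<preceq> e' \<Longrightarrow> A' n e'" unfolding A'_def using N.less_le_trans by blast
    show "\<not> A' n \<^bold>0" unfolding A'_def using not_less_zero by blast
    show "A' n e \<Longrightarrow> \<not> B' n e'"
      unfolding A'_def B'_def using disj suc_inject by blast
    show "\<not> A' \<^bold>0 e" "\<not> A' \<^bold>1 e" "\<not> B' \<^bold>0 e" "\<not> B' \<^bold>1 e"
      unfolding A'_def B'_def using ne by metis+
  qed
  obtain Z where Z: "Z \<in> sets_of M" "\<And>n e. A' n e \<Longrightarrow> n \<in> Z" "\<And>n e. B' n e \<Longrightarrow> n \<notin> Z"
    using separating_set[OF prim] by blast
  let ?Z = "{n. n \<boxplus> \<^bold>1 \<boxplus> \<^bold>1 \<in> Z}"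
  have "?Z \<in> sets_of M" by (intro dec_comprehension Dec_mem Z dec_intros)
  moreover have "A n m \<Longrightarrow> A' (n \<boxplus> \<^bold>1 \<boxplus> \<^bold>1) (m \<boxplus> \<^bold>1)" for n m
    unfolding A'_def using less less_suc by blast
  moreover have "B n m \<Longrightarrow> B' (n \<boxplus> \<^bold>1 \<boxplus> \<^bold>1) m" for n m
    unfolding B'_def using less by blast
  ultimately show ?thesis using Z(2,3) by (intro bexI[of _ ?Z]) blast+
qed

section \<open>A path guided by a separating set\<close>

definition child :: "'a \<Rightarrow> 'a \<Rightarrow> 'a \<Rightarrow> 'a" where
  "child c l b = code (insert (pr l b) (els c))"

lemma els_child: "els (child c l b) = insert (pr l b) (els c)"
  unfolding child_def by (intro Fin_code Fin_insert Fin_els)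

lemma Fun_child: "Fun r \<Longrightarrow> Fun s \<Longrightarrow> Fun t \<Longrightarrow> Fun (\<lambda>e. child (r e) (s e) (t e))"
  unfolding child_def by (intro Fun_code Ff_insert Ff_els Fun_pr)

lemma binary_seq_mem:
  "binary_seq M s l \<Longrightarrow> z \<in> els s \<Longrightarrow> \<exists>i. i \<prec> l \<and> (z = pr i \<^bold>0 \<or> z = pr i \<^bold>1)"
  unfolding binary_seq_iff by blast

lemma binary_seq_index: "binary_seq M s l \<Longrightarrow> pr i y \<in> els s \<Longrightarrow> i \<prec> l \<and> (y = \<^bold>0 \<or> y = \<^bold>1)"
  unfolding binary_seq_iff by fastforce

lemma binary_seq_eqI:
  assumes "binary_seq M s l" "binary_seq M t l" "els s \<subseteq> els t" shows "s = t"
proof -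
  have "bits s = bits t"
    using binary_seq_length_mono(2)[OF assms] mem_bits[of _ t] binary_seq_index[OF assms(2)] by blast
  then show ?thesis using binary_seq_bseq_bits[OF assms(1)] binary_seq_bseq_bits[OF assms(2)] by simp
qed

lemma bits_in_sets: "bits c \<in> sets_of M"
  using Ff_Fin[OF Ff_bits[OF Fun_const]] unfolding Fin_def by blast

lemma els_restrict:
  assumes s: "binary_seq M s l" and m: "m \<preceq> l"
  shows "pr i y \<in> els (bseq (bits s) m) \<longleftrightarrow> i \<prec> m \<and> pr i y \<in> els s"
proof -
  have il: "i \<prec> l" if "i \<prec> m" using that m by (rule N.less_le_trans)
  have b: "i \<in> bits s \<longleftrightarrow> pr i \<^bold>1 \<in> els s" by (rule mem_bits)
  have v: "i \<prec> m \<Longrightarrow> pr i \<^bold>0 \<in> els s \<longleftrightarrow> pr i \<^bold>1 \<notin> els s" using s il unfolding binary_seq_iff by blast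
  show ?thesis
  proof (cases "y = \<^bold>0 \<or> y = \<^bold>1")
    case True
    then show ?thesis using pr_mem_bseq[OF bits_in_sets] b v by blast
  next
    case False
    then show ?thesis
      using binary_seq_index[OF s] binary_seq_index[OF binary_seq_bseq[OF bits_in_sets]] by blast
  qed
qed

text \<open>To have extensions of every length is a Pi_1 property of a node and cannot steer a
  recursion. The separating set can: it knows which child dies first, and where neither child dies
  any answer will do.\<close>

theorem primary_imp_wkl:
  assumes prim: "maximal_radical_implies_primary M"
  shows "weak_koenig_lemma M"
  unfolding weak_koenig_lemma_def
proof (intro ballI impI)
  fix T assume T: "T \<in> sets_of M" and "binary_tree M T \<and> unbounded M T"
  then have tree: "binary_tree M T" and unb: "unbounded M T" by blast+
  obtain cb where cb: "Fun (\<lambda>e. cb (e 0))"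
    "\<And>k X. Fin X \<Longrightarrow> (\<And>i. i \<in> X \<Longrightarrow> i \<prec> k) \<Longrightarrow> code X \<preceq> cb k" by (rule Fun_code_bound) blast
  \<comment> \<open>The pairs of a binary sequence of length at most m are at most pr m 1, hence
    below pr m 1 + 1; so \<open>b m\<close> bounds the code.\<close>
  define b where "b m = cb (pr m \<^bold>1 \<boxplus> \<^bold>1)" for m
  have Fb: "Fun (\<lambda>e. b (t e))" if "Fun t" for t
    unfolding b_def by (rule Fun_comp[where f=cb, OF cb(1)]) (intro dec_intros that)
  have bound: "s \<preceq> b m" if s: "binary_seq M s l" and l: "l \<preceq> m" for s l m
  proof -
    have "z \<prec> pr m \<^bold>1 \<boxplus> \<^bold>1" if z: "z \<in> els s" for z
    proof -
      obtain i where i: "i \<prec> l" "z = pr i \<^bold>0 \<or> z = pr i \<^bold>1"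
        using binary_seq_mem[OF s] z by blast
      then have "i \<preceq> m" using N.less_le_trans[OF _ l] unfolding nle_def by blast
      then show ?thesis using i(2) pr_mono[of i m] unfolding less_suc_iff by (auto simp: nle_def[of "\<^bold>1"])
    qed
    then have "code (els s) \<preceq> b m" unfolding b_def by (intro cb(2) Fin_els)
    then show ?thesis using code_els[of s] s by (simp add: binary_seq_def)
  qed
  \<comment> \<open>An extension of c at level m of the tree; the bound on its code keeps this
    decidable.\<close>
  define alive where "alive c m \<longleftrightarrow> (\<exists>s. s \<preceq> b m \<and> (s \<in> T \<and> binary_seq M s m \<and> els c \<subseteq> els s))" for c m
  have aliveI: "alive c m" if "s \<in> T" "binary_seq M s m" "els c \<subseteq> els s" for c m s
    unfolding alive_def using that bound nle_def by blast
  have Dec_alive: "Dec (\<lambda>e. alive (s e) (t e))" if "Fun s" "Fun t" for s t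
  proof (rule Dec_comp2[OF _ that])
    show "Dec (\<lambda>e. alive (e 0) (e 1))" unfolding alive_def
      by (intro dec_intros Fb Dec_mem T Dec_binary_seq Dec_subset_Ff Ff_els)
  qed
  have restrict: "bseq (bits s) m \<in> T" if s: "s \<in> T" "binary_seq M s l" "m \<preceq> l" for s l m
  proof -
    have "els (bseq (bits s) m) \<subseteq> els s"
    proof
      fix z assume z: "z \<in> els (bseq (bits s) m)"
      then obtain i where "z = pr i \<^bold>0 \<or> z = pr i \<^bold>1"
        using binary_seq_mem[OF binary_seq_bseq[OF bits_in_sets, of s m]] by blast
      then show "z \<in> els s" using z els_restrict[OF s(2,3)] by blast
    qed
    then show ?thesis
      using tree s(1) binary_seq_bseq[OF bits_in_sets] unfolding binary_tree_def by blast
  qed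
  have alive_down: "alive c m" if a: "alive c m'" and m: "m \<preceq> m'" and c: "\<And>z. z \<in> els c \<Longrightarrow> \<exists>i y. i \<prec> m \<and> z = pr i y" for c m m'
  proof -
    obtain s where s: "s \<in> T" "binary_seq M s m'" "els c \<subseteq> els s" using a unfolding alive_def by blast
    have "els c \<subseteq> els (bseq (bits s) m)"
    proof
      fix z assume z: "z \<in> els c"
      then obtain i y where "i \<prec> m" "z = pr i y" using c by blast
      then show "z \<in> els (bseq (bits s) m)" using els_restrict[OF s(2) m] z s(3) by blast
    qed
    then show ?thesis
      using aliveI restrict[OF s(1,2) m] binary_seq_bseq[OF bits_in_sets] by blast
  qed
  \<comment> \<open>At level m the child x has no extension left while the child y still has one.
    Existential quantification over m gives the Sigma_1 classes to be separated.\<close>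
  define dies where "dies n x y m \<longleftrightarrow> (\<exists>l. l \<preceq> n \<and> (\<exists>c. c \<preceq> n \<and> (n = pr l c \<and> binary_seq M c l \<and>
      \<not> alive (child c l x) m \<and> alive (child c l y) m)))" for n x y m
  have diesI: "dies (pr l c) x y m"
    if "binary_seq M c l" "\<not> alive (child c l x) m" "alive (child c l y) m" for c l x y m
    unfolding dies_def using that pr_bounds by blast
  have disj: "\<not> (dies n x y m \<and> dies n y x m')" if "m \<preceq> m'" for n x y m m'
  proof
    assume "dies n x y m \<and> dies n y x m'"
    then obtain l c where n: "n = pr l c" and c: "binary_seq M c l"
      and m: "\<not> alive (child c l x) m" "alive (child c l y) m" and m': "alive (child c l x) m'"
      unfolding dies_def by auto
    obtain s where s: "binary_seq M s m" "els (child c l y) \<subseteq> els s" using m(2) unfolding alive_def by blast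
    \<comment> \<open>An extension of length m that contains an entry at l forces l < m, so the
      entries of both children fit below m and \<open>alive_down\<close> applies.\<close>
    then have lm: "l \<prec> m" using binary_seq_index unfolding els_child by blast
    have "\<exists>i y. i \<prec> m \<and> z = pr i y" if z: "z \<in> els (child c l x)" for z
    proof (cases "z = pr l x")
      case False
      then obtain i where "i \<prec> l" "z = pr i \<^bold>0 \<or> z = pr i \<^bold>1"
        using z binary_seq_mem[OF c, of z] unfolding els_child by blast
      then show ?thesis using N.less_trans[OF _ lm] by blast
    qed (use lm in blast)
    then show False using alive_down[OF m' \<open>m \<preceq> m'\<close>] m(1) by blast
  qed
  have Dec_dies: "Dec (\<lambda>e. dies (e 0) x y (e 1))" for x y
    unfolding dies_def by (intro dec_intros Dec_binary_seq Dec_alive Fun_child)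
  have "\<not> dies n \<^bold>1 \<^bold>0 m'" if "dies n \<^bold>0 \<^bold>1 m" for n m m'
    using disj[of m m' n "\<^bold>0" "\<^bold>1"] disj[of m' m n "\<^bold>1" "\<^bold>0"] nle_total[of m m'] that by blast
  then obtain Z where Z: "Z \<in> sets_of M" "\<And>n m. dies n \<^bold>0 \<^bold>1 m \<Longrightarrow> n \<in> Z" "\<And>n m. dies n \<^bold>1 \<^bold>0 m \<Longrightarrow> n \<notin> Z"
    using separation_of_classes[OF prim Dec_dies Dec_dies, of "\<^bold>0" "\<^bold>1" "\<^bold>1" "\<^bold>0"] by blast
  \<comment> \<open>Z contains the nodes whose child 0 dies first, hence the bit 1 there.\<close>
  define bit where "bit n c = (if pr n c \<in> Z then \<^bold>1 else \<^bold>0)" for n c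
  have Fbit: "Fun (\<lambda>e. bit (s e) (t e))" if "Fun s" "Fun t" for s t
    unfolding bit_def by (intro dec_intros Dec_mem Z that)
  define node where "node n = nrec (code {}) (\<lambda>n c. child c n (bit n c)) n" for n
  have step: "Fun (\<lambda>e. child (e 1) (e 0) (bit (e 0) (e 1)))" by (intro Fun_child Fbit dec_intros)
  have node0: "node \<^bold>0 = code {}" and nodeS: "node (n \<boxplus> \<^bold>1) = child (node n) n (bit n (node n))" for n
    unfolding node_def using nrec_zero[OF step] nrec_suc[OF step] by simp_all
  have Fnode: "Fun (\<lambda>e. node (t e))" if "Fun t" for t
    unfolding node_def
    by (rule Fun_nrec[where h="\<lambda>n c _. child c n (bit n c)" and g="\<lambda>_. code {}"])
      (intro step Fun_const that)+
  define f where "f n = bit n (node n)" for n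
  have Ff: "Fun (\<lambda>e. f (t e))" if "Fun t" for t unfolding f_def by (intro Fbit Fnode that)
  have f01: "f n = \<^bold>0 \<or> f n = \<^bold>1" for n unfolding f_def bit_def by simp
  have els_node: "z \<in> els (node n) \<longleftrightarrow> (\<exists>i. i \<prec> n \<and> z = pr i (f i))" for z n
  proof (rule dec_induct[where P="\<lambda>n. z \<in> els (node n) \<longleftrightarrow> (\<exists>i. i \<prec> n \<and> z = pr i (f i))"])
    show "Dec (\<lambda>e. z \<in> els (node (e 0)) \<longleftrightarrow> (\<exists>i. i \<prec> e 0 \<and> z = pr i (f i)))"
      by (intro dec_intros Ff_intros Fnode Ff)
    show "z \<in> els (node \<^bold>0) \<longleftrightarrow> (\<exists>i. i \<prec> \<^bold>0 \<and> z = pr i (f i))"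
      using Fin_code(2)[OF Fin_empty] by (simp add: node0 not_less_zero)
    show "z \<in> els (node (n \<boxplus> \<^bold>1)) \<longleftrightarrow> (\<exists>i. i \<prec> n \<boxplus> \<^bold>1 \<and> z = pr i (f i))"
      if "z \<in> els (node n) \<longleftrightarrow> (\<exists>i. i \<prec> n \<and> z = pr i (f i))" for n
      unfolding nodeS els_child less_suc insert_iff that f_def[symmetric] by blast
  qed
  have code_node: "finite_set_code M (node n)" for n
  proof (cases "n = \<^bold>0")
    case True
    then show ?thesis using Fin_code(1)[OF Fin_empty] by (simp add: node0)
  next
    case False
    then obtain k where "n = k \<boxplus> \<^bold>1" using zero_or_suc by blast
    then show ?thesis unfolding child_def nodeS by (simp add: nodeS child_def Fin_code(1) Fin_insert Fin_els)
  qed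
  have seq_node: "binary_seq M (node n) n" for n
  proof -
    have "\<exists>i. i \<prec> n \<and> (z = pr i \<^bold>0 \<or> z = pr i \<^bold>1)" if "z \<in> els (node n)" for z
      using that f01 unfolding els_node by metis
    moreover have "pr i \<^bold>0 \<in> els (node n) \<longleftrightarrow> pr i \<^bold>1 \<notin> els (node n)" if "i \<prec> n" for i
      using that f01[of i] N.zero_neq_one unfolding els_node by (metis pr_inject)
    ultimately show ?thesis unfolding binary_seq_iff using code_node by blast
  qed
  have alive_node: "n \<preceq> m \<longrightarrow> alive (node n) m" for m n
  proof (rule pi_induct[where A="\<lambda>m n. n \<preceq> m \<longrightarrow> alive (node n) m"])
    show "Dec (\<lambda>e. e 1 \<preceq> e 0 \<longrightarrow> alive (node (e 1)) (e 0))" by (intro dec_intros Dec_alive Fnode)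
    fix m
    \<comment> \<open>A node with code above \<open>b m\<close> must be longer than m; its
      restriction to length m witnesses that the root is alive at m.\<close>
    obtain s where s: "s \<in> T" "\<not> s \<prec> b m \<boxplus> \<^bold>1" using unb unfolding unbounded_def by blast
    then obtain l where l: "binary_seq M s l" using tree unfolding binary_tree_def by blast
    have "m \<preceq> l"
    proof (rule ccontr)
      assume "\<not> m \<preceq> l"
      then have "l \<preceq> m" using nle_total by blast
      then show False using bound[OF l] s(2) less_suc_iff by blast
    qed
    then have "alive (node \<^bold>0) m"
      using aliveI[OF restrict[OF s(1) l] binary_seq_bseq[OF bits_in_sets]]
        Fin_code(2)[OF Fin_empty] by (simp add: node0)
    then show "\<^bold>0 \<preceq> m \<longrightarrow> alive (node \<^bold>0) m" by blast
  next
    fix n assume IH: "\<forall>m. n \<preceq> m \<longrightarrow> alive (node n) m"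
    show "\<forall>m. n \<boxplus> \<^bold>1 \<preceq> m \<longrightarrow> alive (node (n \<boxplus> \<^bold>1)) m"
    proof (intro allI impI, rule ccontr)
      fix m assume m: "n \<boxplus> \<^bold>1 \<preceq> m" and dead: "\<not> alive (node (n \<boxplus> \<^bold>1)) m"
      let ?c = "node n"
      have nm: "n \<prec> m" using m unfolding suc_nle_iff .
      then have "alive ?c m" using IH nle_def by blast
      then obtain s where s: "s \<in> T" "binary_seq M s m" "els ?c \<subseteq> els s" unfolding alive_def by blast
      \<comment> \<open>The extension s passes through one of the two children. If the chosen child
        were dead at m, the other one would be alive, and \<open>dies\<close> would put the node on
        the opposite side of Z.\<close>
      have "alive (child ?c n y) m" if "pr n y \<in> els s" for y
        by (rule aliveI[OF s(1,2)]) (use that s(3) in \<open>simp add: els_child\<close>)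
      moreover have "pr n \<^bold>0 \<in> els s \<or> pr n \<^bold>1 \<in> els s" using s(2) nm unfolding binary_seq_iff by blast
      ultimately have ch: "alive (child ?c n \<^bold>0) m \<or> alive (child ?c n \<^bold>1) m" by metis
      show False
      proof (cases "pr n ?c \<in> Z")
        case True
        then have "\<not> alive (child ?c n \<^bold>1) m" using dead unfolding nodeS bit_def by simp
        then have "dies (pr n ?c) \<^bold>1 \<^bold>0 m" using ch seq_node diesI by blast
        then show False using Z(3) True by blast
      next
        case False
        then have "\<not> alive (child ?c n \<^bold>0) m" using dead unfolding nodeS bit_def by simp
        then have "dies (pr n ?c) \<^bold>0 \<^bold>1 m" using ch seq_node diesI by blast
        then show False using Z(2) False by blast
      qed
    qed
  qed
  have node_T: "node n \<in> T" for n
  proof -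
    \<comment> \<open>At level n an extension of the node has the same length and is the node
      itself.\<close>
    have "alive (node n) n" using alive_node nle_def by blast
    then obtain s where s: "s \<in> T" "binary_seq M s n" "els (node n) \<subseteq> els s" unfolding alive_def by blast
    then show ?thesis using binary_seq_eqI[OF seq_node s(2,3)] by simp
  qed
  let ?F = "{pr n (f n) |n. n \<in> UNIV}"
  have "?F = {z. \<exists>n. n \<preceq> z \<and> z = pr n (f n)}" using pr_bounds(1) by blast
  also have "\<dots> \<in> sets_of M" by (intro dec_comprehension dec_intros Ff)
  finally have F: "?F \<in> sets_of M" .
  have fY: "f n \<in> {\<^bold>0, \<^bold>1}" for n using f01 by blast
  have "els (node n) = {pr i (app M ?F i) |i. i \<prec> n}" for n
  proof -
    have "app M ?F i = f i" for i by (rule is_fun_graph(2)[where Y="{\<^bold>0, \<^bold>1}"]) (simp_all add: fY[simplified])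
    then show ?thesis using els_node[of _ n] by auto
  qed
  then have "path_through M T ?F"
    unfolding path_through_def using is_fun_graph(1)[of UNIV f "{\<^bold>0, \<^bold>1}"] fY node_T seq_node by blast
  then show "\<exists>F\<in>sets_of M. path_through M T F" using F by blast
qed

end

theorem theorem4p10:
  fixes M :: "'a l2_structure"
  assumes "RCA0 M"
  shows "WKL0 M \<longleftrightarrow> maximal_radical_implies_primary M"
proof -
  interpret rca M by unfold_locales (rule assms)
  show ?thesis
    unfolding WKL0_def using assms wkl_maximal_radical_implies_primary primary_imp_wkl by blast
qed

end
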